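(* For every positive integer $n$, $\operatorname{diam}(\mathcal{T}_n) = 2n-2$, where $\mathcal{T}_n$ is the flip-graph of the once-punctured disk with $n$ marked points on its boundary.
   Context: Let $\Delta^\star$ be the closed disk with one puncture in its interior, the puncture being viewed as a marked point. For $n\ge 1$, let $\Delta^\star_n$ be the surface obtained from $\Delta^\star$ by placing $n$ (distinct, labelled) marked points on the boundary curve. Thus $\Delta^\star_n$ is a disk with $n$ boundary marked points and one interior marked point (the puncture). Arcs are considered up to isotopy fixing the marked points. They are simple, have their endpoints at marked points (possibly the same marked point for both endpoints, i.e. loops are allowed), contain no marked point in their interior, and are not contractible to a point. Two arcs are non-crossing if they can be realized with disjoint interiors. A triangulation of $\Delta^\star_n$ is a maximal set of pairwise non-crossing, pairwise non-isotopic arcs (including the boundary arcs between consecutive boundary marked points); it always has exactly $n$ interior (non-boundary) arcs. The flip-graph $\mathcal{T}_n$ has as vertices the isotopy classes of triangulations of $\Delta^\star_n$, and two of them are joined by an edge exactly when they differ by a single arc (equivalently, one is obtained from the other by a flip: exchanging the two diagonals of a quadrilateral formed by two neighbouring triangles). The diameter $\operatorname{diam}$ of a connected graph is the largest graph distance between two of its vertices. *)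

theory Defs
  imports "HOL-Analysis.Analysis" "HOL-Library.Extended_Nat"
begin

section \<open>Arcs in the once-punctured disk\<close>

text \<open>
  The surface is the closed unit disk of the complex plane with the origin as the puncture, and
  \<open>P\<close> is the set of marked points on the unit circle.  The puncture is itself a marked point, so
  it belongs to the disk and arcs may end there.
\<close>

definition marked_points :: "complex set \<Rightarrow> complex set" where
  "marked_points P = insert 0 P"

text \<open>
  The predicate \<^const>\<open>simple_path\<close> admits loops.  An arc may run along the boundary circle away from
  \<open>P\<close>: the boundary arcs do so.  The last conjunct says that the arc is not contractible to a
  point in the disk, where its base point is fixed and the other marked points are obstacles; it
  is automatic when the two endpoints differ.
\<close>

definition marked_arc :: "complex set \<Rightarrow> (real \<Rightarrow> complex) \<Rightarrow> bool" where
  "marked_arc P g \<longleftrightarrow>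
     simple_path g \<and> path_image g \<subseteq> cball 0 1 \<and>
     pathstart g \<in> marked_points P \<and> pathfinish g \<in> marked_points P \<and>
     g ` {0<..<1} \<inter> marked_points P = {} \<and>
     \<not> homotopic_paths (cball 0 1 - (marked_points P - {pathstart g})) g
         (linepath (pathstart g) (pathstart g))"

text \<open>Isotopy fixing the marked points: a homotopy with fixed endpoints through arcs.\<close>

definition isotopic_arcs :: "complex set \<Rightarrow> (real \<Rightarrow> complex) \<Rightarrow> (real \<Rightarrow> complex) \<Rightarrow> bool" where
  "isotopic_arcs P g h \<longleftrightarrow>
     homotopic_with_canon
       (\<lambda>r. marked_arc P r \<and> pathstart r = pathstart g \<and> pathfinish r = pathfinish g)
       {0..1} (cball 0 1) g h"

text \<open>Arcs are unoriented, hence the reversed path.\<close>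

definition isotopy_rel :: "complex set \<Rightarrow> ((real \<Rightarrow> complex) \<times> (real \<Rightarrow> complex)) set" where
  "isotopy_rel P =
     {(g, h). marked_arc P g \<and> marked_arc P h \<and>
              (isotopic_arcs P g h \<or> isotopic_arcs P g (reversepath h))}"

definition arc_classes :: "complex set \<Rightarrow> (real \<Rightarrow> complex) set set" where
  "arc_classes P = Collect (marked_arc P) // isotopy_rel P"

definition noncrossing :: "(real \<Rightarrow> complex) set \<Rightarrow> (real \<Rightarrow> complex) set \<Rightarrow> bool" where
  "noncrossing A B \<longleftrightarrow> (\<exists>g\<in>A. \<exists>h\<in>B. g ` {0<..<1} \<inter> h ` {0<..<1} = {})"


section \<open>Triangulations and the flip-graph\<close>

definition arc_system :: "complex set \<Rightarrow> (real \<Rightarrow> complex) set set \<Rightarrow> bool" where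
  "arc_system P T \<longleftrightarrow> T \<subseteq> arc_classes P \<and> pairwise noncrossing T"

text \<open>
  The classes of the boundary arcs belong to every triangulation, by maximality, since they are
  non-crossing with every class.
\<close>

definition triangulations :: "complex set \<Rightarrow> (real \<Rightarrow> complex) set set set" where
  "triangulations P = {T. arc_system P T \<and> (\<forall>T'. arc_system P T' \<and> T \<subseteq> T' \<longrightarrow> T' = T)}"

definition flips ::
  "complex set \<Rightarrow> ((real \<Rightarrow> complex) set set \<times> (real \<Rightarrow> complex) set set) set" where
  "flips P = {(T, T'). T \<in> triangulations P \<and> T' \<in> triangulations P \<and>
                       is_singleton (T - T') \<and> is_singleton (T' - T)}"

text \<open>
  The graph with vertex set \<open>V\<close> and adjacency relation \<open>E\<close>.  The distance between vertices in
  different components is \<open>\<infinity>\<close>, so a finite diameter includes connectedness.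
\<close>

definition graph_distance :: "('v \<times> 'v) set \<Rightarrow> 'v \<Rightarrow> 'v \<Rightarrow> enat" where
  "graph_distance E u v = (INF k\<in>{k. (u, v) \<in> E ^^ k}. enat k)"

definition graph_diameter :: "'v set \<Rightarrow> ('v \<times> 'v) set \<Rightarrow> enat" where
  "graph_diameter V E = (SUP (u, v)\<in>V \<times> V. graph_distance E u v)"

end

theory Submission
  imports Defs "HOL-Complex_Analysis.Complex_Analysis"
begin

text \<open>
  The map \<open>w \<mapsto> exp (\<i> w)\<close> from the closed upper half-plane unrolls the punctured disk, and the marked
  points become a sequence on the real line indexed by the integers, with period \<open>n\<close>.  An arc
  between boundary points is isotopic to the image of a parabola over the interval between its
  lifted end points: pushed off the circle, it bounds a Jordan domain upstairs together with a low
  graph, and by the Schoenflies theorem it can be moved across this domain to the graph.  An arc that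
  ends at the puncture is isotopic to a radius by Alexander's trick.  Thus arcs become chords and
  spokes on the integers modulo translation by \<open>n\<close>, and two classes cross if and only if some lifts
  interlace.

  For the upper bound, every triangulation without a full set of \<open>n\<close> spokes has a flip that adds a
  spoke, so the star of spokes is at distance at most \<open>n - 1\<close> from every triangulation.  For the lower
  bound, two opposite fans are compared by induction on \<open>n\<close>: contracting a boundary edge turns a path of
  flips into a path for \<open>n - 1\<close> in which every flip of the triangle at the contracted edge becomes
  trivial, and at least two such flips occur.
\<close>

section \<open>The Schoenflies theorem for the inside of a Jordan curve\<close>

text \<open>Arcs are isotopic only if every intermediate curve is again a simple arc, so a mere
  homotopy is not enough; this is what calls for a planar homeomorphism theorem. Only the closed
  inside of a Jordan curve is needed: a Riemann map is extended to the boundary, and in the round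
  disk Alexander's trick straightens any arc with both ends on the circle to a chord. Two arcs with
  the same ends thus become the same chord. Conversely, distinct orbits give distinct classes
  because the end points and the displacement of a lift, read off as a winding number about the
  puncture, survive isotopy; crossings survive because interlaced paths in the half-plane must meet.
  In the lower bound, the triangle on the edge from 1 to 2 has apex -1 in one fan and
  \<open>n\<close> in the other. Losing the first triangle and acquiring the second are different
  flips, because a translate of the chord from 1 to \<open>n\<close> crosses both sides that end at
  -1.\<close>

lemma maximum_principle_frontier:
  fixes f :: "complex \<Rightarrow> complex"
  assumes hol: "f holomorphic_on W" and W: "open W" "bounded W"
    and fr: "\<And>x e. x \<in> frontier W \<Longrightarrow> 0 < e \<Longrightarrow> \<exists>d>0. \<forall>z\<in>W \<inter> ball x d. norm (f z) \<le> M + e"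
    and z: "z \<in> W"
  shows "norm (f z) \<le> M"
proof (rule ccontr)
  assume "\<not> norm (f z) \<le> M"
  define e where "e = (norm (f z) - M) / 2"
  have e: "e > 0" "M + e < norm (f z)"
    using \<open>\<not> norm (f z) \<le> M\<close> by (auto simp: e_def field_simps)
  \<comment> \<open>The frontier bound keeps \<open>K\<close> away from the frontier of
    \<open>W\<close>, so \<open>K\<close> is compact and the norm of \<open>f\<close> attains its
    maximum over \<open>W\<close> there.\<close>
  define K where "K = {w \<in> W. norm (f z) \<le> norm (f w)}"
  have contf: "continuous_on W f"
    using hol holomorphic_on_imp_continuous_on by blast
  have clK: "closed K"
    unfolding closed_limpt
  proof (intro allI impI)
    fix x assume x: "x islimpt K"
    have xcl: "x \<in> closure W"
      using x islimpt_subset[of x K W] by (auto simp: K_def closure_def)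
    have "x \<in> W"
    proof (rule ccontr)
      assume "x \<notin> W"
      then have "x \<in> frontier W" using xcl W by (simp add: frontier_def interior_open)
      then obtain d where d: "d > 0" "\<forall>z\<in>W \<inter> ball x d. norm (f z) \<le> M + e"
        using fr e by blast
      obtain w where "w \<in> K" "w \<in> ball x d"
        using x d(1) unfolding islimpt_def by (metis centre_in_ball open_ball)
      then show False using d e by (force simp: K_def)
    qed
    obtain s where s: "\<And>n. s n \<in> K" "s \<longlonglongrightarrow> x"
      using x islimpt_sequential by (metis DiffD1)
    have "(f \<circ> s) \<longlonglongrightarrow> f x"
      using contf \<open>x \<in> W\<close> s unfolding continuous_on_sequentially by (auto simp: K_def)
    then have "(\<lambda>n. norm (f (s n))) \<longlonglongrightarrow> norm (f x)"
      by (auto simp: o_def intro: tendsto_norm)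
    then have "norm (f z) \<le> norm (f x)"
      by (rule LIMSEQ_le_const) (use s in \<open>auto simp: K_def\<close>)
    then show "x \<in> K" using \<open>x \<in> W\<close> by (simp add: K_def)
  qed
  then have cK: "compact K"
    using W(2) bounded_subset[of W K] by (auto simp: K_def compact_eq_bounded_closed)
  have "z \<in> K" using z by (simp add: K_def)
  have "continuous_on K (\<lambda>w. norm (f w))"
    using contf by (intro continuous_on_norm) (auto simp: K_def intro: continuous_on_subset)
  then obtain x where x: "x \<in> K" "\<And>w. w \<in> K \<Longrightarrow> norm (f w) \<le> norm (f x)"
    using continuous_attains_sup[OF cK] \<open>z \<in> K\<close> by blast
  have xmax: "norm (f w) \<le> norm (f x)" if "w \<in> W" for w
    using x that by (force simp: K_def)
  \<comment> \<open>The level set of a maximal value is open by the local maximum principle, and it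
    is also compact and nonempty, which is impossible in the plane.\<close>
  define N where "N = {w \<in> W. f w = f x}"
  have NK: "N \<subseteq> K" using x by (auto simp: N_def K_def)
  have "closed N"
  proof -
    have "N = K \<inter> f -` {f x}" using NK by (auto simp: N_def K_def)
    moreover have "closed (K \<inter> f -` {f x})"
      by (rule continuous_closed_preimage) (use contf clK in \<open>auto simp: K_def intro: continuous_on_subset\<close>)
    ultimately show ?thesis by simp
  qed
  then have "compact N" using NK cK
    by (metis closed_Int_compact inf.absorb1)
  moreover have "open N"
    unfolding open_contains_ball
  proof
    fix w assume w: "w \<in> N"
    then obtain d where d: "d > 0" "ball w d \<subseteq> W"
      using W(1) unfolding N_def open_contains_ball by auto
    have "f constant_on ball w d"
      by (rule maximum_modulus_principle[where U = "ball w d" and \<xi> = w])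
         (use d hol xmax w in \<open>auto simp: N_def intro: holomorphic_on_subset\<close>)
    then have "ball w d \<subseteq> N"
      using w d by (auto simp: constant_on_def N_def subset_iff)
    then show "\<exists>d>0. ball w d \<subseteq> N" using d by blast
  qed
  moreover have "N \<noteq> {}" using x by (auto simp: N_def K_def)
  ultimately show False
    by (metis compact_open)
qed

section \<open>Koebe's lemma: small values on continua near the circle\<close>

lemma connected_component_joinI:
  assumes "connected S" "S \<subseteq> T" "a \<in> S" "b \<in> S"
  shows "connected_component T a b"
  using assms connected_component_def by blast

lemma closure_touch:
  fixes W :: "'a::metric_space set"
  assumes "x \<in> closure W" "d > 0"
  obtains w where "w \<in> W" "w \<in> ball x d"
  using assms by (metis closure_approachable dist_commute mem_ball)

text \<open>Suppose \<open>W\<close> touched both sides. Leaving the disk through \<open>A2\<close>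
  joins 0 to the exterior point 2 off \<open>E \<union> A1\<close>, and leaving through
  \<open>A1\<close> joins them off \<open>E \<union> A2\<close>. The two obstacles meet in the
  connected set \<open>E\<close>, so by Janiszewski's theorem 0 and 2 are joined off their union,
  which contains the whole circle.\<close>

lemma disc_continuum_separates:
  fixes E W A1 A2 :: "complex set"
  assumes E: "compact E" "connected E" and A: "closed A1" "closed A2" "A1 \<union> A2 = sphere 0 1"
    and AE: "A1 \<inter> A2 \<subseteq> E" "E \<inter> sphere 0 1 \<subseteq> A1 \<inter> A2" "E \<subseteq> cball 0 1"
    and W: "connected W" "0 \<in> W" "W \<inter> E = {}" "W \<subseteq> ball 0 1"
    and x: "x1 \<in> closure W" "x1 \<in> A1 - A2" and y: "x2 \<in> closure W" "x2 \<in> A2 - A1"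
  shows False
proof -
  have main: "connected_component (- (E \<union> A1)) 0 2"
    if xx: "x2 \<in> closure W" "x2 \<in> A2 - A1" and A: "closed A1" "closed A2" "A1 \<union> A2 = sphere 0 1"
      and AE: "A1 \<inter> A2 \<subseteq> E" "E \<inter> sphere 0 1 \<subseteq> A1 \<inter> A2"
    for x2 A1 A2
  proof -
    have n2: "norm x2 = 1" using xx A by force
    have sph: "A1 \<inter> W = {}" "A1 \<subseteq> cball 0 1"
      using A(3) W(4) by (force simp: set_eq_iff)+
    have "x2 \<notin> E \<union> A1" using xx AE n2 by auto
    moreover have "open (- (E \<union> A1))" using E A compact_imp_closed by blast
    ultimately obtain d where d: "d > 0" "ball x2 d \<subseteq> - (E \<union> A1)"
      by (meson ComplI openE)
    obtain w where w: "w \<in> W" "w \<in> ball x2 d"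
      using closure_touch[OF xx(1) d(1)] by blast
    \<comment> \<open>A point just outside the disk beyond \<open>x2\<close>; the small ball around
      \<open>x2\<close> joins it to \<open>W\<close> and avoids the obstacle.\<close>
    define y where "y = of_real (1 + d/2) * x2"
    have y: "y \<in> ball x2 d" "norm y > 1"
    proof -
      have "dist x2 y = norm (of_real (d/2) * x2)"
        by (simp add: y_def dist_norm algebra_simps norm_mult[symmetric] norm_minus_commute)
      then show "y \<in> ball x2 d" using d(1) n2 by (simp add: norm_mult)
      show "norm y > 1" unfolding y_def norm_mult norm_of_real n2 using d(1) by simp
    qed
    have "connected_component (- (E \<union> A1)) 0 w"
      by (rule connected_component_joinI[of W]) (use W w sph in auto)
    moreover have "connected_component (- (E \<union> A1)) w y"
      by (rule connected_component_joinI[of "ball x2 d"]) (use w d y in auto)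
    moreover have "connected_component (- (E \<union> A1)) y 2"
    proof (rule connected_component_joinI[of "- cball 0 1"])
      show "connected (- cball (0::complex) 1)"
        by (rule connected_complement_bounded_convex) auto
      show "- cball 0 1 \<subseteq> - (E \<union> A1)" using assms(8) sph by auto
    qed (use y in auto)
    ultimately show ?thesis
      by (meson connected_component_trans)
  qed
    have "connected_component (- ((E \<union> A1) \<union> (E \<union> A2))) 0 2"
    proof (rule Janiszewski)
      show "compact (E \<union> A1)"
        using E A by (metis closed_Int_compact compact_Un compact_sphere inf_sup_absorb sup_commute Int_commute)
      show "closed (E \<union> A2)" using E A compact_imp_closed by blast
      have "(E \<union> A1) \<inter> (E \<union> A2) = E" using AE by auto
      then show "connected ((E \<union> A1) \<inter> (E \<union> A2))" using E by simp
      show "connected_component (- (E \<union> A1)) 0 2"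
        using main[of x2 A2 A1] y A AE by auto
      show "connected_component (- (E \<union> A2)) 0 2"
        using main[of x1 A1 A2] x A AE by (auto simp: Un_commute)
    qed
    then obtain C where C: "connected C" "C \<subseteq> - ((E \<union> A1) \<union> (E \<union> A2))" "0 \<in> C" "2 \<in> C"
      unfolding connected_component_def by blast
    have "C \<inter> frontier (ball 0 1) \<noteq> {}"
      by (rule connected_Int_frontier) (use C in auto)
    then show False using C A by (auto simp: frontier_def)
qed

text \<open>The domains \<open>W\<close> never reach the circle near \<open>om\<close>. With a pole
  \<open>c\<close> just outside the disk near \<open>om\<close>, the weight
  \<open>1 / dist z c ^ k\<close> is much larger near \<open>om\<close> than on \<open>A\<close>.
  Bounding \<open>G\<close> divided by \<open>(z - c) ^ k\<close> on \<open>W\<close>, and letting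
  first \<open>e\<close> shrink and then \<open>k\<close> grow, makes \<open>G\<close> vanish near
  \<open>om\<close>; the identity theorem does the rest.\<close>

lemma vanishing_of_small_frontier_values:
  fixes G :: "complex \<Rightarrow> complex"
  assumes hol: "G holomorphic_on ball 0 1" and N: "\<And>z. norm z < 1 \<Longrightarrow> norm (G z) \<le> N"
    and A: "closed A" and om: "norm om = 1" "om \<notin> A"
    and W: "\<And>e. 0 < e \<Longrightarrow> e < 1 \<Longrightarrow>
      \<exists>W. open W \<and> W \<subseteq> ball 0 1 \<and> ball 0 (1 - e) \<subseteq> W \<and> closure W \<inter> sphere 0 1 \<subseteq> A \<and>
          (\<forall>z\<in>frontier W \<inter> ball 0 1. norm (G z) \<le> e)"
    and z: "norm z < 1"
  shows "G z = 0"
proof -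
  have "open (- A)" using A by blast
  then obtain d where d: "d > 0" "ball om d \<subseteq> - A"
    using om by (meson ComplI openE)
  have dA: "d \<le> dist om y" if "y \<in> A" for y
    using d(2) that by (meson ComplD in_mono mem_ball not_le)
  \<comment> \<open>All of \<open>A\<close> lies at distance at least \<open>3 * d/4\<close> from
    \<open>c\<close>, while points within \<open>d/4\<close> of \<open>om\<close> lie at distance
    less than \<open>d/2\<close>; the quotient below 1 is what is raised to the power
    \<open>k\<close>.\<close>
  define c where "c = of_real (1 + d/4) * om"
  have cn: "norm c = 1 + d/4" using om d by (simp add: c_def norm_mult del: of_real_add)
  have comc: "dist om c = d/4"
  proof -
    have "dist om c = norm (of_real (d/4) * om)"
      by (simp add: c_def dist_norm algebra_simps norm_mult[symmetric] norm_minus_commute)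
    then show ?thesis using om d by (simp add: norm_mult)
  qed
  have far: "3 * d/4 \<le> dist y c" if "y \<in> A" for y
    using dA[OF that] comc dist_triangle[of om y c] by (simp add: dist_commute)
  have out: "d/4 \<le> dist y c" if "norm y \<le> 1" for y
    using that cn norm_triangle_ineq2[of c y] by (simp add: dist_norm norm_minus_commute)
  have N0: "N \<ge> 0" using N[of 0] norm_ge_zero[of "G 0"] by (simp del: norm_ge_zero)
  have vanish: "G z0 = 0" if z0: "norm z0 < 1" "dist om z0 < d/4" for z0
  proof -
    have z0c: "dist z0 c < d/2" using z0 comc dist_triangle[of z0 c om] by (simp add: dist_commute)
    have z0p: "dist z0 c > 0" using out[of z0] z0 d by linarith
    have bound: "norm (G z0) / dist z0 c ^ k \<le> N / (3*d/4)^k" for k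
    proof (rule field_le_epsilon)
      fix e0 :: real assume e0: "e0 > 0"
      \<comment> \<open>The choice depends on \<open>k\<close>: it puts \<open>z0\<close> inside
        \<open>W\<close>, and on the frontier inside the disk it makes the quotient at most
        \<open>e0/2\<close> although the denominator may be as small as
        \<open>(d/4)^k\<close>.\<close>
      define e where "e = min (min (1/2) ((1 - norm z0)/2)) (e0/2 * (d/4)^k)"
      have "e \<le> 1/2" and e3: "e \<le> (1 - norm z0)/2" "e \<le> e0/2 * (d/4)^k"
        unfolding e_def by (meson min.cobounded1 min.cobounded2 order_trans)+
      moreover have "e > 0" using e0 z0 d by (simp add: e_def)
      ultimately have e: "e > 0" "e < 1" "e \<le> (1 - norm z0)/2" "e \<le> e0/2 * (d/4)^k"
        by auto
      obtain W where Wo: "open W" "W \<subseteq> ball 0 1" "ball 0 (1 - e) \<subseteq> W" "closure W \<inter> sphere 0 1 \<subseteq> A"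
          "\<And>z. z \<in> frontier W \<inter> ball 0 1 \<Longrightarrow> norm (G z) \<le> e"
        using W[OF e(1,2)] by blast
      define F where "F = (\<lambda>z. G z / (z - c) ^ k)"
      have cW: "z \<noteq> c" if "norm z \<le> 1" for z
        using out[OF that] d by auto
      have holF: "F holomorphic_on ball 0 1"
        unfolding F_def by (intro holomorphic_intros hol) (use cW in auto)
      have "norm (F z0) \<le> N / (3*d/4)^k + e0/2"
      proof (rule maximum_principle_frontier[where W = W and f = F])
        show "F holomorphic_on W" using holF Wo holomorphic_on_subset by blast
        show "open W" "bounded W" using Wo bounded_subset[OF bounded_ball] by blast+
        show "z0 \<in> W" using Wo(3) e(1,3) z0 by (force simp: field_simps)
        fix x and e1 :: real assume x: "x \<in> frontier W" and e1: "e1 > 0"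
        have xcl: "x \<in> closure W" using x by (simp add: frontier_def)
        then have "x \<in> cball 0 1" using Wo(2) closure_mono[of W "ball 0 1"] by (auto simp: closure_ball)
        then have x1: "norm x \<le> 1" by simp
        consider "norm x < 1" | "norm x = 1" using x1 by linarith
        then show "\<exists>d'>0. \<forall>z\<in>W \<inter> ball x d'. norm (F z) \<le> N / (3*d/4)^k + e0/2 + e1"
        proof cases
          case 1
          have "norm (G x) \<le> e" using Wo(5)[of x] x 1 by auto
          moreover have "(d/4)^k \<le> dist x c ^ k" using out[OF x1] d by (intro power_mono) auto
          ultimately have "norm (G x) / dist x c ^ k \<le> e / (d/4)^k"
            using d e(1) by (intro frac_le) auto
          also have "\<dots> \<le> e0/2" using e(4) d by (simp add: field_simps)
          finally have Fx: "norm (F x) \<le> e0/2" by (simp add: F_def norm_divide norm_power dist_norm)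
          have "isCont F x"
            using holF 1 holomorphic_on_imp_continuous_on[of F "ball 0 1"] continuous_on_interior[of "ball 0 1" F x]
            by auto
          then obtain d' where "d' > 0" "\<And>z. dist z x < d' \<Longrightarrow> dist (F z) (F x) < e1"
            using e1 unfolding continuous_at_eps_delta by blast
          moreover have "norm (F z) \<le> N / (3*d/4)^k + e0/2 + e1" if "dist (F z) (F x) < e1" for z
          proof -
            have "norm (F z) \<le> norm (F x) + dist (F z) (F x)"
              by (metis dist_norm norm_triangle_sub)
            moreover have "N / (3*d/4)^k \<ge> 0" using N0 d by simp
            ultimately show ?thesis using Fx that by linarith
          qed
          ultimately show ?thesis by (metis IntD2 dist_commute mem_ball)
        next
          case 2
          then have "x \<in> A" using Wo(4) xcl by auto
          then have fx: "3*d/4 \<le> dist x c" by (rule far)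
          have xc: "x \<noteq> c" using cW x1 by blast
          define H where "H = (\<lambda>z. N / dist z c ^ k)"
          have "isCont H x" unfolding H_def using xc by (intro continuous_intros) auto
          then obtain d' where d': "d' > 0" "\<And>z. dist z x < d' \<Longrightarrow> dist (H z) (H x) < e1"
            using e1 unfolding continuous_at_eps_delta by blast
          have Hx: "H x \<le> N / (3*d/4)^k"
            unfolding H_def using fx d N0 by (intro divide_left_mono power_mono mult_pos_pos zero_less_power) auto
          have "norm (F z) \<le> N / (3*d/4)^k + e0/2 + e1" if "z \<in> W \<inter> ball x d'" for z
          proof -
            have "norm (F z) \<le> H z"
              unfolding F_def H_def norm_divide norm_power dist_norm
              by (rule divide_right_mono) (use that Wo(2) N[of z] in auto)
            moreover have "dist (H z) (H x) < e1" using d'(2)[of z] that by (simp add: dist_commute)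
            ultimately show ?thesis using Hx e0 by (simp add: dist_real_def)
          qed
          then show ?thesis using d' by blast
        qed
      qed
      then show "norm (G z0) / dist z0 c ^ k \<le> N / (3*d/4)^k + e0"
        using e0 by (simp add: F_def norm_divide norm_power dist_norm)
    qed
    define r where "r = dist z0 c / (3*d/4)"
    have r: "0 \<le> r" "r < 1" using z0c z0p d by (auto simp: r_def field_simps)
    have "norm (G z0) \<le> N * r ^ k" for k
      using bound[of k] z0p d by (simp add: r_def field_simps power_mult_distrib)
    moreover have "(\<lambda>k. N * r ^ k) \<longlonglongrightarrow> N * 0"
      by (intro tendsto_mult tendsto_const LIMSEQ_power_zero) (use r in auto)
    ultimately have "norm (G z0) \<le> N * 0"
      by (intro LIMSEQ_le_const) auto
    then show ?thesis by simp
  qed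
  have "open (ball 0 1 \<inter> ball om (d/4))" by auto
  moreover have "ball 0 1 \<inter> ball om (d/4) \<noteq> {}"
  proof -
    have "om \<in> closure (ball 0 1)" using om by simp
    then obtain w where "w \<in> ball 0 1" "w \<in> ball om (d/4)"
      using closure_touch[of om "ball 0 1" "d/4"] d(1) by auto
    then show ?thesis by auto
  qed
  ultimately show ?thesis
    using analytic_continuation_open[of "ball 0 1 \<inter> ball om (d/4)" "ball 0 1" G "\<lambda>_. 0" z] vanish hol z
    by (auto simp: dist_commute)
qed

lemma circle_cut_by_chord:
  fixes z1 z2 :: complex
  assumes "norm z1 = 1" "norm z2 = 1" "z1 \<noteq> z2"
  obtains A1 A2 where "closed A1" "closed A2" "A1 \<union> A2 = sphere 0 1" "A1 \<inter> A2 = {z1, z2}"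
    "\<not> A1 \<subseteq> A2" "\<not> A2 \<subseteq> A1"
proof -
  define D where "D = z2 - z1"
  define l where "l = (\<lambda>z. Im ((z - z1) * cnj D))"
  have D: "D \<noteq> 0" using assms by (simp add: D_def)
  have n1: "(Re z1)\<^sup>2 + (Im z1)\<^sup>2 = 1" and n2: "(Re z2)\<^sup>2 + (Im z2)\<^sup>2 = 1"
    using assms cmod_power2[of z1] cmod_power2[of z2] by auto
  have lc: "continuous_on UNIV l" unfolding l_def by (intro continuous_intros)
  define A1 where "A1 = sphere 0 1 \<inter> {z. l z \<ge> 0}"
  define A2 where "A2 = sphere 0 1 \<inter> {z. l z \<le> 0}"
  have dis: "2 * Re (z1 * cnj D) = - (norm D)\<^sup>2"
    using n1 n2 unfolding cmod_power2 by (simp add: D_def algebra_simps power2_eq_square)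
  have im: "\<bar>Im (z1 * cnj D)\<bar> < norm D"
  proof -
    have "(norm (z1 * cnj D))\<^sup>2 = (norm D)\<^sup>2" using assms by (simp add: norm_mult)
    then have "(Re (z1 * cnj D))\<^sup>2 + (Im (z1 * cnj D))\<^sup>2 = (norm D)\<^sup>2" by (simp only: cmod_power2)
    moreover have "Re (z1 * cnj D) \<noteq> 0"
    proof
      assume "Re (z1 * cnj D) = 0"
      then have "- (norm D)\<^sup>2 = 0" using dis by linarith
      then show False using D by simp
    qed
    ultimately have "(Im (z1 * cnj D))\<^sup>2 < (norm D)\<^sup>2"
      by (smt (verit) zero_less_power2)
    then show ?thesis using abs_le_square_iff[of "norm D" "Im (z1 * cnj D)"] by force
  qed
  \<comment> \<open>A unit normal of the chord. The line through \<open>z1\<close> and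
    \<open>z2\<close> passes the origin at distance less than 1, so \<open>w\<close> and
    \<open>- w\<close> lie strictly on its two sides.\<close>
  define w where "w = \<i> * D / of_real (norm D)"
  have nw: "norm w = 1" using D by (simp add: w_def norm_mult norm_divide)
  have "w * cnj D = \<i> * of_real (norm D)"
  proof -
    have aux: "n \<noteq> 0 \<Longrightarrow> \<i> * (n * n) / n = \<i> * n" for n :: complex by simp
    have eq1: "w * cnj D = \<i> * (D * cnj D) / of_real (norm D)" by (simp add: w_def)
    have eq2: "D * cnj D = of_real (norm D) * of_real (norm D)"
      by (simp add: complex_norm_square[symmetric] power2_eq_square[symmetric])
    have nz: "complex_of_real (norm D) \<noteq> 0" using D by simp
    show ?thesis unfolding eq1 eq2 by (rule aux[OF nz])
  qed
  then have "Im (w * cnj D) = norm D" "Im (- w * cnj D) = - norm D"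
    by (simp_all only: mult_minus_left) simp_all
  moreover have "l x = Im (x * cnj D) - Im (z1 * cnj D)" for x
    unfolding l_def left_diff_distrib by (rule minus_complex.simps(2))
  ultimately have lw: "l w > 0" "l (- w) < 0"
    using im by (simp_all only:)
  have meet: "z = z1 \<or> z = z2" if z: "norm z = 1" "l z = 0" for z
  proof -
    define t where "t = Re ((z - z1) / D)"
    have "Im ((z - z1) / D) = 0" using z(2) by (simp add: l_def Im_complex_div_eq_0)
    then have "(z - z1) / D = of_real t" by (simp add: t_def complex_eq_iff)
    then have zt: "z = z1 + of_real t * D" using D by (simp add: field_simps)
    have "(norm z)\<^sup>2 = (norm z1)\<^sup>2 + t * (2 * Re (z1 * cnj D)) + t\<^sup>2 * (norm D)\<^sup>2"
      unfolding zt cmod_power2 by (simp add: power2_eq_square algebra_simps)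
    then have "t * (t - 1) * (norm D)\<^sup>2 = 0"
      using z assms unfolding dis by (simp add: power2_eq_square algebra_simps)
    then have "t = 0 \<or> t = 1" using D by simp
    then show ?thesis using zt by (auto simp: D_def)
  qed
  show thesis
  proof
    show "closed A1" "closed A2" unfolding A1_def A2_def
      by (intro closed_Int closed_sphere closed_Collect_le continuous_on_const lc)+
    show "A1 \<union> A2 = sphere 0 1" by (auto simp: A1_def A2_def)
    have "l z1 = 0" "l z2 = 0" by (auto simp: l_def D_def algebra_simps)
    then show "A1 \<inter> A2 = {z1, z2}" using meet assms by (force simp: A1_def A2_def)
    show "\<not> A1 \<subseteq> A2" using lw nw by (force simp: A1_def A2_def)
    have "- w \<in> A2" "- w \<notin> A1" using lw nw by (auto simp: A1_def A2_def)
    then show "\<not> A2 \<subseteq> A1" by blast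
  qed
qed

lemma frontier_component_subset:
  fixes S :: "'a::real_normed_vector set"
  assumes "open S"
  shows "frontier (connected_component_set S x) \<inter> S = {}"
proof -
  have oC: "open (connected_component_set S x)" using assms by (rule open_connected_component)
  have "y \<in> connected_component_set S x" if y: "y \<in> closure (connected_component_set S x)" "y \<in> S" for y
  proof -
    obtain d where d: "d > 0" "ball y d \<subseteq> S" using y assms open_contains_ball by blast
    obtain w where w: "w \<in> connected_component_set S x" "w \<in> ball y d" using closure_touch[OF y(1) d(1)] by blast
    have "connected_component S w y"
      by (rule connected_component_joinI[of "ball y d"]) (use d w in auto)
    then show ?thesis using w(1) connected_component_trans by fastforce
  qed
  then show ?thesis using oC by (auto simp: frontier_def interior_open)
qed

text \<open>Koebe's lemma.  The continuum and two short segments to the circle shield one side of the circle from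
  the origin.  The maximum principle is applied to \<open>h z * (z - z1) * (z - z2)\<close>, divided by a high power of
  \<open>z - c\<close> for a point \<open>c\<close> outside the disc.\<close>

lemma vanishing_of_small_values_on_continua:
  fixes h :: "complex \<Rightarrow> complex"
  assumes hol: "h holomorphic_on ball 0 1" and M: "\<And>z. norm z < 1 \<Longrightarrow> norm (h z) \<le> M"
    and z12: "norm z1 = 1" "norm z2 = 1" "z1 \<noteq> z2"
    and K: "\<And>e. 0 < e \<Longrightarrow> \<exists>K. compact K \<and> connected K \<and> K \<subseteq> ball 0 1 \<and>
       K \<inter> ball z1 e \<noteq> {} \<and> K \<inter> ball z2 e \<noteq> {} \<and> (\<forall>z\<in>K. norm (h z) \<le> e \<and> 1 - e < norm z)"
    and z: "norm z < 1"
  shows "h z = 0"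
proof -
  \<comment> \<open>On the segments that join the continuum to \<open>z1\<close> and
    \<open>z2\<close>, only the global bound \<open>M\<close> on \<open>h\<close> is available; the
    factor \<open>q\<close> makes the product small there.\<close>
  define q where "q = (\<lambda>z. (z - z1) * (z - z2))"
  define G where "G = (\<lambda>z. h z * q z)"
  have M0: "M \<ge> 0" using M[of 0] norm_ge_zero[of "h 0"] by (simp del: norm_ge_zero)
  have holG: "G holomorphic_on ball 0 1"
    unfolding G_def q_def by (intro holomorphic_intros hol)
  have d2: "norm (z - w) \<le> 2" if "norm z \<le> 1" "norm w \<le> 1" for z w :: complex
    using norm_triangle_ineq4[of z w] that by simp
  have q4: "norm (q z) \<le> 4" if "norm z < 1" for z
  proof -
    have "norm (q z) \<le> 2 * 2" unfolding q_def norm_mult by (intro mult_mono d2) (use that z12 in auto)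
    then show ?thesis by simp
  qed
  have N: "norm (G z) \<le> M * 4" if "norm z < 1" for z
    unfolding G_def norm_mult by (intro mult_mono M q4) (use that M0 in auto)
  obtain A1 A2 where A: "closed A1" "closed A2" "A1 \<union> A2 = sphere 0 1" "A1 \<inter> A2 = {z1, z2}"
      "\<not> A1 \<subseteq> A2" "\<not> A2 \<subseteq> A1"
    using circle_cut_by_chord[OF z12] by blast
  define good where "good = (\<lambda>A e. \<exists>W. open W \<and> W \<subseteq> ball 0 1 \<and> ball 0 (1 - e) \<subseteq> W \<and>
     closure W \<inter> sphere 0 1 \<subseteq> A \<and> (\<forall>z\<in>frontier W \<inter> ball 0 1. norm (G z) \<le> e))"
  have good: "good A1 e \<or> good A2 e" if e: "0 < e" "e < 1" for e
  proof -
    \<comment> \<open>With this constant both estimates below stay within \<open>e\<close>: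
      \<open>4 * e'\<close> on \<open>K\<close>, where \<open>q\<close> is bounded by 4, and
      \<open>2 * M * e'\<close> on the segments, where \<open>h\<close> is bounded by
      \<open>M\<close>.\<close>
    define e' where "e' = e / (4 + 2 * M)"
    have e': "e' > 0" "e' \<le> e" "e' * 4 \<le> e" "M * (e' * 2) \<le> e"
    proof -
      show "e' > 0" using e M0 by (simp add: e'_def)
      have "e' * (4 + 2 * M) = e" using M0 by (simp add: e'_def)
      then have "e' * 4 + M * (e' * 2) = e" by (simp add: algebra_simps)
      moreover have "M * (e' * 2) \<ge> 0" using \<open>e' > 0\<close> M0 by simp
      ultimately show "e' * 4 \<le> e" "e' \<le> e" "M * (e' * 2) \<le> e"
        using \<open>e' > 0\<close> by linarith+
    qed
    obtain K where K: "compact K" "connected K" "K \<subseteq> ball 0 1" "K \<inter> ball z1 e' \<noteq> {}" "K \<inter> ball z2 e' \<noteq> {}"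
      "\<And>z. z \<in> K \<Longrightarrow> norm (h z) \<le> e' \<and> 1 - e' < norm z"
      using K[OF e'(1)] by blast
    obtain x1 x2 where x: "x1 \<in> K" "x1 \<in> ball z1 e'" "x2 \<in> K" "x2 \<in> ball z2 e'" using K by blast
    define E where "E = K \<union> closed_segment x1 z1 \<union> closed_segment x2 z2"
    have seg: "z = v \<or> (norm z < 1 \<and> dist z v < e')"
      if "z \<in> closed_segment x v" "x \<in> K" "x \<in> ball v e'" "norm v = 1" for x z v
    proof -
      have "z = x \<or> z = v \<or> z \<in> open_segment x v" using that(1) by (auto simp: open_segment_def)
      moreover have "norm z < 1" if "z \<in> open_segment x v"
      proof -
        have "x \<in> interior (cball 0 1)" using \<open>x \<in> K\<close> K(3) by auto
        moreover have "v \<in> closure (cball 0 1)" using \<open>norm v = 1\<close> by auto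
        ultimately have "open_segment x v \<subseteq> interior (cball 0 1)"
          by (intro in_interior_closure_convex_segment) auto
        then show ?thesis using that by auto
      qed
      moreover have "dist z v < e'"
        using dist_in_closed_segment[OF that(1), THEN conjunct2] that(3) by (simp add: dist_commute)
      ultimately show ?thesis using \<open>x \<in> K\<close> K(3) by auto
    qed
    have Eball: "E \<subseteq> cball 0 1" and Esph: "E \<inter> sphere 0 1 \<subseteq> {z1, z2}"
      using seg x z12 K(3) by (fastforce simp: E_def)+
    have Enear: "1 - e < norm z" if "z \<in> E" for z
    proof -
      have near: "1 - e' < norm z" if "dist z v < e'" "norm v = 1" for v
        using that norm_triangle_ineq2[of v z] by (simp add: dist_norm norm_minus_commute)
      show ?thesis
        using that seg[of z x1 z1] seg[of z x2 z2] x z12 K(6)[of z] near[of z1] near[of z2] e e' unfolding E_def by fastforce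
    qed
    have EG: "norm (G z) \<le> e" if zE: "z \<in> E" and "norm z < 1" for z
    proof -
      consider "z \<in> K" | "dist z z1 < e'" | "dist z z2 < e'"
        using zE seg[OF _ x(1,2) z12(1)] seg[OF _ x(3,4) z12(2)] e'(1) unfolding E_def by (metis UnE dist_self)
      then show ?thesis
      proof cases
        case 1
        have "norm (G z) \<le> e' * 4"
          unfolding G_def norm_mult by (intro mult_mono) (use 1 K(6) q4 that e'(1) in auto)
        then show ?thesis using e' by linarith
      next
        case 2
        have "norm (q z) \<le> e' * 2"
          unfolding q_def norm_mult by (intro mult_mono d2) (use 2 that e'(1) z12 in \<open>auto simp: dist_norm\<close>)
        then have "norm (G z) \<le> M * (e' * 2)"
          unfolding G_def norm_mult by (intro mult_mono M) (use that M0 e'(1) in auto)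
        then show ?thesis using e' by linarith
      next
        case 3
        have "norm (q z) \<le> 2 * e'"
          unfolding q_def norm_mult by (intro mult_mono d2) (use 3 that e'(1) z12 in \<open>auto simp: dist_norm\<close>)
        then have "norm (q z) \<le> e' * 2" by simp
        then have "norm (G z) \<le> M * (e' * 2)"
          unfolding G_def norm_mult by (intro mult_mono M) (use that M0 e'(1) in auto)
        then show ?thesis using e' by linarith
      qed
    qed
    have cE: "compact E" unfolding E_def by (intro compact_Un compact_segment K(1))
    have conE: "connected E"
      unfolding E_def by (intro connected_Un K connected_segment) (use x in \<open>auto simp: E_def\<close>)
    define S where "S = ball 0 1 - E"
    define W where "W = connected_component_set S 0"
    have oS: "open S" unfolding S_def using cE compact_imp_closed by blast
    have B: "ball 0 (1 - e) \<subseteq> S" using Enear e by (force simp: S_def)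
    have W: "open W" "W \<subseteq> ball 0 1" "ball 0 (1 - e) \<subseteq> W" "connected W" "0 \<in> W" "W \<inter> E = {}"
    proof -
      show "open W" "connected W" unfolding W_def by (auto simp: oS open_connected_component)
      show "ball 0 (1 - e) \<subseteq> W"
        unfolding W_def by (rule connected_component_maximal) (use B e in auto)
      then show "0 \<in> W" using e by auto
      show "W \<subseteq> ball 0 1" "W \<inter> E = {}"
        using connected_component_subset[of S 0] by (auto simp: W_def S_def)
    qed
    have fr: "norm (G z) \<le> e" if "z \<in> frontier W \<inter> ball 0 1" for z
      using that frontier_component_subset[OF oS, of 0] EG unfolding W_def S_def by auto
    have "closure W \<inter> (A1 - A2) = {} \<or> closure W \<inter> (A2 - A1) = {}"
    proof -
      have "A1 \<inter> A2 \<subseteq> E" using A(4) by (auto simp: E_def)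
      then have "x1 \<in> closure W \<Longrightarrow> x1 \<in> A1 - A2 \<Longrightarrow> x2 \<in> closure W \<Longrightarrow> x2 \<in> A2 - A1 \<Longrightarrow> False" for x1 x2
        using disc_continuum_separates[OF cE conE A(1-3) _ _ Eball W(4-6,2)] A(4) Esph by metis
      then show ?thesis by blast
    qed
    then have "closure W \<inter> sphere 0 1 \<subseteq> A2 \<or> closure W \<inter> sphere 0 1 \<subseteq> A1" using A(3) by blast
    moreover have "good A e" if "closure W \<inter> sphere 0 1 \<subseteq> A" for A
      unfolding good_def by (intro exI[of _ W] conjI W(1-3) that ballI fr)
    ultimately show ?thesis by metis
  qed
  have good_mono: "good A e" if g: "good A e'" "0 < e'" "e' \<le> e" for A e e'
  proof -
    obtain W where W: "open W" "W \<subseteq> ball 0 1" "ball 0 (1 - e') \<subseteq> W" "closure W \<inter> sphere 0 1 \<subseteq> A"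
      "\<And>z. z \<in> frontier W \<inter> ball 0 1 \<Longrightarrow> norm (G z) \<le> e'"
      using g(1) unfolding good_def by blast
    have "ball 0 (1 - e) \<subseteq> W" using W(3) subset_ball[of "1 - e" "1 - e'" "0::complex"] g(3) by auto
    moreover have "norm (G z) \<le> e" if "z \<in> frontier W \<inter> ball 0 1" for z
      using W(5)[OF that] \<open>e' \<le> e\<close> by linarith
    ultimately show ?thesis unfolding good_def by (intro exI[of _ W] conjI W(1,2,4) ballI)
  qed
  \<comment> \<open>Which side is shielded may depend on \<open>e\<close>, but \<open>good\<close>
    is inherited by larger \<open>e\<close>. If each side failed at some scale, both would fail at
    the smaller of the two scales.\<close>
  have "(\<forall>e. 0 < e \<and> e < 1 \<longrightarrow> good A1 e) \<or> (\<forall>e. 0 < e \<and> e < 1 \<longrightarrow> good A2 e)"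
  proof (rule ccontr)
    assume "\<not> ?thesis"
    then obtain a b where ab: "0 < a" "a < 1" "0 < b" "b < 1" "\<not> good A1 a" "\<not> good A2 b" by blast
    have "good A1 (min a b) \<or> good A2 (min a b)" using ab by (intro good) auto
    then show False using good_mono[of A1 "min a b" a] good_mono[of A2 "min a b" b] ab by (meson min.cobounded1 min.cobounded2 min_less_iff_conj)
  qed
  then obtain A where AA: "A = A1 \<or> A = A2" "\<And>e. 0 < e \<Longrightarrow> e < 1 \<Longrightarrow> good A e" by blast
  obtain om where om: "norm om = 1" "om \<notin> A"
    using A AA(1) by (metis Un_iff dist_0_norm mem_sphere subsetI)
  have "G z = 0"
    by (rule vanishing_of_small_frontier_values[OF holG N _ om]) (use A AA z good_def in auto)
  moreover have "q z \<noteq> 0" using z z12 by (auto simp: q_def)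
  ultimately show ?thesis by (simp add: G_def)
qed

section \<open>Extending the Riemann map to the boundary\<close>

text \<open>Janiszewski's theorem again. All of the curve except a short piece around
  \<open>a\<close> forms a connected compact set \<open>A\<close> that misses \<open>a\<close>, and
  the short piece lies in \<open>ball a r\<close>. For \<open>u\<close> and \<open>v\<close> inside
  and near \<open>a\<close>, neither the curve nor the union of \<open>A\<close> with the complement
  of \<open>ball a r\<close> separates them, and these two sets meet in \<open>A\<close>.\<close>

lemma inside_locally_connected_at_boundary:
  fixes p :: "real \<Rightarrow> complex"
  assumes p: "simple_path p" "pathfinish p = pathstart p" and a: "a \<in> path_image p" and r: "r > 0"
  obtains s where "s > 0"
    "\<And>u v. \<lbrakk>u \<in> inside (path_image p) \<inter> ball a s; v \<in> inside (path_image p) \<inter> ball a s\<rbrakk>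
      \<Longrightarrow> connected_component (inside (path_image p) \<inter> ball a r) u v"
proof -
  let ?J = "path_image p"
  obtain t where t: "t \<in> {0..1}" "p t = a" using a by (auto simp: path_image_def)
  define q where "q = shiftpath t p"
  have q: "simple_path q" "path_image q = ?J" "q 0 = a" "q 1 = a"
  proof -
    show "simple_path q" unfolding q_def using p t by (intro simple_path_shiftpath) auto
    show "path_image q = ?J" unfolding q_def using p t by (intro path_image_shiftpath) auto
    show "q 0 = a" using t by (auto simp: q_def shiftpath_def)
    show "q 1 = a" using pathfinish_shiftpath[of t p] p t by (auto simp: q_def pathfinish_def)
  qed
  have contq: "continuous_on {0..1} q" using q(1) by (simp add: simple_path_def path_def)
  obtain d0 where d0: "d0 > 0" "\<And>x. x \<in> {0..1} \<Longrightarrow> dist x 0 < d0 \<Longrightarrow> dist (q x) a < r"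
    using contq r q(3) unfolding continuous_on_iff by (metis atLeastAtMost_iff order_refl zero_le_one)
  obtain d1 where d1: "d1 > 0" "\<And>x. x \<in> {0..1} \<Longrightarrow> dist x 1 < d1 \<Longrightarrow> dist (q x) a < r"
    using contq r q(4) unfolding continuous_on_iff by (metis atLeastAtMost_iff order_refl zero_le_one)
  define d where "d = min (1/3) (min d0 d1) / 2"
  have d: "d > 0" "d < 1/3" "d < d0" "d < d1" using d0 d1 by (auto simp: d_def min_def)
  define A where "A = q ` {d..1-d}"
  have AJ: "A \<subseteq> ?J" using q(2) d by (auto simp: A_def path_image_def)
  have conA: "connected A" "compact A"
    unfolding A_def using d
    by (auto intro!: connected_continuous_image compact_continuous_image continuous_on_subset[OF contq])
  have JA: "?J - A \<subseteq> ball a r"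
  proof
    fix x assume x: "x \<in> ?J - A"
    then have "x \<in> path_image q" using q(2) by simp
    then obtain s where s: "s \<in> {0..1}" "x = q s" by (auto simp: path_image_def)
    then have "s < d \<or> s > 1 - d" using x by (force simp: A_def)
    then show "x \<in> ball a r" using d0(2)[of s] d1(2)[of s] s d by (auto simp: dist_real_def dist_commute)
  qed
  have "a \<notin> A"
  proof
    assume "a \<in> A"
    then obtain s where s: "s \<in> {d..1-d}" "q s = q 0" using q(3) by (auto simp: A_def)
    then show False using q(1) d unfolding simple_path_def loop_free_def by fastforce
  qed
  then have "open (- A)" "a \<in> - A" using conA compact_imp_closed by auto
  then obtain s0 where s0: "s0 > 0" "ball a s0 \<subseteq> - A" by (meson openE)
  define s where "s = min r s0"
  have s: "s > 0" "s \<le> r" "ball a s \<subseteq> - A" using s0 r by (auto simp: s_def)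
  have inout: "connected (inside ?J)" using Jordan_inside_outside[OF p] by auto
  have "connected_component (inside ?J \<inter> ball a r) u v"
    if uv: "u \<in> inside ?J \<inter> ball a s" "v \<in> inside ?J \<inter> ball a s" for u v
  proof -
    have "connected_component (- (?J \<union> (A \<union> - ball a r))) u v"
    proof (rule Janiszewski)
      show "compact ?J" using p by (simp add: compact_simple_path_image)
      show "closed (A \<union> - ball a r)" using conA compact_imp_closed by (intro closed_Un) (auto simp: closed_Compl)
      have "?J \<inter> (A \<union> - ball a r) = A" using AJ JA by auto
      then show "connected (?J \<inter> (A \<union> - ball a r))" using conA by simp
      show "connected_component (- ?J) u v"
        by (rule connected_component_joinI[OF inout]) (use uv inside_no_overlap in \<open>auto simp: inside_def\<close>)
      show "connected_component (- (A \<union> - ball a r)) u v"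
        by (rule connected_component_joinI[of "ball a s"]) (use uv s in auto)
    qed
    then obtain C where C: "connected C" "C \<subseteq> - (?J \<union> (A \<union> - ball a r))" "u \<in> C" "v \<in> C"
      unfolding connected_component_def by blast
    have "C \<subseteq> inside ?J"
    proof
      fix x assume "x \<in> C"
      then have "connected_component (- ?J) u x"
        by (intro connected_component_joinI[OF C(1)]) (use C in auto)
      then show "x \<in> inside ?J" using uv inside_same_component by blast
    qed
    then show ?thesis using C by (intro connected_component_joinI[OF C(1)]) auto
  qed
  then show thesis using that s(1) by blast
qed

lemma continuous_extension_by_limits:
  fixes F :: "'a::metric_space \<Rightarrow> 'b::metric_space"
  assumes cF: "continuous_on U F" and oU: "open U"
    and lim: "\<And>a. a \<in> closure U - U \<Longrightarrow> \<exists>l. (F \<longlongrightarrow> l) (at a within U)"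
  obtains f where "continuous_on (closure U) f" "\<And>u. u \<in> U \<Longrightarrow> f u = F u"
    "\<And>a. a \<in> closure U - U \<Longrightarrow> (F \<longlongrightarrow> f a) (at a within U)"
proof -
  obtain l where l: "\<And>a. a \<in> closure U - U \<Longrightarrow> (F \<longlongrightarrow> l a) (at a within U)" using lim by metis
  define f where "f = (\<lambda>u. if u \<in> U then F u else l u)"
  have near: "\<exists>s>0. \<forall>u\<in>U \<inter> ball a s. dist (F u) (f a) < e" if "a \<in> closure U" "e > 0" for a e
  proof (cases "a \<in> U")
    case True
    then obtain s where "s > 0" "\<forall>u\<in>U. dist u a < s \<longrightarrow> dist (F u) (F a) < e"
      using cF \<open>e > 0\<close> unfolding continuous_on_iff by metis
    then show ?thesis using True by (auto simp: f_def dist_commute intro!: exI[of _ s])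
  next
    case False
    then have "(F \<longlongrightarrow> l a) (at a within U)" using l that by auto
    then obtain s where "s > 0" "\<forall>u\<in>U. 0 < dist u a \<and> dist u a < s \<longrightarrow> dist (F u) (l a) < e"
      using \<open>e > 0\<close> unfolding Lim_within by metis
    then show ?thesis using False by (auto simp: f_def dist_commute intro!: exI[of _ s])
  qed
  have "continuous_on (closure U) f"
    unfolding continuous_on_iff
  proof (intro ballI allI impI)
    fix a e assume a: "a \<in> closure U" and e: "(0::real) < e"
    obtain s where s: "s > 0" "\<forall>u\<in>U \<inter> ball a s. dist (F u) (f a) < e/2" using near[OF a] e by (metis half_gt_zero)
    \<comment> \<open>A boundary point \<open>b\<close> near \<open>a\<close> is compared with
      \<open>a\<close> through a point of \<open>U\<close> close to both.\<close>
    have "dist (f b) (f a) < e" if b: "b \<in> closure U" "dist b a < s" for b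
    proof -
      obtain s' where s': "s' > 0" "\<forall>u\<in>U \<inter> ball b s'. dist (F u) (f b) < e/2"
        using near[OF b(1)] e by (metis half_gt_zero)
      obtain u where u: "u \<in> U" "u \<in> ball b (min s' (s - dist b a))"
        using closure_touch[OF b(1), of "min s' (s - dist b a)"] s' b by auto
      then have "u \<in> ball a s" using dist_triangle[of a u b] by (auto simp: dist_commute)
      then have "dist (F u) (f a) < e/2" "dist (F u) (f b) < e/2" using u s s' by auto
      then show ?thesis using dist_triangle3[of "f b" "f a" "F u"] by linarith
    qed
    then show "\<exists>d>0. \<forall>x'\<in>closure U. dist x' a < d \<longrightarrow> dist (f x') (f a) < e" using s by blast
  qed
  then show thesis using that[of f] l by (auto simp: f_def)
qed

text \<open>Two points split the loop into two open arcs. If \<open>X\<close> missed a point of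
  each, these two points would cut the loop into two closed pieces that disconnect
  \<open>X\<close>.\<close>

lemma connected_loop_subset_contains_arc:
  fixes p :: "real \<Rightarrow> 'a::metric_space"
  assumes p: "simple_path p" "pathfinish p = pathstart p" and X: "connected X" "X \<subseteq> path_image p"
    and ab: "a \<in> X" "b \<in> X" "a \<noteq> b"
  obtains x e where "x \<in> path_image p" "e > 0" "path_image p \<inter> ball x e \<subseteq> X"
proof -
  obtain t0 where t0: "t0 \<in> {0..1}" "p t0 = a" using ab X by (auto simp: path_image_def)
  define q where "q = shiftpath t0 p"
  have q: "simple_path q" "path_image q = path_image p" "q 0 = a" "q 1 = a"
  proof -
    show "simple_path q" unfolding q_def using p t0 by (intro simple_path_shiftpath) auto
    show "path_image q = path_image p" unfolding q_def using p t0 by (intro path_image_shiftpath) auto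
    show "q 0 = a" using t0 by (auto simp: q_def shiftpath_def)
    show "q 1 = a" using pathfinish_shiftpath[of t0 p] p t0 by (auto simp: q_def pathfinish_def)
  qed
  have cq: "continuous_on {0..1} q" using q(1) by (simp add: simple_path_def path_def)
  have inj: "x = y \<or> x = 0 \<and> y = 1 \<or> x = 1 \<and> y = 0" if "q x = q y" "x \<in> {0..1}" "y \<in> {0..1}" for x y
    using q(1) that unfolding simple_path_def loop_free_def by blast
  have clq: "closed (q ` {u..v})" if "0 \<le> u" "v \<le> 1" for u v
    using that by (intro compact_imp_closed compact_continuous_image continuous_on_subset[OF cq]) auto
  have qex: "\<exists>s\<in>{0..1}. x = q s" if "x \<in> path_image p" for x
    using that unfolding q(2)[symmetric] by (auto simp: path_image_def)
  obtain t where t: "t \<in> {0..1}" "q t = b" using qex[OF subsetD[OF X(2) ab(2)]] by metis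
  then have t01: "0 < t" "t < 1" using q(3,4) ab(3) by (metis atLeastAtMost_iff less_eq_real_def)+
  have "q ` {0<..<t} \<subseteq> X \<or> q ` {t<..<1} \<subseteq> X"
  proof (rule ccontr)
    assume "\<not> ?thesis"
    then obtain u v where "u \<in> {0<..<t}" "v \<in> {t<..<1}" and uvX: "q u \<notin> X" "q v \<notin> X" by blast
    then have uv: "0 < u" "u < t" "q u \<notin> X" "t < v" "v < 1" "q v \<notin> X" by auto
    let ?A = "q ` {u..v}" and ?B = "q ` {0..u} \<union> q ` {v..1}"
    have cl: "closed ?A" "closed ?B" using clq uv by (auto intro!: closed_Un)
    have cov: "X \<subseteq> ?A \<union> ?B"
    proof
      fix x assume "x \<in> X"
      then obtain s where "s \<in> {0..1}" "x = q s" using X(2) qex[of x] by blast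
      then show "x \<in> ?A \<union> ?B" by (cases "s < u"; cases "v < s") auto
    qed
    have dis: "?A \<inter> ?B \<inter> X = {}"
    proof -
      have "q s \<noteq> q s'" if "s \<in> {u..v}" "s' \<in> {0..u} \<union> {v..1}" "q s \<in> X" for s s'
      proof
        assume "q s = q s'"
        then have "s = s'" using inj[of s s'] that uv by force
        then have "s = u \<or> s = v" using that by auto
        then show False using that uv by auto
      qed
      then show ?thesis by fastforce
    qed
    have "b \<in> ?A \<inter> X" using ab t uv by auto
    moreover have "a \<in> ?B \<inter> X" using ab q(3) uv by force
    ultimately show False using connected_closedD[OF X(1) dis cov cl] by blast
  qed
  then obtain l m where lm: "0 \<le> l" "l < m" "m \<le> 1" "q ` {l<..<m} \<subseteq> X"
    using t01 by (metis less_eq_real_def)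
  define s where "s = (l + m) / 2"
  have s: "l < s" "s < m" using lm by (auto simp: s_def)
  have "q s \<notin> q ` {0..l} \<union> q ` {m..1}"
    using inj[of s] s lm by force
  moreover have "open (- (q ` {0..l} \<union> q ` {m..1}))" using clq lm by (intro open_Compl closed_Un) auto
  ultimately obtain e where e: "e > 0" "ball (q s) e \<subseteq> - (q ` {0..l} \<union> q ` {m..1})"
    by (meson ComplI openE)
  show thesis
  proof
    show "q s \<in> path_image p" using s lm unfolding q(2)[symmetric] by (auto simp: path_image_def)
    show "e > 0" by fact
    show "path_image p \<inter> ball (q s) e \<subseteq> X"
    proof
      fix x assume x: "x \<in> path_image p \<inter> ball (q s) e"
      then obtain w where w: "w \<in> {0..1}" "x = q w" using qex[of x] by blast
      then have "l < w" "w < m" using x e(2) by (force simp: subset_iff)+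
      then show "x \<in> X" using lm(4) w by auto
    qed
  qed
qed

text \<open>The pole \<open>c\<close> is taken outside the curve but close to \<open>x\<close>. On
  the frontier of the part of the inside within \<open>r/2\<close> of \<open>c\<close>, the
  difference from \<open>w\<close> either tends to 0 or is divided by a number of norm exactly
  \<open>(r/2) ^ k\<close>, while a point \<open>z\<close> near \<open>x\<close> is closer to
  \<open>c\<close> than \<open>3*r/8\<close>. Letting \<open>k\<close> grow gives
  \<open>F z = w\<close>, which has norm 1.\<close>

lemma not_constant_on_loop_arc:
  fixes p :: "real \<Rightarrow> complex"
  assumes p: "simple_path p" "pathfinish p = pathstart p"
    and hol: "F holomorphic_on inside (path_image p)"
    and F1: "\<And>u. u \<in> inside (path_image p) \<Longrightarrow> norm (F u) < 1"
    and cont: "continuous_on (closure (inside (path_image p))) f"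
    and fF: "\<And>u. u \<in> inside (path_image p) \<Longrightarrow> f u = F u"
    and x: "x \<in> path_image p" and r: "r > 0"
    and const: "\<And>y. y \<in> path_image p \<inter> ball x r \<Longrightarrow> f y = w" and w: "norm w = 1"
  shows False
proof -
  let ?J = "path_image p" and ?U = "inside (path_image p)"
  note Jd = Jordan_inside_outside[OF p]
  have oU: "open ?U" and clU: "closure ?U = ?U \<union> ?J"
    using Jd by (auto simp: closure_Un_frontier)
  have clO: "closure (outside ?J) = outside ?J \<union> ?J" using Jd by (auto simp: closure_Un_frontier)
  have "x \<in> closure (outside ?J)" using x clO by auto
  then obtain c where c: "c \<in> outside ?J" "c \<in> ball x (r/4)" using closure_touch[of x _ "r/4"] r by auto
  have "c \<notin> closure ?U"
    using c(1) clU inside_Int_outside[of ?J] outside_no_overlap[of ?J] by blast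
  then have "c \<in> - closure ?U" by simp
  moreover have "open (- closure ?U)" by auto
  ultimately obtain d where d: "d > 0" "ball c d \<subseteq> - closure ?U" by (meson openE)
  have dc: "d \<le> dist c y" if "y \<in> closure ?U" for y
    using d(2) that by (meson ComplD in_mono mem_ball not_le)
  define W where "W = ?U \<inter> ball c (r/2)"
  have "x \<in> closure ?U" using x clU by auto
  then obtain z where z: "z \<in> ?U" "z \<in> ball x (r/8)" using closure_touch[of x ?U "r/8"] r by auto
  have zc: "dist c z < 3*r/8" using z(2) c(2) dist_triangle[of c z x] by (simp add: dist_commute)
  then have zW: "z \<in> W" using z(1) r by (auto simp: W_def)
  have cz: "dist c z > 0" using dc[of z] z(1) clU d(1) by force
  have bound: "norm (F z - w) / dist c z ^ k \<le> 2 / (r/2)^k" for k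
  proof -
    define H where "H = (\<lambda>u. (F u - w) / (u - c) ^ k)"
    define h where "h = (\<lambda>u. (f u - w) / (u - c) ^ k)"
    have nc: "u \<noteq> c" if "u \<in> closure ?U" for u using dc[OF that] d(1) by auto
    have conth: "continuous_on (closure ?U) h"
      unfolding h_def by (intro continuous_intros cont) (use nc in auto)
    have hH: "h u = H u" if "u \<in> ?U" for u using fF[OF that] by (simp add: h_def H_def)
    have f1: "norm (f y) \<le> 1" if y: "y \<in> closure ?U" for y
    proof (rule ccontr)
      assume "\<not> norm (f y) \<le> 1"
      then have "norm (f y) - 1 > 0" by simp
      then obtain s where s: "s > 0" "\<And>u. u \<in> closure ?U \<Longrightarrow> dist u y < s \<Longrightarrow> dist (f u) (f y) < norm (f y) - 1"
        using cont y unfolding continuous_on_iff by meson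
      obtain u where "u \<in> ?U" "u \<in> ball y s" using closure_touch[OF y s(1)] by blast
      then have "dist (F u) (f y) < norm (f y) - 1" "norm (F u) < 1"
        using s(2)[of u] fF F1 clU by (auto simp: dist_commute)
      then show False using norm_triangle_ineq2[of "f y" "F u"] by (simp add: dist_norm norm_minus_commute)
    qed
    have "norm (H z) \<le> 2 / (r/2)^k"
    proof (rule maximum_principle_frontier[where W = W and f = H and z = z])
      show "H holomorphic_on W"
        unfolding H_def W_def
        by (intro holomorphic_intros holomorphic_on_subset[OF hol]) (use nc clU in auto)
      show "open W" unfolding W_def by (intro open_Int oU open_ball)
      show "bounded W" unfolding W_def by (intro bounded_Int disjI2 bounded_ball)
      show "z \<in> W" by fact
      fix y and e :: real assume y: "y \<in> frontier W" and e: "e > 0"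
      have ycl: "y \<in> closure W" using y by (simp add: frontier_def)
      then have ycU: "y \<in> closure ?U" using closure_mono[of W ?U] by (auto simp: W_def)
      have yd: "dist c y \<le> r/2"
      proof -
        have "W \<subseteq> cball c (r/2)" by (auto simp: W_def)
        then have "closure W \<subseteq> cball c (r/2)" by (rule closure_minimal) simp
        then show ?thesis using ycl by auto
      qed
      have "norm (h y) \<le> 2 / (r/2)^k"
      proof (cases "y \<in> ?J")
        case True
        have "dist x y < r" using c(2) yd dist_triangle[of x y c] r by (simp)
        then have "f y = w" using const True by auto
        then show ?thesis using r by (simp add: h_def)
      next
        case False
        then have "y \<in> ?U" using ycU clU by auto
        moreover have "y \<notin> W" using y \<open>open W\<close> by (simp add: frontier_def interior_open)
        ultimately have "norm (y - c) = r/2" using yd by (auto simp: W_def dist_norm norm_minus_commute)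
        moreover have "norm (f y - w) \<le> 2" using f1[OF ycU] w norm_triangle_ineq4[of "f y" w] by simp
        ultimately show ?thesis
          unfolding h_def norm_divide norm_power using r by (simp only:) (intro divide_right_mono, auto)
      qed
      moreover obtain s where s: "s > 0" "\<And>u. u \<in> closure ?U \<Longrightarrow> dist u y < s \<Longrightarrow> dist (h u) (h y) < e"
        using conth ycU e unfolding continuous_on_iff by meson
      moreover have "norm (H u) \<le> 2 / (r/2)^k + e" if "u \<in> W \<inter> ball y s" for u
      proof -
        have "u \<in> ?U" using that by (auto simp: W_def)
        then have "dist (H u) (h y) < e" using s(2)[of u] that hH clU by (auto simp: dist_commute)
        then have "norm (H u) \<le> norm (h y) + e"
          using norm_triangle_ineq2[of "H u" "h y"] by (simp add: dist_norm)
        then show ?thesis using calculation(1) by linarith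
      qed
      ultimately show "\<exists>d>0. \<forall>z\<in>W \<inter> ball y d. norm (H z) \<le> 2 / (r/2)^k + e" by blast
    qed
    then show ?thesis by (simp add: H_def norm_divide norm_power dist_norm norm_minus_commute)
  qed
  define t where "t = dist c z / (r/2)"
  have t: "0 \<le> t" "t < 1" using zc r by (auto simp: t_def)
  have "norm (F z - w) \<le> 2 * t ^ k" for k
    using bound[of k] cz r by (simp add: t_def field_simps power_mult_distrib)
  moreover have "(\<lambda>k. 2 * t ^ k) \<longlonglongrightarrow> 2 * 0"
    by (intro tendsto_mult tendsto_const LIMSEQ_power_zero) (use t in auto)
  ultimately have "norm (F z - w) \<le> 2 * 0"
    using LIMSEQ_le_const[of "\<lambda>k. 2 * t ^ k" "2 * 0" "norm (F z - w)"] by blast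
  then have "F z = w" by simp
  then show False using F1[OF z(1)] w by auto
qed

text \<open>Caratheodory's extension theorem. Single-valued boundary limits come from Koebe's lemma
  applied to the inverse map, injectivity on the curve from connectedness of the boundary fibres;
  compactness then gives the homeomorphism.\<close>

lemma inside_homeomorphic_disc:
  fixes p :: "real \<Rightarrow> complex"
  assumes p: "simple_path p" "pathfinish p = pathstart p"
  obtains f g where "homeomorphism (inside (path_image p) \<union> path_image p) (cball (0::complex) 1) f g"
    "f ` path_image p \<subseteq> sphere 0 1"
proof -
  let ?J = "path_image p" and ?U = "inside (path_image p)"
  note Jd = Jordan_inside_outside[OF p]
  have oU: "open ?U" and clU: "closure ?U = ?U \<union> ?J"
    using Jd by (auto simp: closure_Un_frontier)
  have JU: "?J \<inter> ?U = {}" using inside_no_overlap[of ?J] by blast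
  have neU: "?U \<noteq> {}" "?U \<noteq> UNIV" using Jd JU pathstart_in_path_image[of p] by auto
  have "open ?U \<and> simply_connected ?U" using oU simply_connected_inside_simple_path[OF p(1)] by blast
  then have "\<exists>F G. F holomorphic_on ?U \<and> G holomorphic_on ball 0 1 \<and>
      (\<forall>z\<in>?U. F z \<in> ball 0 1 \<and> G (F z) = z) \<and> (\<forall>z\<in>ball 0 1. G z \<in> ?U \<and> F (G z) = z)"
    using neU Riemann_mapping_theorem[of ?U] by meson
  then obtain F G where F: "F holomorphic_on ?U" and G: "G holomorphic_on ball 0 1"
    and FG: "\<And>z. z \<in> ?U \<Longrightarrow> F z \<in> ball 0 1 \<and> G (F z) = z"
    and GF: "\<And>z. z \<in> ball 0 1 \<Longrightarrow> G z \<in> ?U \<and> F (G z) = z"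
    by blast
  have contF: "continuous_on ?U F" and contG: "continuous_on (ball 0 1) G"
    using F G holomorphic_on_imp_continuous_on by blast+
  obtain M0 where M0: "\<And>u. u \<in> ?U \<Longrightarrow> norm u \<le> M0" using Jd by (meson bounded_iff)
  \<comment> \<open>The points sent into \<open>cball 0 r\<close> form a compact subset of the
    inside, so they stay away from the curve.\<close>
  have proper: "\<exists>s>0. \<forall>u\<in>?U \<inter> ball a s. norm (F u) > r" if a: "a \<in> ?J" and r: "r < 1" for a r
  proof -
    have "compact (G ` cball 0 r)"
      using r by (intro compact_continuous_image continuous_on_subset[OF contG]) auto
    moreover have "a \<notin> G ` cball 0 r" using GF a JU r by fastforce
    ultimately have "open (- (G ` cball 0 r))" "a \<in> - (G ` cball 0 r)" using compact_imp_closed by auto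
    then obtain s where s: "s > 0" "ball a s \<subseteq> - (G ` cball 0 r)" by (meson openE)
    have "norm (F u) > r" if "u \<in> ?U \<inter> ball a s" for u
    proof (rule ccontr)
      assume "\<not> norm (F u) > r"
      then have "u \<in> G ` cball 0 r" using FG[of u] that by (metis IntD1 imageI mem_cball_0 not_le)
      then show False using s that by auto
    qed
    then show ?thesis using s by blast
  qed
  \<comment> \<open>If both \<open>z1\<close> and \<open>z2\<close> were cluster values at
    \<open>a\<close>, short paths near \<open>a\<close> would be mapped by \<open>F\<close> to
    continua close to the circle, running from near \<open>z1\<close> to near \<open>z2\<close>, on
    which \<open>G - a\<close> is small. Then \<open>G\<close> would be constantly \<open>a\<close>,
    which is not in its range.\<close>
  have one_limit: False
    if a: "a \<in> ?J" and z12: "norm z1 = 1" "norm z2 = 1" "z1 \<noteq> z2"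
      and near1: "\<And>s e. s > 0 \<Longrightarrow> e > 0 \<Longrightarrow> \<exists>u\<in>?U \<inter> ball a s. F u \<in> ball z1 e"
      and near2: "\<And>s e. s > 0 \<Longrightarrow> e > 0 \<Longrightarrow> \<exists>u\<in>?U \<inter> ball a s. F u \<in> ball z2 e" for a z1 z2
  proof -
    have "G z - a = 0" if "norm z < 1" for z
    proof (rule vanishing_of_small_values_on_continua[OF _ _ z12 _ that])
      show "(\<lambda>z. G z - a) holomorphic_on ball 0 1" by (intro holomorphic_intros G)
      show "norm (G z - a) \<le> M0 + norm a" if "norm z < 1" for z
        using GF[of z] M0[of "G z"] that norm_triangle_ineq4[of "G z" a] by auto
      fix e :: real assume e: "e > 0"
      obtain s1 where s1: "s1 > 0" "\<And>u. u \<in> ?U \<inter> ball a s1 \<Longrightarrow> norm (F u) > 1 - e"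
        using proper[OF a, of "1 - e"] e by auto
      define r where "r = min e s1"
      have r: "r > 0" "r \<le> e" "r \<le> s1" using e s1 by (auto simp: r_def)
      obtain s where s: "s > 0" "\<And>u v. \<lbrakk>u \<in> ?U \<inter> ball a s; v \<in> ?U \<inter> ball a s\<rbrakk>
          \<Longrightarrow> connected_component (?U \<inter> ball a r) u v"
        using inside_locally_connected_at_boundary[OF p a r(1)] by blast
      obtain u v where uv: "u \<in> ?U \<inter> ball a s" "F u \<in> ball z1 e" "v \<in> ?U \<inter> ball a s" "F v \<in> ball z2 e"
        using near1[OF s(1) e] near2[OF s(1) e] by blast
      have "open (?U \<inter> ball a r)" using oU by auto
      then have "path_component (?U \<inter> ball a r) u v"
        using s(2)[OF uv(1,3)] open_path_connected_component by metis
      then obtain c where c: "path c" "path_image c \<subseteq> ?U \<inter> ball a r" "pathstart c = u" "pathfinish c = v"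
        unfolding path_component_def by blast
      define K where "K = F ` path_image c"
      have cc: "continuous_on (path_image c) F" using contF c(2) continuous_on_subset by blast
      have "compact K" "connected K"
        unfolding K_def using c cc
        by (auto intro!: compact_continuous_image connected_continuous_image compact_path_image connected_path_image)
      moreover have "K \<subseteq> ball 0 1" using c(2) FG by (auto simp: K_def)
      moreover have "F u \<in> K \<inter> ball z1 e" "F v \<in> K \<inter> ball z2 e"
        using uv c pathstart_in_path_image[of c] pathfinish_in_path_image[of c] by (auto simp: K_def)
      moreover have "norm (G z - a) \<le> e \<and> 1 - e < norm z" if "z \<in> K" for z
      proof -
        obtain y where y: "y \<in> path_image c" "z = F y" using \<open>z \<in> K\<close> by (auto simp: K_def)
        then have "y \<in> ?U" "dist a y < r" using c(2) by auto
        then show ?thesis using y(2) FG[of y] s1(2)[of y] r by (auto simp: dist_norm norm_minus_commute)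
      qed
      ultimately show "\<exists>K. compact K \<and> connected K \<and> K \<subseteq> ball 0 1 \<and>
         K \<inter> ball z1 e \<noteq> {} \<and> K \<inter> ball z2 e \<noteq> {} \<and> (\<forall>z\<in>K. norm (G z - a) \<le> e \<and> 1 - e < norm z)"
        by (intro exI[of _ K]) blast
    qed
    then have "G 0 = a" by (metis norm_zero right_minus_eq zero_less_one)
    then show False using GF[of 0] a JU by auto
  qed
  \<comment> \<open>The predicate \<open>Q\<close> is trivial for the first cluster value; when
    convergence fails, it selects points whose images stay away from that value and so yields a
    second one.\<close>
  have cluster: "\<exists>z. norm z = 1 \<and> (\<forall>s>0. \<forall>e>0. \<exists>u\<in>?U \<inter> ball a s. F u \<in> ball z e \<and> Q u)"
    if a: "a \<in> ?J" and Q: "\<And>s. s > 0 \<Longrightarrow> \<exists>u\<in>?U \<inter> ball a s. Q u" for a Q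
  proof -
    have "\<exists>u. u \<in> ?U \<inter> ball a (1 / Suc n) \<and> Q u" for n using Q[of "1 / Suc n"] by auto
    then obtain u where u: "\<And>n. u n \<in> ?U \<inter> ball a (1 / Suc n) \<and> Q (u n)" by metis
    have "\<forall>n. (F \<circ> u) n \<in> cball 0 1" using u FG by (auto simp: less_imp_le)
    then obtain z r where z: "z \<in> cball 0 1" "strict_mono r" "(F \<circ> u \<circ> r) \<longlonglongrightarrow> z"
      using compact_cball[of 0 1] unfolding compact_def by metis
    have small: "\<exists>N. \<forall>n\<ge>N. u (r n) \<in> ball a s" if sp: "s > 0" for s
    proof -
      obtain N where N: "1 / Suc N < s" using sp by (meson nat_approx_posE)
      have "dist a (u (r n)) < s" if "n \<ge> N" for n
      proof -
        have "N \<le> r n" using z(2) that seq_suble order_trans by blast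
        then have "1 / Suc (r n) \<le> 1 / Suc N" by (simp add: frac_le)
        then show ?thesis using u[of "r n"] N by auto
      qed
      then show ?thesis by auto
    qed
    have freq: "\<exists>v\<in>?U \<inter> ball a s. F v \<in> ball z e \<and> Q v" if se: "s > 0" "e > 0" for s e
    proof -
      obtain N1 where N1: "\<And>n. n \<ge> N1 \<Longrightarrow> dist ((F \<circ> u \<circ> r) n) z < e"
        using z(3) se(2) unfolding lim_sequentially by blast
      obtain N2 where N2: "\<And>n. n \<ge> N2 \<Longrightarrow> u (r n) \<in> ball a s" using small[OF se(1)] by blast
      have "u (r (max N1 N2)) \<in> ?U \<inter> ball a s" "F (u (r (max N1 N2))) \<in> ball z e" "Q (u (r (max N1 N2)))"
        using N1[of "max N1 N2"] N2[of "max N1 N2"] u[of "r (max N1 N2)"] by (auto simp: dist_commute)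
      then show ?thesis by blast
    qed
    have "norm z = 1"
    proof (rule ccontr)
      assume "norm z \<noteq> 1"
      then have z1: "norm z < 1" using z(1) by auto
      obtain s where s: "s > 0" "\<And>u. u \<in> ?U \<inter> ball a s \<Longrightarrow> norm (F u) > (1 + norm z)/2"
        using proper[OF a, of "(1 + norm z)/2"] z1 by auto
      obtain v where "v \<in> ?U \<inter> ball a s" "F v \<in> ball z ((1 - norm z)/2)"
        using freq[OF s(1), of "(1 - norm z)/2"] z1 by auto
      then have "norm (F v) > (1 + norm z)/2" "norm (F v - z) < (1 - norm z)/2"
        using s(2) by (auto simp: dist_norm norm_minus_commute)
      then show False using norm_triangle_ineq2[of "F v" z] by (simp add: field_simps)
    qed
    then show ?thesis using freq by blast
  qed
  have lim: "\<exists>l. norm l = 1 \<and> (F \<longlongrightarrow> l) (at a within ?U)" if a: "a \<in> ?J" for a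
  proof -
    have touch: "\<exists>u\<in>?U \<inter> ball a s. True" if "s > 0" for s
      using closure_touch[of a ?U s] a clU that by auto
    obtain l where l: "norm l = 1" "\<And>s e. s > 0 \<Longrightarrow> e > 0 \<Longrightarrow> \<exists>u\<in>?U \<inter> ball a s. F u \<in> ball l e"
      using cluster[OF a touch] by auto
    have "(F \<longlongrightarrow> l) (at a within ?U)"
    proof (rule ccontr)
      assume "\<not> ?thesis"
      then obtain e where e: "e > 0" "\<And>s. s > 0 \<Longrightarrow> \<exists>u\<in>?U. 0 < dist u a \<and> dist u a < s \<and> \<not> dist (F u) l < e"
        unfolding Lim_within by blast
      have far: "\<exists>u\<in>?U \<inter> ball a s. \<not> dist (F u) l < e" if "s > 0" for s
        using e(2)[OF that] by (force simp: dist_commute)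
      obtain l' where l': "norm l' = 1"
        "\<And>s e'. s > 0 \<Longrightarrow> e' > 0 \<Longrightarrow> \<exists>u\<in>?U \<inter> ball a s. F u \<in> ball l' e' \<and> \<not> dist (F u) l < e"
        using cluster[OF a far] by auto
      have "l \<noteq> l'"
      proof
        assume "l = l'"
        then show False using l'(2)[of 1 e] e(1) by (auto simp: dist_commute)
      qed
      then show False using one_limit[OF a l(1) l'(1)] l(2) l'(2) by blast
    qed
    then show ?thesis using l(1) by blast
  qed
  obtain f where contf: "continuous_on (closure ?U) f" and fF: "\<And>u. u \<in> ?U \<Longrightarrow> f u = F u"
    and flim: "\<And>a. a \<in> closure ?U - ?U \<Longrightarrow> (F \<longlongrightarrow> f a) (at a within ?U)"
    using continuous_extension_by_limits[OF contF oU] lim clU by blast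
  have fJ: "norm (f a) = 1" if aJ: "a \<in> ?J" for a
  proof -
    obtain l where l: "norm l = 1" "(F \<longlongrightarrow> l) (at a within ?U)" using lim[OF aJ] by blast
    have aU: "a \<notin> ?U" using aJ JU by auto
    have "a islimpt ?U"
      using aJ clU aU unfolding closure_def by blast
    then have "at a within ?U \<noteq> bot" by (simp add: trivial_limit_within)
    then have "f a = l" using l(2) flim[of a] aJ aU clU tendsto_unique by blast
    then show ?thesis using l by simp
  qed
  have inj: "a = b" if ab: "a \<in> ?J" "b \<in> ?J" "f a = f b" for a b
  proof (rule ccontr)
    assume "a \<noteq> b"
    define z where "z = f a"
    have z1: "norm z = 1" using fJ ab by (simp add: z_def)
    \<comment> \<open>The fibre of \<open>f\<close> over \<open>z\<close> is exhibited as a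
      decreasing intersection of continua, hence connected. A second point in it would force
      \<open>f\<close> to be constant on an arc of the curve.\<close>
    define C where "C = (\<lambda>n::nat. closure (G ` (ball 0 1 \<inter> ball z (1 / Suc n))))"
    define X where "X = {x \<in> ?J. f x = z}"
    have XC: "X = \<Inter> (range C)"
    proof (intro set_eqI iffI)
      fix x assume x: "x \<in> X"
      have "x \<in> C n" for n
        unfolding C_def closure_approachable
      proof (intro allI impI)
        fix e :: real assume e: "e > 0"
        have "x \<in> closure ?U" using x clU by (auto simp: X_def)
        moreover have "1 / real (Suc n) > 0" by simp
        ultimately obtain s where s: "s > 0" "\<And>u. u \<in> closure ?U \<Longrightarrow> dist u x < s \<Longrightarrow> dist (f u) (f x) < 1 / Suc n"
          using contf unfolding continuous_on_iff by meson
        obtain u where u: "u \<in> ?U" "u \<in> ball x (min s e)"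
          using closure_touch[OF \<open>x \<in> closure ?U\<close>, of "min s e"] s e by auto
        have "dist (F u) z < 1 / Suc n" using s(2)[of u] u x fF[of u] clU by (auto simp: X_def dist_commute)
        then have "F u \<in> ball 0 1 \<inter> ball z (1 / Suc n)" using FG[OF u(1)] by (auto simp: dist_commute)
        moreover have "u = G (F u)" using FG[OF u(1)] by simp
        ultimately show "\<exists>y\<in>G ` (ball 0 1 \<inter> ball z (1 / Suc n)). dist y x < e"
          using u(2) by (intro bexI[of _ u]) (auto simp: dist_commute)
      qed
      then show "x \<in> \<Inter> (range C)" by blast
    next
      fix x assume x: "x \<in> \<Inter> (range C)"
      have GU: "G ` (ball 0 1 \<inter> ball z (1 / Suc n)) \<subseteq> ?U" for n using GF by auto
      have "x \<in> C 0" using x by blast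
      then have xcl: "x \<in> closure ?U" using closure_mono[OF GU[of 0]] unfolding C_def by blast
      have "dist (f x) z \<le> 1 / Suc n" for n
      proof -
        have "closed (closure ?U \<inter> f -` cball z (1 / Suc n))"
          by (rule continuous_closed_preimage[OF contf]) auto
        moreover have "G ` (ball 0 1 \<inter> ball z (1 / Suc n)) \<subseteq> closure ?U \<inter> f -` cball z (1 / Suc n)"
          using GF fF clU by auto
        ultimately have "C n \<subseteq> closure ?U \<inter> f -` cball z (1 / Suc n)"
          unfolding C_def by (intro closure_minimal)
        moreover have "x \<in> C n" using x by blast
        ultimately show ?thesis by (auto simp: dist_commute)
      qed
      then have "dist (f x) z \<le> e" if "e > 0" for e
        using nat_approx_posE[OF that] by (metis less_imp_le order_trans)
      then have "f x = z" using dense_ge[of 0 "dist (f x) z"] by force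
      moreover have "x \<notin> ?U" using z1 calculation fF[of x] FG[of x] by auto
      ultimately show "x \<in> X" using xcl clU by (auto simp: X_def)
    qed
    have GU: "G ` (ball 0 1 \<inter> ball z (1 / Suc n)) \<subseteq> ?U" for n using GF by auto
    have "connected (\<Inter> (range C))"
    proof (rule connected_nest)
      fix n
      have "bounded (G ` (ball 0 1 \<inter> ball z (1 / Suc n)))" using GU Jd bounded_subset by metis
      then show "compact (C n)" unfolding C_def by (simp only: compact_closure)
      show "connected (C n)"
        unfolding C_def
        by (intro connected_imp_connected_closure connected_continuous_image continuous_on_subset[OF contG]
              convex_connected convex_Int convex_ball) auto
    next
      fix m n :: nat assume "m \<le> n"
      then have "1 / real (Suc n) \<le> 1 / Suc m" by (simp add: frac_le)
      then show "C n \<subseteq> C m" unfolding C_def by (intro closure_mono image_mono Int_mono subset_ball) auto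
    qed
    then have "connected X" by (simp add: XC)
    moreover have "a \<in> X" "b \<in> X" "X \<subseteq> ?J" using ab by (auto simp: X_def z_def)
    ultimately obtain x r where xr: "x \<in> ?J" "r > 0" "?J \<inter> ball x r \<subseteq> X"
      using connected_loop_subset_contains_arc[OF p] \<open>a \<noteq> b\<close> by metis
    show False
      by (rule not_constant_on_loop_arc[OF p F _ contf fF xr(1,2) _ z1]) (use FG xr(3) X_def in auto)
  qed
  have injf: "inj_on f (closure ?U)"
  proof (rule inj_onI)
    fix a b assume ab: "a \<in> closure ?U" "b \<in> closure ?U" "f a = f b"
    have U1: "norm (f u) < 1 \<and> G (f u) = u" if "u \<in> ?U" for u using fF[OF that] FG[OF that] by simp
    show "a = b"
      using ab inj[of a b] fJ[of a] fJ[of b] U1[of a] U1[of b] unfolding clU by (metis UnE order_less_irrefl)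
  qed
  have "compact (closure ?U)" using Jd by simp
  have im: "f ` closure ?U = cball 0 1"
  proof
    show "f ` closure ?U \<subseteq> cball 0 1" unfolding clU using fJ fF FG by (auto simp: less_imp_le)
    have "closed (f ` closure ?U)"
      using \<open>compact (closure ?U)\<close> contf compact_continuous_image compact_imp_closed by blast
    moreover have "ball 0 1 \<subseteq> f ` closure ?U"
    proof
      fix z :: complex assume "z \<in> ball 0 1"
      then have "G z \<in> ?U" "f (G z) = z" using GF fF by auto
      then show "z \<in> f ` closure ?U" using clU by (metis UnI1 image_eqI)
    qed
    ultimately have "closure (ball 0 1) \<subseteq> f ` closure ?U" by (intro closure_minimal)
    moreover have "closure (ball 0 1) = cball (0::complex) 1" by simp
    ultimately show "cball 0 1 \<subseteq> f ` closure ?U" by simp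
  qed
  obtain g where "homeomorphism (closure ?U) (cball 0 1) f g"
    using homeomorphism_compact[OF \<open>compact (closure ?U)\<close> contf im injf] by blast
  then have "homeomorphism (?U \<union> ?J) (cball 0 1) f g" by (simp only: clU)
  moreover have "f ` ?J \<subseteq> sphere 0 1" using fJ by auto
  ultimately show thesis by (rule that)
qed

section \<open>Triangulations of the unrolled disk\<close>

text \<open>The integers are the marked points on the boundary of the universal cover of the punctured disk, whose
  deck transformations are the translations by multiples of \<open>n\<close>; the puncture is at infinity.  The
  chord from \<open>i\<close> to \<open>i + n\<close> is a loop downstairs.\<close>

datatype cover_arc = Chord int int | Spoke int

fun shift :: "int \<Rightarrow> cover_arc \<Rightarrow> cover_arc" where
  "shift d (Chord i j) = Chord (i + d) (j + d)"
| "shift d (Spoke i) = Spoke (i + d)"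

fun crosses :: "cover_arc \<Rightarrow> cover_arc \<Rightarrow> bool" where
  "crosses (Chord a b) (Chord c d) \<longleftrightarrow> a < c \<and> c < b \<and> b < d \<or> c < a \<and> a < d \<and> d < b"
| "crosses (Chord a b) (Spoke c) \<longleftrightarrow> a < c \<and> c < b"
| "crosses (Spoke c) (Chord a b) \<longleftrightarrow> a < c \<and> c < b"
| "crosses (Spoke c) (Spoke d) \<longleftrightarrow> False"

text \<open>A chord longer than \<open>n\<close> would cross its own translate by \<open>n\<close>,
  so it cannot come from a simple arc.\<close>

fun valid :: "int \<Rightarrow> cover_arc \<Rightarrow> bool" where
  "valid n (Chord i j) \<longleftrightarrow> i < j \<and> j \<le> i + n"
| "valid n (Spoke i) \<longleftrightarrow> True"

definition orbit :: "int \<Rightarrow> cover_arc \<Rightarrow> cover_arc set" where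
  "orbit n x = range (\<lambda>k. shift (k * n) x)"

definition family :: "int \<Rightarrow> cover_arc set \<Rightarrow> bool" where
  "family n T \<longleftrightarrow> (\<forall>x\<in>T. valid n x) \<and> (\<forall>x. shift n x \<in> T \<longleftrightarrow> x \<in> T) \<and> (\<forall>x\<in>T. \<forall>y\<in>T. \<not> crosses x y)"

definition triang :: "int \<Rightarrow> cover_arc set \<Rightarrow> bool" where
  "triang n T \<longleftrightarrow> family n T \<and> (\<forall>T'. family n T' \<longrightarrow> T \<subseteq> T' \<longrightarrow> T' = T)"

section \<open>Periodic families and their maximality\<close>

lemma shift_0 [simp]: "shift 0 x = x" by (cases x) auto

lemma shift_shift [simp]: "shift d (shift e x) = shift (d + e) x" by (cases x) auto

lemma crosses_sym: "crosses x y \<longleftrightarrow> crosses y x" by (cases x; cases y) auto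

lemma crosses_shift [simp]: "crosses (shift d x) (shift d y) \<longleftrightarrow> crosses x y" by (cases x; cases y) auto

lemma valid_shift [simp]: "valid n (shift d x) \<longleftrightarrow> valid n x" by (cases x) auto

text \<open>Distinct translates start at least \<open>n\<close> apart, which is no less than the
  length of the chord, so they cannot interlace.\<close>

lemma valid_not_crosses_orbit:
  assumes "valid n x" "n \<ge> 1"
  shows "\<not> crosses x (shift (k * n) x)"
proof (cases x)
  case (Chord i j)
  have ij: "j \<le> i + n" using assms Chord by simp
  have False if "i < i + k * n" "i + k * n < j"
  proof -
    have "k \<ge> 1" using that assms by (smt (verit) mult_nonpos_nonneg)
    then have "k * n \<ge> n" using assms by simp
    then show False using that ij by linarith
  qed
  moreover have False if "i + k * n < i" "i < j + k * n"
  proof -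
    have "k \<le> -1" using that assms by (smt (verit) mult_nonneg_nonneg)
    then have "k * n \<le> - n" using assms mult_right_mono[of k "-1" n] by simp
    then show False using that ij by linarith
  qed
  ultimately show ?thesis using Chord by auto
qed auto

lemma orbit_refl: "x \<in> orbit n x"
  unfolding orbit_def by (rule range_eqI[of _ _ 0]) simp

lemma orbit_eq: "y \<in> orbit n x \<Longrightarrow> orbit n y = orbit n x"
proof -
  assume "y \<in> orbit n x"
  then obtain k where k: "y = shift (k * n) x" by (auto simp: orbit_def)
  have "shift (l * n) y \<in> orbit n x" for l
    unfolding orbit_def k by (rule range_eqI[of _ _ "l + k"]) (simp add: algebra_simps)
  moreover have "shift (l * n) x \<in> orbit n y" for l
    unfolding orbit_def k by (rule range_eqI[of _ _ "l - k"]) (simp add: algebra_simps)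
  ultimately show ?thesis unfolding orbit_def by blast
qed

lemma family_shift:
  assumes "family n T"
  shows "shift (k * n) x \<in> T \<longleftrightarrow> x \<in> T"
proof (induction k rule: int_induct[where k = 0])
  case (step1 i)
  have "shift ((i + 1) * n) x = shift n (shift (i * n) x)" by (simp add: algebra_simps)
  then show ?case using assms step1 unfolding family_def by metis
next
  case (step2 i)
  have "shift (i * n) x = shift n (shift ((i - 1) * n) x)" by (simp add: algebra_simps)
  then show ?case using assms step2 unfolding family_def by metis
qed simp

lemma orbit_subset_family: "family n T \<Longrightarrow> x \<in> T \<Longrightarrow> orbit n x \<subseteq> T"
  using family_shift by (auto simp: orbit_def)

lemma shift_orbit: "shift n x \<in> orbit n y \<longleftrightarrow> x \<in> orbit n y"
proof
  assume "x \<in> orbit n y"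
  then obtain k where "x = shift (k * n) y" by (auto simp: orbit_def)
  then show "shift n x \<in> orbit n y"
    unfolding orbit_def by (intro range_eqI[of _ _ "k + 1"]) (simp add: algebra_simps)
next
  assume "shift n x \<in> orbit n y"
  then obtain k where "shift n x = shift (k * n) y" by (auto simp: orbit_def)
  then have "shift (-n) (shift n x) = shift (-n) (shift (k * n) y)" by simp
  then show "x \<in> orbit n y"
    unfolding orbit_def by (intro range_eqI[of _ _ "k - 1"]) (simp add: algebra_simps)
qed

text \<open>Maximality concerns periodic families, so the whole orbit of \<open>x\<close> has to be
  added: its members avoid \<open>T\<close> by periodicity, and they avoid each other because
  \<open>x\<close> is valid.\<close>

lemma triangI_mem:
  assumes T: "triang n T" and n: "n \<ge> 1" and x: "valid n x" "\<And>y. y \<in> T \<Longrightarrow> \<not> crosses x y"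
  shows "x \<in> T"
proof -
  have fT: "family n T" using T by (simp add: triang_def)
  have xT: "\<not> crosses (shift (k * n) x) y" if "y \<in> T" for k y
  proof -
    have "shift (k * n) (shift (- k * n) y) = y" by simp
    moreover have "shift (- k * n) y \<in> T" using family_shift[OF fT] that by blast
    ultimately show ?thesis using x(2) crosses_shift by metis
  qed
  have xx: "\<not> crosses (shift (k * n) x) (shift (l * n) x)" for k l
  proof -
    have "shift (l * n) x = shift (k * n) (shift ((l - k) * n) x)" by (simp add: algebra_simps)
    then show ?thesis using valid_not_crosses_orbit[OF x(1) n] crosses_shift by metis
  qed
  have "family n (T \<union> orbit n x)"
    unfolding family_def
  proof (intro conjI ballI allI)
    fix y assume "y \<in> T \<union> orbit n x" then show "valid n y"
      using fT x(1) by (auto simp: family_def orbit_def)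
  next
    fix y show "shift n y \<in> T \<union> orbit n x \<longleftrightarrow> y \<in> T \<union> orbit n x"
      using fT shift_orbit by (auto simp: family_def)
  next
    fix y z assume "y \<in> T \<union> orbit n x" "z \<in> T \<union> orbit n x"
    then show "\<not> crosses y z"
      using fT xT xx crosses_sym unfolding family_def orbit_def by blast
  qed
  then have "T \<union> orbit n x = T" using T by (auto simp: triang_def)
  then show ?thesis using orbit_refl by blast
qed

lemma int_greatest:
  fixes S :: "int set"
  assumes "a \<in> S" "\<And>z. z \<in> S \<Longrightarrow> z \<le> B"
  obtains m where "m \<in> S" "\<And>z. z \<in> S \<Longrightarrow> z \<le> m"
proof -
  let ?F = "{z \<in> S. a \<le> z}"
  have "finite ?F" by (rule finite_subset[of _ "{a..B}"]) (use assms in auto)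
  moreover have "?F \<noteq> {}" using assms by auto
  ultimately have "Max ?F \<in> ?F" "\<And>z. z \<in> ?F \<Longrightarrow> z \<le> Max ?F" using Max_in Max_ge by blast+
  then show thesis using that[of "Max ?F"] by force
qed

lemma int_least:
  fixes S :: "int set"
  assumes "a \<in> S" "\<And>z. z \<in> S \<Longrightarrow> B \<le> z"
  obtains m where "m \<in> S" "\<And>z. z \<in> S \<Longrightarrow> m \<le> z"
proof -
  obtain m where "m \<in> uminus ` S" "\<And>z. z \<in> uminus ` S \<Longrightarrow> z \<le> m"
    by (rule int_greatest[of "- a" "uminus ` S" "- B"]) (use assms in auto)
  then show thesis using that[of "- m"] by force
qed

text \<open>A local description of the triangulations: every chord has a triangle below it, and
  consecutive spokes span a triangle at the puncture.\<close>

definition locally_complete :: "int \<Rightarrow> cover_arc set \<Rightarrow> bool" where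
  "locally_complete n T \<longleftrightarrow> family n T \<and> (\<forall>i. Chord i (i + 1) \<in> T) \<and>
     (\<forall>i j. Chord i j \<in> T \<longrightarrow> i + 1 < j \<longrightarrow> (\<exists>w. i < w \<and> w < j \<and> Chord i w \<in> T \<and> Chord w j \<in> T)) \<and>
     (\<exists>i. Spoke i \<in> T) \<and>
     (\<forall>u v. Spoke u \<in> T \<longrightarrow> Spoke v \<in> T \<longrightarrow> u < v \<longrightarrow> v \<le> u + n \<longrightarrow>
        (\<forall>w. u < w \<longrightarrow> w < v \<longrightarrow> Spoke w \<notin> T) \<longrightarrow> Chord u v \<in> T)"

lemma family_spoke_near:
  assumes "family n T" "Spoke i \<in> T" "n \<ge> 1"
  shows "\<exists>w. Spoke w \<in> T \<and> c - n < w \<and> w \<le> c"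
proof (intro exI conjI)
  let ?w = "c - (c - i) mod n"
  have "?w = i + ((c - i) div n) * n" using div_mult_mod_eq[of "c - i" n] by linarith
  then have "Spoke ?w = shift (((c - i) div n) * n) (Spoke i)" by simp
  then show "Spoke ?w \<in> T" using family_shift[OF assms(1)] assms(2) by metis
  show "c - n < ?w" "?w \<le> c" using assms(3) pos_mod_bound[of n "c - i"] pos_mod_sign[of n "c - i"] by linarith+
qed

text \<open>Extremal choice of a spoke at or before \<open>c\<close> and of one at or after
  \<open>d\<close>. The final disjunction among the hypotheses rules out that both are the spoke at
  \<open>c = d\<close>.\<close>

lemma family_spokes_around:
  assumes T: "family n T" and n: "n \<ge> 1" and "Spoke i \<in> T" and cd: "c \<le> d" "d \<le> c + n"
    and free: "\<And>w. c < w \<Longrightarrow> w < d \<Longrightarrow> Spoke w \<notin> T" and "c < d \<or> Spoke c \<notin> T"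
  obtains u v where "Spoke u \<in> T" "Spoke v \<in> T" "u \<le> c" "d \<le> v" "u < v" "v \<le> u + n"
    "\<And>w. u < w \<Longrightarrow> w < v \<Longrightarrow> Spoke w \<notin> T"
proof -
  obtain u0 where u0: "Spoke u0 \<in> T" "u0 \<le> c" using family_spoke_near[OF assms(1,3,2)] by blast
  obtain u where u: "Spoke u \<in> T" "u \<le> c" "\<And>z. Spoke z \<in> T \<Longrightarrow> z \<le> c \<Longrightarrow> z \<le> u"
    by (rule int_greatest[of u0 "{z. Spoke z \<in> T \<and> z \<le> c}" c]) (use u0 in auto)
  obtain v0 where v0: "Spoke v0 \<in> T" "d \<le> v0"
    using family_spoke_near[OF assms(1,3,2), of "d + n"] by (auto intro: less_imp_le)
  obtain v where v: "Spoke v \<in> T" "d \<le> v" "\<And>z. Spoke z \<in> T \<Longrightarrow> d \<le> z \<Longrightarrow> v \<le> z"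
    by (rule int_least[of v0 "{z. Spoke z \<in> T \<and> d \<le> z}" d]) (use v0 in auto)
  have un: "Spoke (u + n) \<in> T" using T u(1) unfolding family_def by (metis shift.simps(2))
  have "c < u + n"
  proof (rule ccontr)
    assume "\<not> c < u + n"
    then show False using u(3)[of "u + n"] \<open>Spoke (u + n) \<in> T\<close> n by auto
  qed
  then have "d \<le> u + n" using free[of "u + n"] \<open>Spoke (u + n) \<in> T\<close> by force
  then have vn: "v \<le> u + n" using v(3)[OF \<open>Spoke (u + n) \<in> T\<close>] by blast
  have uv: "u < v"
  proof (rule ccontr)
    assume "\<not> u < v"
    then have "u = c" "c = d" using u(2) v(2) cd by linarith+
    then show False using u(1) assms(7) by simp
  qed
  have "Spoke w \<notin> T" if "u < w" "w < v" for w
  proof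
    assume w: "Spoke w \<in> T"
    have "c < w" using u(3)[OF w] that(1) by (meson not_le)
    moreover have "w < d" using v(3)[OF w] that(2) by (meson not_le)
    ultimately show False using free w by blast
  qed
  then show thesis by (rule that[OF u(1) v(1) u(2) v(2) uv vn])
qed

text \<open>Let \<open>T'\<close> be a larger family. A chord of \<open>T'\<close> passes over no
  spoke of \<open>T\<close>, hence lies below the chord between two consecutive spokes, and
  descending through the triangles ends at the chord itself. A spoke outside \<open>T\<close> would
  cross the chord that closes its gap.\<close>

lemma locally_complete_imp_triang:
  assumes T: "locally_complete n T" and n: "n \<ge> 1"
  shows "triang n T"
  unfolding triang_def
proof (intro conjI allI impI)
  show fT: "family n T" using T by (simp add: locally_complete_def)
  obtain i where i: "Spoke i \<in> T" using T by (auto simp: locally_complete_def)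
  have consec: "Chord u v \<in> T" if "Spoke u \<in> T" "Spoke v \<in> T" "u < v" "v \<le> u + n"
    "\<And>w. u < w \<Longrightarrow> w < v \<Longrightarrow> Spoke w \<notin> T" for u v
    using T that unfolding locally_complete_def by blast
  fix T' assume T': "family n T'" "T \<subseteq> T'"
  have nc: "\<not> crosses x y" if "x \<in> T'" "y \<in> T'" for x y using T' that by (auto simp: family_def)
  have descend: "Chord c d \<in> T" if "Chord c d \<in> T'" "Chord u v \<in> T" "u \<le> c" "d \<le> v" for c d u v
    using that(2-4)
  proof (induction "nat (v - u)" arbitrary: u v rule: less_induct)
    case less
    have cd: "c < d" using T'(1) that(1) by (auto simp: family_def)
    show ?case
    proof (cases "u = c \<and> v = d")
      case False
      then have "u + 1 < v" using less.prems cd by auto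
      then obtain w where w: "u < w" "w < v" "Chord u w \<in> T" "Chord w v \<in> T"
        using T less.prems unfolding locally_complete_def by blast
      have "d \<le> w \<or> w \<le> c"
        using nc[OF that(1), of "Chord u w"] nc[OF that(1), of "Chord w v"] w T'(2) less.prems False by auto
      then show ?thesis
      proof
        assume "d \<le> w" then show ?thesis using less.hyps[of w u] less.prems w by auto
      next
        assume "w \<le> c" then show ?thesis using less.hyps[of v w] less.prems w by auto
      qed
    qed (use less in auto)
  qed
  have "x \<in> T" if x: "x \<in> T'" for x
  proof (cases x)
    case (Chord c d)
    have cd: "c < d" "d \<le> c + n" using T'(1) x Chord by (auto simp: family_def)
    have "Spoke w \<notin> T" if "c < w" "w < d" for w
      using nc[OF x, of "Spoke w"] T'(2) that Chord by auto
    then obtain u v where "Spoke u \<in> T" "Spoke v \<in> T" "u \<le> c" "d \<le> v" "u < v" "v \<le> u + n"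
      "\<And>w. u < w \<Longrightarrow> w < v \<Longrightarrow> Spoke w \<notin> T"
      using family_spokes_around[OF fT n i, of c d] cd by auto
    then show ?thesis using consec[of u v] descend[of c d u v] x Chord by blast
  next
    case (Spoke c)
    show ?thesis
    proof (rule ccontr)
      assume "x \<notin> T"
      then obtain u v where uv: "Spoke u \<in> T" "Spoke v \<in> T" "u \<le> c" "c \<le> v" "u < v" "v \<le> u + n"
        "\<And>w. u < w \<Longrightarrow> w < v \<Longrightarrow> Spoke w \<notin> T"
        using family_spokes_around[OF fT n i, of c c] Spoke n by auto
      then have "Chord u v \<in> T'" "u \<noteq> c" "v \<noteq> c" using consec[of u v] T'(2) \<open>x \<notin> T\<close> Spoke by auto
      then show False using nc[OF x, of "Chord u v"] uv Spoke by auto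
    qed
  qed
  then show "T' = T" using T'(2) by blast
qed

text \<open>Extremal choices produce the required arcs. The apex below a chord from \<open>i\<close>
  to \<open>j\<close> is the farthest neighbour of \<open>i\<close> before \<open>j\<close>. A spoke
  exists at the left end of a longest chord, since a chord passing over that point would strictly
  contain the longest one.\<close>

lemma triang_imp_locally_complete:
  assumes T: "triang n T" and n: "n \<ge> 1"
  shows "locally_complete n T"
proof -
  have fT: "family n T" using T by (simp add: triang_def)
  have nc: "\<not> crosses x y" if "x \<in> T" "y \<in> T" for x y using fT that by (auto simp: family_def)
  note mem = triangI_mem[OF T n]
  have bd: "Chord i (i + 1) \<in> T" for i
  proof (rule mem)
    show "\<not> crosses (Chord i (i + 1)) y" if "y \<in> T" for y
      using that by (cases y) auto
  qed (use n in auto)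
  have below: "\<exists>w. i < w \<and> w < j \<and> Chord i w \<in> T \<and> Chord w j \<in> T" if ij: "Chord i j \<in> T" "i + 1 < j" for i j
  proof -
    obtain w where w: "i < w" "w < j" "Chord i w \<in> T" "\<And>z. i < z \<Longrightarrow> z < j \<Longrightarrow> Chord i z \<in> T \<Longrightarrow> z \<le> w"
      by (rule int_greatest[of "i + 1" "{z. i < z \<and> z < j \<and> Chord i z \<in> T}" j]) (use ij bd in auto)
    have "Chord w j \<in> T"
    proof (rule mem)
      show "valid n (Chord w j)" using fT ij w by (fastforce simp: family_def)
      fix y assume y: "y \<in> T"
      show "\<not> crosses (Chord w j) y"
      proof (cases y)
        case (Chord c d)
        then show ?thesis
          using nc[OF ij(1) y] nc[OF w(3) y] w(4)[of d] w(1,2) y by (cases "c = i") auto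
      next
        case (Spoke c)
        then show ?thesis using nc[OF ij(1) y] w by auto
      qed
    qed
    then show ?thesis using w by blast
  qed
  have sp: "\<exists>i. Spoke i \<in> T"
  proof -
    obtain l where l: "\<exists>i. Chord i (i + l) \<in> T" "\<And>z. \<exists>i. Chord i (i + z) \<in> T \<Longrightarrow> z \<le> l"
      by (rule int_greatest[of 1 "{z. \<exists>i. Chord i (i + z) \<in> T}" n]) (use bd fT in \<open>fastforce simp: family_def\<close>)+
    then obtain i where i: "Chord i (i + l) \<in> T" by blast
    have "Spoke i \<in> T"
    proof (rule mem)
      fix y assume y: "y \<in> T"
      show "\<not> crosses (Spoke i) y"
      proof (cases y)
        case (Chord c d)
        have "\<exists>i. Chord i (i + (d - c)) \<in> T" by (rule exI[of _ c]) (use y Chord in simp)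
        then have "d - c \<le> l" by (rule l(2))
        then show ?thesis using nc[OF i y] Chord by auto
      qed auto
    qed auto
    then show ?thesis by blast
  qed
  have cons: "Chord u v \<in> T" if uv: "Spoke u \<in> T" "Spoke v \<in> T" "u < v" "v \<le> u + n"
    "\<forall>w. u < w \<longrightarrow> w < v \<longrightarrow> Spoke w \<notin> T" for u v
  proof (rule mem)
    fix y assume y: "y \<in> T"
    show "\<not> crosses (Chord u v) y"
      using nc[OF uv(1) y] nc[OF uv(2) y] uv y by (cases y) auto
  qed (use uv in auto)
  show ?thesis
    unfolding locally_complete_def
    by (intro conjI allI impI; (rule fT | rule bd | (rule below; assumption) | rule sp | (rule cons; assumption)))
qed

section \<open>Flips towards the star of spokes\<close>

definition tri_adj :: "int \<Rightarrow> (cover_arc set \<times> cover_arc set) set" where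
  "tri_adj n = {(T, T'). triang n T \<and> triang n T' \<and>
     (\<exists>x y. T - T' = orbit n x \<and> T' - T = orbit n y)}"

definition star :: "int \<Rightarrow> cover_arc set" where
  "star n = {Spoke i | i. True} \<union> {Chord i (i + 1) | i. True}"

definition missing :: "int \<Rightarrow> cover_arc set \<Rightarrow> int set" where
  "missing n T = {i \<in> {0..<n}. Spoke i \<notin> T}"

lemma shift_mod: "shift ((- (i div n)) * n) (Spoke i) = Spoke (i mod n)"
  by (simp add: minus_div_mult_eq_mod)

lemma spoke_mod_iff:
  assumes "family n T"
  shows "Spoke (i mod n) \<in> T \<longleftrightarrow> Spoke i \<in> T"
  using family_shift[OF assms, of "- (i div n)" "Spoke i"] shift_mod[of i n] by simp

text \<open>A missing spoke lies in a gap between consecutive spokes \<open>u\<close> and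
  \<open>v\<close>. The chord \<open>u v\<close> is the common side of the triangle at the puncture
  and of a triangle \<open>u w v\<close> below it; replacing it by the spoke at \<open>w\<close>
  exchanges the diagonals of this quadrilateral. The case \<open>v = u + n\<close>, with a single
  spoke downstairs, is included.\<close>

lemma flip_to_more_spokes:
  assumes T: "triang n T" and n: "n \<ge> 1" and ne: "missing n T \<noteq> {}"
  obtains T' where "(T, T') \<in> tri_adj n" "card (missing n T') < card (missing n T)"
proof -
  have cT: "locally_complete n T" and fT: "family n T"
    using T n triang_imp_locally_complete by (auto simp: triang_def)
  have nc: "\<not> crosses x y" if "x \<in> T" "y \<in> T" for x y using fT that by (auto simp: family_def)
  obtain i where i: "Spoke i \<notin> T" using ne by (auto simp: missing_def)
  obtain i0 where "Spoke i0 \<in> T" using cT by (auto simp: locally_complete_def)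
  then obtain u v where uv: "Spoke u \<in> T" "Spoke v \<in> T" "u \<le> i" "i \<le> v" "u < v" "v \<le> u + n"
    "\<And>w. u < w \<Longrightarrow> w < v \<Longrightarrow> Spoke w \<notin> T"
    using family_spokes_around[OF fT n, of i0 i i] i n by auto
  have Cuv: "Chord u v \<in> T" using cT uv unfolding locally_complete_def by blast
  have "u + 1 < v" using uv i by (cases "u = i"; cases "v = i") auto
  then obtain w where w: "u < w" "w < v" "Chord u w \<in> T" "Chord w v \<in> T"
    using cT Cuv unfolding locally_complete_def by blast
  define C where "C = Chord u v"
  define S where "S = Spoke w"
  define T' where "T' = (T - orbit n C) \<union> orbit n S"
  have SnT: "orbit n S \<inter> T = {}"
  proof -
    have "S \<notin> T" using uv(7)[OF w(1,2)] by (simp add: S_def)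
    then show ?thesis using family_shift[OF fT] unfolding orbit_def by blast
  qed
  have CS: "crosses C S" using w by (simp add: C_def S_def)
  \<comment> \<open>The sides of the quadrilateral are the spokes at \<open>u\<close> and
    \<open>v\<close> and the chords \<open>u w\<close> and \<open>w v\<close>. An arc that crosses
    none of them but crosses \<open>S\<close> can only be the other diagonal.\<close>
  have onlyC: "y = C" if y: "y \<in> T" "crosses y S" for y
  proof (cases y)
    case (Chord c d)
    then show ?thesis
      using nc[OF y(1) w(3)] nc[OF y(1) w(4)] nc[OF y(1) uv(1)] nc[OF y(1) uv(2)] y(2) w(1,2)
      by (auto simp: S_def C_def)
  qed (use y in \<open>auto simp: S_def\<close>)
  have crossS: "y \<in> orbit n C" if y: "y \<in> T" "crosses y (shift (k * n) S)" for y k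
  proof -
    have "crosses (shift ((- k) * n) y) (shift ((- k) * n) (shift (k * n) S))" using y by (simp only: crosses_shift)
    then have "crosses (shift ((- k) * n) y) S" by simp
    moreover have "shift ((- k) * n) y \<in> T" using family_shift[OF fT] y by blast
    ultimately have "shift ((- k) * n) y = C" using onlyC by blast
    then have "y = shift (k * n) C" by (metis add.commute add_uminus_conv_diff diff_self minus_mult_left shift_0 shift_shift)
    then show ?thesis by (auto simp: orbit_def)
  qed
  have fT': "family n T'"
    unfolding family_def
  proof (intro conjI ballI allI)
    fix y assume "y \<in> T'" then show "valid n y"
      using fT by (auto simp: family_def T'_def orbit_def S_def)
  next
    fix y show "shift n y \<in> T' \<longleftrightarrow> y \<in> T'"
      using fT shift_orbit by (auto simp: family_def T'_def)
  next
    fix y z assume yz: "y \<in> T'" "z \<in> T'"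
    have a: "\<not> crosses y z" if "y \<in> T - orbit n C" "z \<in> orbit n S" for y z
      using that crossS[of y] by (auto simp: orbit_def)
    have "y \<in> T - orbit n C \<or> y \<in> orbit n S" "z \<in> T - orbit n C \<or> z \<in> orbit n S"
      using yz by (auto simp: T'_def)
    then consider "y \<in> T" "z \<in> T" | "y \<in> T - orbit n C" "z \<in> orbit n S" | "z \<in> T - orbit n C" "y \<in> orbit n S"
      | "y \<in> orbit n S" "z \<in> orbit n S" by blast
    then show "\<not> crosses y z"
    proof cases
      case 3 then show ?thesis using a[of z y] crosses_sym by blast
    qed (use nc a in \<open>auto simp: orbit_def S_def\<close>)
  qed
  have len: "Chord a b \<notin> orbit n C" if "b - a \<noteq> v - u" for a b
    using that by (auto simp: orbit_def C_def)
  have keep: "Spoke u \<in> T'" "Spoke v \<in> T'" "Chord u w \<in> T'" "Chord w v \<in> T'" "S \<in> T'"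
    using uv w len[of w u] len[of v w] orbit_refl[of S n] by (auto simp: T'_def) (auto simp: orbit_def C_def)
  have "triang n T'"
    unfolding triang_def
  proof (intro conjI allI impI)
    fix T'' assume T'': "family n T''" "T' \<subseteq> T''"
    have nc'': "\<not> crosses x y" if "x \<in> T''" "y \<in> T''" for x y using T'' that by (auto simp: family_def)
    have noC: "x = S" if x: "x \<in> T''" "crosses x C" for x
    proof (cases x)
      case (Chord c d)
      then show ?thesis
        using nc''[OF x(1), of "Spoke u"] nc''[OF x(1), of "Spoke v"] keep T''(2) x(2) uv(5)
        by (auto simp: C_def)
    next
      case (Spoke c)
      then have "u < c" "c < v" using x by (auto simp: C_def)
      moreover have "\<not> (u < c \<and> c < w)" "\<not> (w < c \<and> c < v)"
        using nc''[OF x(1), of "Chord u w"] nc''[OF x(1), of "Chord w v"] keep T''(2) Spoke by auto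
      ultimately show ?thesis using Spoke by (auto simp: S_def)
    qed
    \<comment> \<open>An arc of the larger family that crosses a translate of \<open>C\<close> is a
      translate of \<open>S\<close>. Any other one crosses nothing in \<open>T\<close>, so it was
      there before the flip.\<close>
    have "x \<in> T'" if x: "x \<in> T''" for x
    proof (cases "\<exists>k. crosses x (shift (k * n) C)")
      case True
      then obtain k where "crosses x (shift (k * n) C)" by blast
      then have "crosses (shift ((- k) * n) x) (shift ((- k) * n) (shift (k * n) C))" by (simp only: crosses_shift)
      then have "crosses (shift ((- k) * n) x) C" by simp
      moreover have "shift ((- k) * n) x \<in> T''" using family_shift[OF T''(1)] x by blast
      ultimately have "shift ((- k) * n) x = S" using noC by blast
      then have "shift ((- k) * n) x \<in> T'" using keep by simp
      then show ?thesis using family_shift[OF fT'] by blast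
    next
      case False
      have "x \<in> T"
      proof (rule triangI_mem[OF T n])
        show "valid n x" using T'' x by (auto simp: family_def)
        fix y assume "y \<in> T"
        then show "\<not> crosses x y"
          using False nc''[OF x, of y] T''(2) by (auto simp: T'_def orbit_def)
      qed
      moreover have "x \<notin> orbit n C"
      proof
        assume "x \<in> orbit n C"
        then obtain k where "x = shift (k * n) C" by (auto simp: orbit_def)
        then have "crosses x (shift (k * n) S)" using CS by simp
        moreover have "shift (k * n) S \<in> T''" using family_shift[OF T''(1)] keep T''(2) by blast
        ultimately show False using nc'' x by blast
      qed
      ultimately show ?thesis by (simp add: T'_def)
    qed
    then show "T'' = T'" using T''(2) by blast
  qed (rule fT')
  moreover have "T - T' = orbit n C" "T' - T = orbit n S"
    using SnT orbit_subset_family[OF fT Cuv] by (auto simp: T'_def C_def)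
  ultimately have "(T, T') \<in> tri_adj n" using T unfolding tri_adj_def by blast
  moreover have "missing n T' \<subset> missing n T"
  proof
    have "Spoke j \<notin> orbit n C" for j by (auto simp: orbit_def C_def)
    then show "missing n T' \<subseteq> missing n T" by (auto simp: missing_def T'_def)
    have "w mod n \<in> missing n T"
      using n uv(7)[OF w(1,2)] spoke_mod_iff[OF fT] by (auto simp: missing_def)
    moreover have "w mod n \<notin> missing n T'"
      using keep(5) spoke_mod_iff[OF fT'] by (auto simp: missing_def S_def)
    ultimately show "missing n T' \<noteq> missing n T" by blast
  qed
  then have "card (missing n T') < card (missing n T)"
    by (intro psubset_card_mono finite_subset[of "missing n T" "{0..<n}"]) (auto simp: missing_def)
  ultimately show thesis using that by blast
qed

lemma triang_no_missing:
  assumes T: "triang n T" and n: "n \<ge> 1" and "missing n T = {}"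
  shows "T = star n"
proof -
  have cT: "locally_complete n T" and fT: "family n T"
    using T n triang_imp_locally_complete by (auto simp: triang_def)
  have sp: "Spoke i \<in> T" for i
  proof -
    have "i mod n \<in> {0..<n}" using n by simp
    then have "Spoke (i mod n) \<in> T" using assms(3) by (auto simp: missing_def)
    then show ?thesis using spoke_mod_iff[OF fT] by simp
  qed
  have "y \<in> star n" if y: "y \<in> T" for y
  proof (cases y)
    case (Chord i j)
    have "i < j" using fT y Chord by (auto simp: family_def)
    moreover have "\<not> i + 1 < j"
      using sp[of "i + 1"] y Chord fT by (fastforce simp: family_def)
    ultimately show ?thesis using Chord by (auto simp: star_def)
  qed (auto simp: star_def)
  then show ?thesis using cT sp by (auto simp: star_def locally_complete_def)
qed

lemma distance_to_star:
  assumes "triang n T" and n: "n \<ge> 1"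
  obtains k where "k \<le> nat n - 1" "(T, star n) \<in> tri_adj n ^^ k"
proof -
  have "\<exists>k. k \<le> card (missing n T) \<and> (T, star n) \<in> tri_adj n ^^ k"
    using assms(1)
  proof (induction "card (missing n T)" arbitrary: T rule: less_induct)
    case less
    show ?case
    proof (cases "missing n T = {}")
      case True
      then show ?thesis using triang_no_missing[OF less.prems n] by (intro exI[of _ 0]) auto
    next
      case False
      obtain T' where T': "(T, T') \<in> tri_adj n" "card (missing n T') < card (missing n T)"
        using flip_to_more_spokes[OF less.prems n False] by blast
      then have "triang n T'" by (simp add: tri_adj_def)
      then obtain k where "k \<le> card (missing n T')" "(T', star n) \<in> tri_adj n ^^ k"
        using less.hyps[OF T'(2)] by blast
      then show ?thesis using T' relpow_Suc_I2 by (intro exI[of _ "Suc k"]) auto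
    qed
  qed
  \<comment> \<open>Some spoke is always present, so at most \<open>n - 1\<close> are
    missing.\<close>
  moreover have "card (missing n T) \<le> nat n - 1"
  proof -
    obtain i where "Spoke i \<in> T" using triang_imp_locally_complete[OF assms] by (auto simp: locally_complete_def)
    then have "i mod n \<notin> missing n T"
      using spoke_mod_iff[of n T i] assms(1) by (auto simp: missing_def triang_def)
    then have "missing n T \<subseteq> {0..<n} - {i mod n}" by (auto simp: missing_def)
    then have "card (missing n T) \<le> card ({0..<n} - {i mod n})" by (intro card_mono) auto
    then show ?thesis using n by simp
  qed
  ultimately show thesis using that order_trans by blast
qed

lemma relpow_sym:
  assumes "sym E" "(a, b) \<in> E ^^ k"
  shows "(b, a) \<in> E ^^ k"
  using assms(2)
proof (induction k arbitrary: b)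
  case (Suc k)
  then obtain c where "(a, c) \<in> E ^^ k" "(c, b) \<in> E" by auto
  then show ?case using Suc.IH assms(1) relpow_Suc_I2[of b c E a k] by (auto dest: symD)
qed auto

lemma tri_adj_distance_le:
  assumes "triang n T" "triang n T'" and n: "n \<ge> 1"
  obtains k where "k \<le> 2 * nat n - 2" "(T, T') \<in> tri_adj n ^^ k"
proof -
  obtain k where k: "k \<le> nat n - 1" "(T, star n) \<in> tri_adj n ^^ k" using distance_to_star assms by blast
  obtain l where l: "l \<le> nat n - 1" "(T', star n) \<in> tri_adj n ^^ l" using distance_to_star assms by blast
  have "(star n, T') \<in> tri_adj n ^^ l"
    by (rule relpow_sym[OF _ l(2)]) (auto simp: sym_def tri_adj_def)
  then have "(T, T') \<in> tri_adj n ^^ (k + l)" using k(2) relpow_add by blast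
  moreover have "k + l \<le> 2 * nat n - 2" using k l by simp
  ultimately show thesis using that by blast
qed

section \<open>The distance between opposite fans\<close>

text \<open>Identifies \<open>1\<close> and \<open>2\<close> modulo \<open>n\<close> and renumbers with period \<open>n - 1\<close>.\<close>

definition squeeze :: "int \<Rightarrow> int \<Rightarrow> int" where
  "squeeze n i = i - ((i - 2) div n + 1)"

lemma squeeze_add: "n \<ge> 1 \<Longrightarrow> squeeze n (i + k * n) = squeeze n i + k * (n - 1)"
proof -
  assume "n \<ge> 1"
  then have "((i - 2) + k * n) div n = k + (i - 2) div n" by (intro div_mult_self1) simp
  moreover have "i + k * n - 2 = (i - 2) + k * n" by simp
  ultimately have "(i + k * n - 2) div n = k + (i - 2) div n" by metis
  then show ?thesis unfolding squeeze_def right_diff_distrib by linarith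
qed

lemma squeeze_step: "n \<ge> 1 \<Longrightarrow> squeeze n (i + 1) = squeeze n i \<or> squeeze n (i + 1) = squeeze n i + 1"
proof -
  assume n: "n \<ge> 1"
  have "(i - 2) div n \<le> (i - 1) div n" using n by (intro zdiv_mono1) auto
  moreover have "(i - 1) div n \<le> (i - 2 + n) div n" using n by (intro zdiv_mono1) auto
  moreover have "(i - 2 + n) div n = (i - 2) div n + 1" using n div_add_self2[of n "i - 2"] by simp
  moreover have "i + 1 - 2 = i - 1" by simp
  ultimately show ?thesis unfolding squeeze_def by (simp only:) linarith
qed

lemma squeeze_mono:
  assumes n: "n \<ge> 1" and "i \<le> j"
  shows "squeeze n i \<le> squeeze n j"
  using assms(2)
proof (induction j rule: int_ge_induct[where k = i])
  case (step j)
  then show ?case using squeeze_step[OF n, of j] by linarith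
qed simp

lemma squeeze_less: "n \<ge> 1 \<Longrightarrow> squeeze n i < squeeze n j \<Longrightarrow> i < j"
  by (meson squeeze_mono not_le)

text \<open>Every edge after the contraction comes from an edge that is not collapsed. Writing
  \<open>a - 1 = q * (n - 1) + r\<close>, the witness is \<open>q * n + r + 2\<close>; blocks that
  start at residue 2 have the collapsed edges between them.\<close>

lemma squeeze_section:
  assumes "n \<ge> 2"
  obtains i where "squeeze n i = a" "squeeze n (i + 1) = a + 1"
proof -
  define q r where "q = (a - 1) div (n - 1)" and "r = (a - 1) mod (n - 1)"
  have a: "a = q * (n - 1) + r + 1" using div_mult_mod_eq[of "a - 1" "n - 1"] by (simp add: q_def r_def)
  have r: "0 \<le> r" "r + 1 < n" using assms by (auto simp: r_def) (smt (verit) pos_mod_bound)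
  have 1: "(q * n + r) div n = q" using r by simp
  have 2: "(q * n + r + 1) div n = q" using r by (simp add: add.assoc)
  have "squeeze n (q * n + r + 2) = a" "squeeze n (q * n + r + 2 + 1) = a + 1"
    using 1 2 by (auto simp: squeeze_def a algebra_simps)
  then show thesis using that by blast
qed

fun proj :: "int \<Rightarrow> cover_arc \<Rightarrow> cover_arc" where
  "proj n (Chord i j) = Chord (squeeze n i) (squeeze n j)"
| "proj n (Spoke i) = Spoke (squeeze n i)"

text \<open>Contracting the boundary edges from \<open>1\<close> to \<open>2\<close>; the degenerate images of these edges are
  discarded by \<^const>\<open>valid\<close>.\<close>

definition contract :: "int \<Rightarrow> cover_arc set \<Rightarrow> cover_arc set" where
  "contract n T = {y \<in> proj n ` T. valid (n - 1) y}"

lemma proj_shift: "n \<ge> 1 \<Longrightarrow> proj n (shift (k * n) x) = shift (k * (n - 1)) (proj n x)"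
  by (cases x) (auto simp: squeeze_add)

text \<open>Monotonicity of \<open>squeeze\<close> lets strict inequalities be pulled back, so
  contraction creates no new crossing.\<close>

lemma crosses_proj:
  assumes "n \<ge> 1" "crosses (proj n x) (proj n y)"
  shows "crosses x y"
  using assms(2) by (cases x; cases y) (auto dest: squeeze_less[OF assms(1)])

lemma chord_contract:
  assumes "n \<ge> 1" "family n T" "Chord i j \<in> T" "squeeze n i < squeeze n j"
  shows "Chord (squeeze n i) (squeeze n j) \<in> contract n T"
proof -
  have "j \<le> i + 1 * n" using assms by (auto simp: family_def)
  then have "squeeze n j \<le> squeeze n i + (n - 1)"
    using squeeze_mono[of n j "i + 1 * n"] squeeze_add[of n i 1] assms(1) by simp
  then show ?thesis unfolding contract_def using assms(3,4) by (auto intro!: image_eqI[of _ _ "Chord i j"])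
qed

text \<open>If the apex of a triangle is merged with an end of its long side, one of the short sides
  has the same projection as the long one, and the apex is sought below that side instead; the
  length decreases, so this terminates.\<close>

lemma contract_locally_complete:
  assumes T: "locally_complete n T" and n: "n \<ge> 2"
  shows "locally_complete (n - 1) (contract n T)"
proof -
  have n1: "n \<ge> 1" using n by simp
  have fT: "family n T" using T by (simp add: locally_complete_def)
  have tri: "\<exists>w. i < w \<and> w < j \<and> Chord i w \<in> T \<and> Chord w j \<in> T" if "Chord i j \<in> T" "i + 1 < j" for i j
    using T that by (auto simp: locally_complete_def)
  note cc = chord_contract[OF n1 fT]
  have sc: "Spoke (squeeze n i) \<in> contract n T" if "Spoke i \<in> T" for i
    using that unfolding contract_def by (auto intro!: image_eqI[of _ _ "Spoke i"])
  have fam: "family (n - 1) (contract n T)"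
    unfolding family_def
  proof (intro conjI ballI allI)
    fix x assume "x \<in> contract n T" then show "valid (n - 1) x" by (simp add: contract_def)
  next
    fix y
    have up: "shift (k * (n - 1)) y \<in> contract n T" if yC: "y \<in> contract n T" for k y
    proof -
      obtain x where x: "x \<in> T" "y = proj n x" "valid (n - 1) y" using yC by (auto simp: contract_def)
      have "shift (k * n) x \<in> T" using x family_shift[OF fT] by blast
      moreover have "shift (k * (n - 1)) y = proj n (shift (k * n) x)" using proj_shift[OF n1] x by simp
      moreover have "valid (n - 1) (shift (k * (n - 1)) y)" using x(3) by simp
      ultimately show ?thesis unfolding contract_def by blast
    qed
    show "shift (n - 1) y \<in> contract n T \<longleftrightarrow> y \<in> contract n T"
      using up[of y 1] up[of "shift (n - 1) y" "-1"] by auto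
  next
    fix x y assume "x \<in> contract n T" "y \<in> contract n T"
    then obtain a b where ab: "a \<in> T" "b \<in> T" "x = proj n a" "y = proj n b" by (auto simp: contract_def)
    then have "\<not> crosses a b" using fT by (auto simp: family_def)
    then show "\<not> crosses x y" using crosses_proj[OF n1, of a b] ab by blast
  qed
  have bdry: "Chord a (a + 1) \<in> contract n T" for a
  proof -
    obtain i where i: "squeeze n i = a" "squeeze n (i + 1) = a + 1" using squeeze_section[OF n] by blast
    then show ?thesis using cc[of i "i + 1"] T by (auto simp: locally_complete_def)
  qed
  have below: "\<exists>w. a < w \<and> w < b \<and> Chord a w \<in> contract n T \<and> Chord w b \<in> contract n T"
    if "Chord a b \<in> contract n T" "a + 1 < b" for a b
  proof -
    have *: "\<exists>w. squeeze n i < w \<and> w < squeeze n j \<and> Chord (squeeze n i) w \<in> contract n T \<and> Chord w (squeeze n j) \<in> contract n T"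
      if "Chord i j \<in> T" "squeeze n i + 1 < squeeze n j" for i j
      using that
    proof (induction "nat (j - i)" arbitrary: i j rule: less_induct)
      case less
      have "i < j" using squeeze_less[OF n1] less.prems by force
      have "i + 1 < j"
      proof (rule ccontr)
        assume "\<not> i + 1 < j"
        then have "j = i + 1" using \<open>i < j\<close> by simp
        then show False using less.prems squeeze_step[OF n1, of i] by auto
      qed
      then obtain w where w: "i < w" "w < j" "Chord i w \<in> T" "Chord w j \<in> T" using tri less.prems by blast
      have le: "squeeze n i \<le> squeeze n w" "squeeze n w \<le> squeeze n j" using w squeeze_mono[OF n1] by auto
      consider "squeeze n i < squeeze n w" "squeeze n w < squeeze n j" | "squeeze n w = squeeze n i" | "squeeze n w = squeeze n j"
        using le by linarith
      then show ?case
      proof cases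
        case 1
        then show ?thesis using cc[OF w(3)] cc[OF w(4)] by blast
      next
        case 2
        have "nat (j - w) < nat (j - i)" using w by simp
        from less.hyps[OF this w(4)] show ?thesis using 2 less.prems(2) by simp
      next
        case 3
        have "nat (w - i) < nat (j - i)" using w by simp
        from less.hyps[OF this w(3)] show ?thesis using 3 less.prems(2) by simp
      qed
    qed
    obtain x where "x \<in> T" "Chord a b = proj n x" using \<open>Chord a b \<in> contract n T\<close> by (auto simp: contract_def)
    then obtain i j where "Chord i j \<in> T" "squeeze n i = a" "squeeze n j = b" by (cases x) auto
    then show ?thesis using *[of i j] that(2) by simp
  qed
  have sp: "\<exists>i. Spoke i \<in> contract n T" using T sc unfolding locally_complete_def by blast
  have cons: "Chord u' v' \<in> contract n T"
    if uv: "Spoke u' \<in> contract n T" "Spoke v' \<in> contract n T" "u' < v'" "v' \<le> u' + (n - 1)"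
      "\<forall>w. u' < w \<longrightarrow> w < v' \<longrightarrow> Spoke w \<notin> contract n T" for u' v'
  proof -
    have pre: "\<exists>i. Spoke i \<in> T \<and> squeeze n i = a" if aC: "Spoke a \<in> contract n T" for a
    proof -
      obtain x where "x \<in> T" "Spoke a = proj n x" using aC by (auto simp: contract_def)
      then show ?thesis by (cases x) auto
    qed
    obtain u0 v0 where u0: "Spoke u0 \<in> T" "squeeze n u0 = u'" and v0: "Spoke v0 \<in> T" "squeeze n v0 = v'"
      using pre uv by metis
    \<comment> \<open>Several spokes can be merged into one. The last spoke that projects to
      \<open>u'\<close> or before it and the first that projects to \<open>v'\<close> or after it
      have no spoke between them upstairs.\<close>
    obtain u where u: "Spoke u \<in> T" "squeeze n u \<le> u'" "\<And>z. Spoke z \<in> T \<Longrightarrow> squeeze n z \<le> u' \<Longrightarrow> z \<le> u"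
    proof (rule int_greatest[of u0 "{z. Spoke z \<in> T \<and> squeeze n z \<le> u'}" v0])
      fix z assume "z \<in> {z. Spoke z \<in> T \<and> squeeze n z \<le> u'}"
      then show "z \<le> v0" using squeeze_less[OF n1, of z v0] v0 uv(3) by auto
    qed (use u0 in auto)
    obtain v where v: "Spoke v \<in> T" "v' \<le> squeeze n v" "\<And>z. Spoke z \<in> T \<Longrightarrow> v' \<le> squeeze n z \<Longrightarrow> v \<le> z"
    proof (rule int_least[of v0 "{z. Spoke z \<in> T \<and> v' \<le> squeeze n z}" u0])
      fix z assume "z \<in> {z. Spoke z \<in> T \<and> v' \<le> squeeze n z}"
      then show "u0 \<le> z" using squeeze_less[OF n1, of u0 z] u0 uv(3) by auto
    qed (use v0 in auto)
    have su: "squeeze n u = u'" using u(2) u(3)[OF u0(1)] u0 squeeze_mono[OF n1, of u0 u] by simp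
    have sv: "squeeze n v = v'" using v(2) v(3)[OF v0(1)] v0 squeeze_mono[OF n1, of v v0] by simp
    have "u < v" using squeeze_less[OF n1, of u v] su sv uv(3) by simp
    moreover have "v \<le> u + n"
    proof (rule v(3))
      show "Spoke (u + n) \<in> T" using family_shift[OF fT, of 1 "Spoke u"] u(1) by simp
      show "v' \<le> squeeze n (u + n)" using squeeze_add[OF n1, of u 1] su uv(4) by simp
    qed
    moreover have "Spoke w \<notin> T" if "u < w" "w < v" for w
    proof
      assume w: "Spoke w \<in> T"
      then have "u' < squeeze n w" "squeeze n w < v'" using u(3)[of w] v(3)[of w] that by force+
      then show False using uv(5) sc[OF w] by blast
    qed
    ultimately have "Chord u v \<in> T" using T u(1) v(1) unfolding locally_complete_def by blast
    then show ?thesis using cc[of u v] su sv uv(3) by simp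
  qed
  show ?thesis
    unfolding locally_complete_def
    by (intro conjI allI impI; (rule fam | rule bdry | (rule below; assumption) | rule sp | (rule cons; assumption)))
qed

lemma contract_triang:
  assumes "triang n T" "n \<ge> 2"
  shows "triang (n - 1) (contract n T)"
proof -
  have "locally_complete n T" using assms triang_imp_locally_complete by auto
  then show ?thesis using contract_locally_complete[of n T] locally_complete_imp_triang[of "n - 1"] assms(2) by simp
qed

lemma triang_subset_eq: "triang n T \<Longrightarrow> triang n T' \<Longrightarrow> T \<subseteq> T' \<Longrightarrow> T = T'"
  unfolding triang_def by blast

text \<open>Flips, together with equality, since a flip may become trivial under contraction.\<close>

definition near :: "int \<Rightarrow> (cover_arc set \<times> cover_arc set) set" where
  "near n = {(T, T'). triang n T \<and> triang n T' \<and> (\<exists>x y. T - T' \<subseteq> orbit n x \<and> T' - T \<subseteq> orbit n y)}"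

lemma contract_near:
  assumes "(T, T') \<in> near n" "n \<ge> 2"
  shows "(contract n T, contract n T') \<in> near (n - 1)"
proof -
  obtain x y where xy: "T - T' \<subseteq> orbit n x" "T' - T \<subseteq> orbit n y" and tt: "triang n T" "triang n T'"
    using assms by (auto simp: near_def)
  have *: "contract n A - contract n B \<subseteq> orbit (n - 1) (proj n x)" if "A - B \<subseteq> orbit n x" for A B x
  proof
    fix z assume z: "z \<in> contract n A - contract n B"
    then obtain w where w: "w \<in> A" "z = proj n w" "w \<notin> B" by (auto simp: contract_def)
    then have "w \<in> orbit n x" using that by blast
    then obtain k where "w = shift (k * n) x" by (auto simp: orbit_def)
    then show "z \<in> orbit (n - 1) (proj n x)" using w proj_shift[of n k x] assms(2) by (auto simp: orbit_def)
  qed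
  show ?thesis unfolding near_def using *[OF xy(1)] *[OF xy(2)] tt contract_triang assms(2) by blast
qed

text \<open>A flip that changes the triangle at the contracted edge becomes trivial, because the two other
  sides of that triangle are identified.\<close>

lemma contract_near_eq:
  assumes near: "(T, T') \<in> near n" and n: "n \<ge> 2"
    and s: "s \<in> T" "s' \<in> T" "proj n s = proj n s'" "s' \<notin> orbit n s" "\<not> (s \<in> T' \<and> s' \<in> T')"
  shows "contract n T = contract n T'"
proof -
  have tt: "triang n T" "triang n T'" and fT: "family n T" "family n T'"
    using near by (auto simp: near_def triang_def)
  have main: "contract n T \<subseteq> contract n T'"
    if s: "s \<in> T" "s' \<in> T" "proj n s = proj n s'" "s' \<notin> orbit n s" "s \<notin> T'" for s s'
  proof -
    obtain x where x: "T - T' \<subseteq> orbit n x" using near by (auto simp: near_def)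
    have "s \<in> orbit n x" using x s by blast
    \<comment> \<open>Only translates of \<open>s\<close> leave, so the twin \<open>s'\<close> stays
      and keeps the common projection in the image of \<open>T'\<close>.\<close>
    then have o: "T - T' \<subseteq> orbit n s" using x orbit_eq by metis
    then have s': "s' \<in> T'" using s by blast
    have "proj n z \<in> proj n ` T'" if z: "z \<in> T" for z
    proof (cases "z \<in> T'")
      case False
      then obtain k where "z = shift (k * n) s" using o z by (auto simp: orbit_def)
      then have "proj n z = proj n (shift (k * n) s')" using proj_shift[of n k] n s(3) by simp
      moreover have "shift (k * n) s' \<in> T'" using family_shift[OF fT(2)] s' by blast
      ultimately show ?thesis by blast
    qed blast
    then show ?thesis by (auto simp: contract_def)
  qed
  have "s \<notin> orbit n s'" using s(4) orbit_eq orbit_refl by metis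
  then have "contract n T \<subseteq> contract n T'"
    using main[of s s'] main[of s' s] s by (metis)
  then show ?thesis
    by (rule triang_subset_eq[OF contract_triang[OF tt(1) n] contract_triang[OF tt(2) n]])
qed

lemma near_sym: "(T, T') \<in> near n \<Longrightarrow> (T', T) \<in> near n"
  by (auto simp: near_def)

section \<open>The two fans and their contractions\<close>

definition fan :: "int \<Rightarrow> cover_arc set" where
  "fan n = {Spoke i | i. n dvd i + 1} \<union> {Chord i j | i j. i < j \<and> j \<le> i + n \<and> (n dvd i + 1 \<or> j = i + 1)}"

text \<open>Mirror image of \<open>fan\<close>: there all chords other than boundary edges start at
  lifts of the point of index -1, here they end at lifts of the point of index 0. The longest
  chords, of length \<open>n\<close>, are loops around the puncture.\<close>

definition fan' :: "int \<Rightarrow> cover_arc set" where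
  "fan' n = {Spoke i | i. n dvd i} \<union> {Chord i j | i j. i < j \<and> j \<le> i + n \<and> (n dvd j \<or> j = i + 1)}"

lemma dvd_gap:
  fixes n a b :: int
  assumes "n dvd a" "n dvd b" "a < b"
  shows "a + n \<le> b"
proof -
  have "n dvd b - a" using assms by (rule_tac dvd_diff)
  then have "n \<le> b - a" by (rule zdvd_imp_le) (use assms in linarith)
  then show ?thesis by linarith
qed

lemma triang_fan: assumes n: "n \<ge> 1" shows "triang n (fan n)"
proof (rule locally_complete_imp_triang[OF _ n])
  have per: "n dvd i + n + 1 \<longleftrightarrow> n dvd i + 1" for i
    using dvd_add_left_iff[of n n "i + 1"] by (simp add: add.commute add.left_commute)
  have cc: False if "Chord i j \<in> fan n" "Chord c d \<in> fan n" "i < c" "c < j" "j < d" for i j c d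
  proof -
    have "n dvd i + 1" "n dvd c + 1" "j \<le> i + n" using that by (auto simp: fan_def)
    then show False using dvd_gap[of n "i + 1" "c + 1"] that by simp
  qed
  have cs: False if "Chord i j \<in> fan n" "Spoke c \<in> fan n" "i < c" "c < j" for i j c
  proof -
    have "n dvd i + 1" "n dvd c + 1" "j \<le> i + n" using that by (auto simp: fan_def)
    then show False using dvd_gap[of n "i + 1" "c + 1"] that by simp
  qed
  have "family n (fan n)"
    unfolding family_def
  proof (intro conjI ballI allI)
    fix x assume "x \<in> fan n" then show "valid n x" by (auto simp: fan_def)
  next
    fix x show "shift n x \<in> fan n \<longleftrightarrow> x \<in> fan n" by (cases x) (auto simp: fan_def per)
  next
    fix x y assume "x \<in> fan n" "y \<in> fan n"
    then show "\<not> crosses x y" using cc cs by (cases x; cases y) auto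
  qed
  moreover have "\<exists>w. i < w \<and> w < j \<and> Chord i w \<in> fan n \<and> Chord w j \<in> fan n"
    if "Chord i j \<in> fan n" "i + 1 < j" for i j
    using that n by (intro exI[of _ "j - 1"]) (auto simp: fan_def)
  moreover have "Spoke (-1) \<in> fan n" by (auto simp: fan_def)
  moreover have "Chord i (i + 1) \<in> fan n" for i using n by (auto simp: fan_def)
  moreover have "Chord u v \<in> fan n" if "Spoke u \<in> fan n" "u < v" "v \<le> u + n" for u v
    using that by (auto simp: fan_def)
  ultimately show "locally_complete n (fan n)" unfolding locally_complete_def by blast
qed

lemma triang_fan': assumes n: "n \<ge> 1" shows "triang n (fan' n)"
proof (rule locally_complete_imp_triang[OF _ n])
  have cc: False if "Chord i j \<in> fan' n" "Chord c d \<in> fan' n" "i < c" "c < j" "j < d" for i j c d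
  proof -
    have "n dvd j" "n dvd d" "d \<le> c + n" using that by (auto simp: fan'_def)
    then show False using dvd_gap[of n j d] that by simp
  qed
  have cs: False if "Chord i j \<in> fan' n" "Spoke c \<in> fan' n" "i < c" "c < j" for i j c
  proof -
    have "n dvd j" "n dvd c" "j \<le> i + n" using that by (auto simp: fan'_def)
    then show False using dvd_gap[of n c j] that by simp
  qed
  have "family n (fan' n)"
    unfolding family_def
  proof (intro conjI ballI allI)
    fix x assume "x \<in> fan' n" then show "valid n x" by (auto simp: fan'_def)
  next
    fix x show "shift n x \<in> fan' n \<longleftrightarrow> x \<in> fan' n" by (cases x) (auto simp: fan'_def)
  next
    fix x y assume "x \<in> fan' n" "y \<in> fan' n"
    then show "\<not> crosses x y" using cc cs by (cases x; cases y) auto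
  qed
  moreover have "\<exists>w. i < w \<and> w < j \<and> Chord i w \<in> fan' n \<and> Chord w j \<in> fan' n"
    if "Chord i j \<in> fan' n" "i + 1 < j" for i j
    using that n by (intro exI[of _ "i + 1"]) (auto simp: fan'_def)
  moreover have "Spoke 0 \<in> fan' n" by (auto simp: fan'_def)
  moreover have "Chord i (i + 1) \<in> fan' n" for i using n by (auto simp: fan'_def)
  moreover have "Chord u v \<in> fan' n" if "Spoke v \<in> fan' n" "u < v" "v \<le> u + n" for u v
    using that by (auto simp: fan'_def)
  ultimately show "locally_complete n (fan' n)" unfolding locally_complete_def by blast
qed

lemma squeeze_values:
  assumes "n \<ge> 3"
  shows "squeeze n (-1) = -1" "squeeze n 0 = 0" "squeeze n 1 = 1" "squeeze n 2 = 1"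
proof -
  have "(-3) div n = -1" using int_div_pos_eq[of "-3" n "-1" "n - 3"] assms by simp
  moreover have "(-2) div n = -1" using int_div_pos_eq[of "-2" n "-1" "n - 2"] assms by simp
  moreover have "(-1) div n = -1" using int_div_pos_eq[of "-1" n "-1" "n - 1"] assms by simp
  ultimately show "squeeze n (-1) = -1" "squeeze n 0 = 0" "squeeze n 1 = 1" "squeeze n 2 = 1"
    using assms by (auto simp: squeeze_def)
qed

text \<open>Both sides are triangulations for \<open>n - 1\<close>, so it is enough to find every
  arc of the smaller fan in the contraction.\<close>

lemma contract_fan:
  assumes n: "n \<ge> 3"
  shows "contract n (fan n) = fan (n - 1)"
proof -
  have n1: "n \<ge> 1" "n \<ge> 2" "n - 1 \<ge> 1" using n by auto
  have t: "triang n (fan n)" "triang (n - 1) (fan (n - 1))" using triang_fan n1 by auto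
  then have t': "triang (n - 1) (contract n (fan n))" using contract_triang n1 by blast
  have fT: "family n (fan n)" using t by (simp add: triang_def)
  have at: "squeeze n (-1 + k * n) = -1 + k * (n - 1)" for k
    using squeeze_add[OF n1(1), of "-1" k] squeeze_values[OF n] by simp
  have "x \<in> contract n (fan n)" if x: "x \<in> fan (n - 1)" for x
  proof (cases x)
    case (Spoke i)
    then obtain k where "i + 1 = (n - 1) * k" using x by (auto simp: fan_def)
    then have i: "i = squeeze n (-1 + k * n)" using at[of k] by (simp add: mult.commute)
    have "Spoke (-1 + k * n) \<in> fan n" by (auto simp: fan_def)
    then show ?thesis unfolding contract_def using Spoke i by force
  next
    case (Chord i j)
    have ij: "i < j" "j \<le> i + (n - 1)" "n - 1 dvd i + 1 \<or> j = i + 1" using x Chord by (auto simp: fan_def)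
    show ?thesis
    proof (cases "j = i + 1")
      case True
      then show ?thesis using triang_imp_locally_complete[OF t' n1(3)] Chord by (auto simp: locally_complete_def)
    next
      case False
      then obtain k where "i + 1 = (n - 1) * k" using ij by auto
      then have i: "i = squeeze n (-1 + k * n)" using at[of k] by (simp add: mult.commute)
      have i': "i + (n - 1) = squeeze n (-1 + k * n + n)"
        using squeeze_add[OF n1(1), of "-1 + k * n" 1] i by simp
      \<comment> \<open>Monotonicity bounds \<open>m\<close> only when the chord is shorter than a
        full period; for the loop the next lift of the base point is taken.\<close>
      obtain m where m: "squeeze n m = j" "m \<le> -1 + k * n + n"
      proof (cases "j = i + (n - 1)")
        case True then show ?thesis using that i' by simp
      next
        case False
        obtain m where "squeeze n m = j" using squeeze_section[OF n1(2)] by blast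
        then show ?thesis using that[of m] squeeze_less[OF n1(1), of m "-1 + k * n + n"] i' False ij by simp
      qed
      have "-1 + k * n < m" using squeeze_less[OF n1(1), of "-1 + k * n" m] i m ij by simp
      then have "Chord (-1 + k * n) m \<in> fan n" using m by (auto simp: fan_def)
      then show ?thesis using chord_contract[OF n1(1) fT, of "-1 + k * n" m] i m ij Chord by simp
    qed
  qed
  then have "fan (n - 1) \<subseteq> contract n (fan n)" by blast
  then show ?thesis using triang_subset_eq[OF t(2) t'] by simp
qed

lemma contract_fan':
  assumes n: "n \<ge> 3"
  shows "contract n (fan' n) = fan' (n - 1)"
proof -
  have n1: "n \<ge> 1" "n \<ge> 2" "n - 1 \<ge> 1" using n by auto
  have t: "triang n (fan' n)" "triang (n - 1) (fan' (n - 1))" using triang_fan' n1 by auto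
  then have t': "triang (n - 1) (contract n (fan' n))" using contract_triang n1 by blast
  have fT: "family n (fan' n)" using t by (simp add: triang_def)
  have at: "squeeze n (k * n) = k * (n - 1)" for k
    using squeeze_add[OF n1(1), of 0 k] squeeze_values[OF n] by simp
  have "x \<in> contract n (fan' n)" if x: "x \<in> fan' (n - 1)" for x
  proof (cases x)
    case (Spoke i)
    then obtain k where "i = (n - 1) * k" using x by (auto simp: fan'_def)
    then have i: "i = squeeze n (k * n)" using at[of k] by (simp add: mult.commute)
    have "Spoke (k * n) \<in> fan' n" by (auto simp: fan'_def)
    then show ?thesis unfolding contract_def using Spoke i by force
  next
    case (Chord i j)
    have ij: "i < j" "j \<le> i + (n - 1)" "n - 1 dvd j \<or> j = i + 1" using x Chord by (auto simp: fan'_def)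
    show ?thesis
    proof (cases "j = i + 1")
      case True
      then show ?thesis using triang_imp_locally_complete[OF t' n1(3)] Chord by (auto simp: locally_complete_def)
    next
      case False
      then obtain k where "j = (n - 1) * k" using ij by auto
      then have j: "j = squeeze n (k * n)" using at[of k] by (simp add: mult.commute)
      have j': "j - (n - 1) = squeeze n (k * n - n)"
        using squeeze_add[OF n1(1), of "k * n" "-1"] j by simp
      obtain m where m: "squeeze n m = i" "k * n - n \<le> m"
      proof (cases "i = j - (n - 1)")
        case True then show ?thesis using that j' by simp
      next
        case False
        obtain m where "squeeze n m = i" using squeeze_section[OF n1(2)] by blast
        then show ?thesis using that[of m] squeeze_less[OF n1(1), of "k * n - n" m] j' False ij by simp
      qed
      have "m < k * n" using squeeze_less[OF n1(1), of m "k * n"] j m ij by simp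
      then have "Chord m (k * n) \<in> fan' n" using m by (auto simp: fan'_def)
      then show ?thesis using chord_contract[OF n1(1) fT, of m "k * n"] j m ij Chord by simp
    qed
  qed
  then have "fan' (n - 1) \<subseteq> contract n (fan' n)" by blast
  then show ?thesis using triang_subset_eq[OF t(2) t'] by simp
qed

lemma relpow_segment:
  assumes "\<And>m. a \<le> m \<Longrightarrow> m < b \<Longrightarrow> (f m, f (Suc m)) \<in> E" "a \<le> b"
  shows "(f a, f b) \<in> E ^^ (b - a)"
  unfolding relpow_fun_conv
  by (rule exI[of _ "\<lambda>i. f (a + i)"]) (use assms in auto)

lemma change_step:
  assumes "P (0::nat)" "\<not> P k"
  obtains i where "i < k" "P i" "\<not> P (Suc i)"
proof -
  have "\<exists>i<k. P i \<and> \<not> P (Suc i)"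
    using assms by (induction k) (auto intro: less_SucI)
  then show thesis using that by blast
qed

lemma chord_orbit_length: "Chord a b \<in> orbit n (Chord c d) \<Longrightarrow> b - a = d - c"
  by (auto simp: orbit_def)

lemma fan_distance_step:
  assumes n: "n \<ge> 3" and path: "(fan n, fan' n) \<in> near n ^^ k"
  shows "\<exists>l. l + 2 = k \<and> (fan (n - 1), fan' (n - 1)) \<in> near (n - 1) ^^ l"
proof -
  have n2: "n \<ge> 2" using n by simp
  obtain f where f: "f 0 = fan n" "f k = fan' n" "\<And>i. i < k \<Longrightarrow> (f i, f (Suc i)) \<in> near n"
    using path unfolding relpow_fun_conv by auto
  \<comment> \<open>The edge from 1 to 2 carries a triangle with apex -1 in the first fan and one
    with apex \<open>n\<close>, a lift of the point 0, in the second. Contracting the edge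
    identifies the two other sides of either triangle.\<close>
  define left where "left = (\<lambda>T. Chord (-1) 1 \<in> T \<and> Chord (-1) 2 \<in> T)"
  define right where "right = (\<lambda>T. Chord 1 n \<in> T \<and> Chord 2 n \<in> T)"
  have "left (f 0)" "\<not> left (f k)" "\<not> right (f 0)" "right (f k)"
    using n zdvd_not_zless[of 2 n] zdvd_not_zless[of 3 n]
    unfolding f left_def right_def by (auto simp: fan_def fan'_def)
  obtain i where i: "i < k" "left (f i)" "\<not> left (f (Suc i))"
    using change_step[of "\<lambda>i. left (f i)" k] \<open>left (f 0)\<close> \<open>\<not> left (f k)\<close> by blast
  obtain j where j: "j < k" "\<not> right (f j)" "right (f (Suc j))"
    using change_step[of "\<lambda>i. \<not> right (f i)" k] \<open>\<not> right (f 0)\<close> \<open>right (f k)\<close> by blast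
  \<comment> \<open>One flip cannot do both. A translate of the side from 1 to \<open>n\<close>
    crosses both sides at the apex -1, so these would have to leave together; but they have
    different lengths, and only one orbit leaves.\<close>
  have "i \<noteq> j"
  proof
    assume ij: "i = j"
    have near: "(f i, f (Suc i)) \<in> near n" using f i by blast
    then have fam: "family n (f (Suc i))" by (simp add: near_def triang_def)
    obtain x where x: "f i - f (Suc i) \<subseteq> orbit n x" using near by (auto simp: near_def)
    have r: "Chord 1 n \<in> f (Suc i)" using j(3) ij by (simp add: right_def)
    then have "Chord (1 - n) 0 \<in> f (Suc i)" using family_shift[OF fam, of "-1" "Chord 1 n"] by simp
    then have "Chord (-1) 1 \<notin> f (Suc i)" "Chord (-1) 2 \<notin> f (Suc i)"
      using r fam n unfolding family_def by fastforce+
    then have "Chord (-1) 1 \<in> orbit n x" "Chord (-1) 2 \<in> orbit n x" using i(2) x by (auto simp: left_def)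
    then have "Chord (-1) 1 \<in> orbit n (Chord (-1) 2)" by (metis orbit_eq orbit_refl)
    then show False using chord_orbit_length by force
  qed
  define g where "g = contract n \<circ> f"
  have g: "(g m, g (Suc m)) \<in> near (n - 1)" if "m < k" for m
    using contract_near[OF f(3)[OF that] n2] by (simp add: g_def)
  have gi: "g i = g (Suc i)"
    unfolding g_def comp_def
  proof (rule contract_near_eq[OF f(3)[OF i(1)] n2])
    show "Chord (-1) 1 \<in> f i" "Chord (-1) 2 \<in> f i" using i by (auto simp: left_def)
    show "proj n (Chord (-1) 1) = proj n (Chord (-1) 2)" using squeeze_values[OF n] by simp
    show "Chord (-1) 2 \<notin> orbit n (Chord (-1) 1)" using chord_orbit_length by force
    show "\<not> (Chord (-1) 1 \<in> f (Suc i) \<and> Chord (-1) 2 \<in> f (Suc i))" using i by (auto simp: left_def)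
  qed
  \<comment> \<open>Acquiring the second triangle is losing it along the reversed flip.\<close>
  have "contract n (f (Suc j)) = contract n (f j)"
  proof (rule contract_near_eq[OF near_sym[OF f(3)[OF j(1)]] n2])
    show "Chord 1 n \<in> f (Suc j)" "Chord 2 n \<in> f (Suc j)" using j by (auto simp: right_def)
    show "proj n (Chord 1 n) = proj n (Chord 2 n)" using squeeze_values[OF n] by simp
    show "Chord 2 n \<notin> orbit n (Chord 1 n)" using chord_orbit_length by force
    show "\<not> (Chord 1 n \<in> f j \<and> Chord 2 n \<in> f j)" using j by (auto simp: right_def)
  qed
  then have gj: "g j = g (Suc j)" by (simp add: g_def)
  have skip: "\<exists>l. l + 2 = k \<and> (g 0, g k) \<in> near (n - 1) ^^ l"
    if "a < b" "b < k" "g a = g (Suc a)" "g b = g (Suc b)" for a b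
  proof -
    have "(g 0, g a) \<in> near (n - 1) ^^ a" using relpow_segment[of 0 a g] g that by simp
    moreover have "(g a, g b) \<in> near (n - 1) ^^ (b - Suc a)" using relpow_segment[of "Suc a" b g] g that by simp
    moreover have "(g b, g k) \<in> near (n - 1) ^^ (k - Suc b)" using relpow_segment[of "Suc b" k g] g that by simp
    ultimately have "(g 0, g k) \<in> near (n - 1) ^^ (a + (b - Suc a) + (k - Suc b))"
      unfolding relpow_add by blast
    then show ?thesis using that by (intro exI conjI) auto
  qed
  have "g 0 = fan (n - 1)" "g k = fan' (n - 1)"
    using contract_fan[OF n] contract_fan'[OF n] f by (auto simp: g_def)
  moreover have "\<exists>l. l + 2 = k \<and> (g 0, g k) \<in> near (n - 1) ^^ l"
  proof (cases "i < j")
    case True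
    then show ?thesis by (rule skip[OF _ j(1) gi gj])
  next
    case False
    then have "j < i" using \<open>i \<noteq> j\<close> by simp
    then show ?thesis by (rule skip[OF _ i(1) gj gi])
  qed
  ultimately show ?thesis by simp
qed

text \<open>The contraction step starts from \<open>n = 3\<close>. For \<open>n = 2\<close> the
  spoke at -1 and the chord from -1 to 1 both have to leave, and their orbits differ.\<close>

lemma fan_distance_ge:
  assumes "N \<ge> 1" "(fan (int N), fan' (int N)) \<in> near (int N) ^^ k"
  shows "2 * N - 2 \<le> k"
  using assms
proof (induction N arbitrary: k rule: less_induct)
  case (less N)
  consider "N = 1" | "N = 2" | "N \<ge> 3" using less.prems by linarith
  then show ?case
  proof cases
    case 2
    have S: "Spoke (-1) \<in> fan 2 - fan' 2" and C: "Chord (-1) 1 \<in> fan 2 - fan' 2" by (auto simp: fan_def fan'_def)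
    have "k \<noteq> 0" using less.prems(2) 2 S by (cases k) auto
    moreover have "k \<noteq> 1"
    proof
      assume "k = 1"
      then have "(fan 2, fan' 2) \<in> near 2" using less.prems(2) 2 by simp
      then obtain x where "fan 2 - fan' 2 \<subseteq> orbit 2 x" by (auto simp: near_def)
      then have "Chord (-1) 1 \<in> orbit 2 (Spoke (-1))" using S C by (metis orbit_eq orbit_refl subsetD)
      then show False by (auto simp: orbit_def)
    qed
    ultimately show ?thesis using 2 by simp
  next
    case 3
    then obtain l where l: "l + 2 = k" "(fan (int N - 1), fan' (int N - 1)) \<in> near (int N - 1) ^^ l"
      using fan_distance_step[of "int N" k] less.prems by auto
    have "int N - 1 = int (N - 1)" using 3 by simp
    then have "(fan (int (N - 1)), fan' (int (N - 1))) \<in> near (int (N - 1)) ^^ l" using l(2) by metis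
    moreover have "N - 1 < N" "1 \<le> N - 1" using 3 by linarith+
    ultimately have "2 * (N - 1) - 2 \<le> l" using less.IH by blast
    then show ?thesis using l(1) by linarith
  qed simp
qed

section \<open>Lifting arcs to the upper half-plane\<close>

definition cov :: "complex \<Rightarrow> complex" where
  "cov w = exp (\<i> * w)"

lemma norm_cov: "norm (cov w) = exp (- Im w)"
  by (simp add: cov_def norm_exp_eq_Re)

lemma cov_nonzero [simp]: "cov w \<noteq> 0" by (simp add: cov_def)

lemma cov_eq: "cov w = cov w' \<longleftrightarrow> (\<exists>k::int. w' = w + of_real (2 * pi * k))"
proof
  assume "cov w = cov w'"
  then obtain k :: int where k: "\<i> * w = \<i> * w' + (of_int (2 * k) * pi) * \<i>"
    unfolding cov_def exp_eq by auto
  then have "\<i> * w' = \<i> * (w + of_real (2 * pi * (of_int (- k))))" by (simp add: algebra_simps)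
  then show "\<exists>k::int. w' = w + of_real (2 * pi * k)" by (metis complex_i_not_zero mult_cancel_left)
next
  assume "\<exists>k::int. w' = w + of_real (2 * pi * k)"
  then obtain k :: int where "w' = w + of_real (2 * pi * k)" by blast
  then have "\<i> * w' = \<i> * w + (of_int (2 * k) * pi) * \<i>" by (simp add: algebra_simps)
  then show "cov w = cov w'" unfolding cov_def exp_eq[of "\<i> * w" "\<i> * w'"]
    by (intro exI[of _ "- k"]) (simp add: algebra_simps)
qed

lemma cov_shift [simp]: "cov (w + of_real (2 * pi * of_int k)) = cov w"
  using cov_eq by metis

lemma continuous_on_cov [continuous_intros]: "continuous_on S f \<Longrightarrow> continuous_on S (\<lambda>x. cov (f x))"
  unfolding cov_def by (intro continuous_intros)

text \<open>Turns the displacement of a lift into a homotopy invariant of its image in the punctured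
  plane.\<close>

lemma winding_number_cov:
  assumes "path h"
  shows "winding_number (\<lambda>s. cov (h s)) 0 = (h 1 - h 0) / (2 * pi)"
proof -
  have "path (\<lambda>s. \<i> * h s)" using assms unfolding path_def by (intro continuous_intros)
  from winding_number_compose_exp[OF this]
  have "winding_number (\<lambda>s. cov (h s)) 0 = (\<i> * h 1 - \<i> * h 0) / (2 * of_real pi * \<i>)"
    by (simp add: o_def cov_def pathstart_def pathfinish_def)
  also have "\<dots> = (h 1 - h 0) / (2 * pi)" by (simp add: field_simps)
  finally show ?thesis .
qed

lemma path_lift:
  assumes g: "path g" "0 \<notin> path_image g" and A: "cov A = g 0"
  obtains h where "path h" "h 0 = A" "\<And>t. t \<in> {0..1} \<Longrightarrow> g t = cov (h t)"
proof -
  obtain q where q: "path q" "\<And>t. t \<in> {0..1} \<Longrightarrow> g t = 0 + exp (q t)"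
    using winding_number_as_continuous_log[OF g] by metis
  \<comment> \<open>The continuous logarithm of the path is turned by a quarter and moved so that
    the lift starts at the prescribed point \<open>A\<close>.\<close>
  define h where "h = (\<lambda>t. A - \<i> * (q t - q 0))"
  show thesis
  proof
    show "path h" using q(1) unfolding h_def path_def by (intro continuous_intros)
    show "h 0 = A" by (simp add: h_def)
    fix t :: real assume t: "t \<in> {0..1}"
    have "cov (h t) = exp (q t) * (exp (\<i> * A) / exp (q 0))"
      by (simp add: cov_def h_def exp_diff exp_add algebra_simps)
    also have "exp (\<i> * A) / exp (q 0) = 1" using q(2)[of 0] A by (simp add: cov_def)
    finally show "g t = cov (h t)" using q(2)[OF t] by simp
  qed
qed

section \<open>Isotopy of arcs as an equivalence relation\<close>

text \<open>A path is a function on the whole real line of which only the values on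
  \<open>{0..1}\<close> matter; the isotopies constructed later agree with the given arcs only
  there.\<close>

lemma marked_arc_cong:
  assumes eq: "\<And>s. s \<in> {0..1} \<Longrightarrow> f s = g s" and f: "marked_arc P f"
  shows "marked_arc P g"
proof -
  have ends: "pathstart g = pathstart f" "pathfinish g = pathfinish f"
    using eq by (auto simp: pathstart_def pathfinish_def)
  have im: "path_image g = path_image f" using eq by (auto simp: path_image_def)
  have sf: "simple_path f" using f by (simp add: marked_arc_def)
  have "simple_path g"
    using sf eq unfolding simple_path_def loop_free_def path_def
    by (metis continuous_on_cong)
  moreover have "g ` {0<..<1} = f ` {0<..<1}" using eq by (intro image_cong) auto
  moreover have "\<not> homotopic_paths (cball 0 1 - (marked_points P - {pathstart g})) g (linepath (pathstart g) (pathstart g))"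
  proof
    let ?S = "cball 0 1 - (marked_points P - {pathstart g})"
    assume h: "homotopic_paths ?S g (linepath (pathstart g) (pathstart g))"
    then have "path_image f \<subseteq> ?S" using homotopic_paths_imp_subset[OF h] im by simp
    then have "homotopic_paths ?S f g"
      using sf eq by (intro homotopic_paths_eq) (auto simp: simple_path_def)
    then have "homotopic_paths ?S f (linepath (pathstart g) (pathstart g))" using h homotopic_paths_trans by blast
    then show False using f ends by (simp add: marked_arc_def)
  qed
  ultimately show ?thesis using f ends im by (simp add: marked_arc_def)
qed

lemma isotopic_arcsI:
  fixes H :: "real \<Rightarrow> real \<Rightarrow> complex"
  assumes cont: "continuous_on ({0..1} \<times> {0..1}) (\<lambda>x. H (fst x) (snd x))"
    and marked: "\<And>t. t \<in> {0..1} \<Longrightarrow> marked_arc P (H t)"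
    and ends: "\<And>t. t \<in> {0..1} \<Longrightarrow> H t 0 = a" "\<And>t. t \<in> {0..1} \<Longrightarrow> H t 1 = b"
    and fg: "\<And>s. s \<in> {0..1} \<Longrightarrow> f s = H 0 s" "\<And>s. s \<in> {0..1} \<Longrightarrow> g s = H 1 s"
  shows "isotopic_arcs P f g"
proof -
  let ?Q = "\<lambda>r. marked_arc P r \<and> pathstart r = pathstart f \<and> pathfinish r = pathfinish f"
  have fe: "f 0 = a" "f 1 = b" using ends[of 0] fg by auto
  have "H t s \<in> cball 0 1" if "t \<in> {0..1}" "s \<in> {0..1}" for t s
    using marked[OF that(1)] that(2) unfolding marked_arc_def path_image_def by blast
  then have "homotopic_with_canon ?Q {0..1} (cball 0 1) (H 0) (H 1)"
    unfolding homotopic_with_def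
    using cont marked ends
    by (intro exI[of _ "\<lambda>x. H (fst x) (snd x)"])
       (auto simp: fe pathstart_def pathfinish_def subtopology_Times[symmetric] euclidean_product_topology[symmetric])
  then show ?thesis
    unfolding isotopic_arcs_def
  proof (rule homotopic_with_eq)
    fix h k :: "real \<Rightarrow> complex"
    assume hk: "\<And>x. x \<in> topspace (top_of_set {0..1}) \<Longrightarrow> h x = k x"
    then have "pathstart h = pathstart k" "pathfinish h = pathfinish k" by (auto simp: pathstart_def pathfinish_def)
    moreover have "marked_arc P h \<longleftrightarrow> marked_arc P k"
      using marked_arc_cong[of h k P] marked_arc_cong[of k h P] hk by auto
    ultimately show "?Q h \<longleftrightarrow> ?Q k" by auto
  qed (use fg in auto)
qed

lemma isotopic_arcsD:
  assumes "isotopic_arcs P f g"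
  obtains H :: "real \<Rightarrow> real \<Rightarrow> complex" where "continuous_on ({0..1} \<times> {0..1}) (\<lambda>x. H (fst x) (snd x))"
    "\<And>t. t \<in> {0..1} \<Longrightarrow> marked_arc P (H t)"
    "\<And>t. t \<in> {0..1} \<Longrightarrow> H t 0 = f 0" "\<And>t. t \<in> {0..1} \<Longrightarrow> H t 1 = f 1" "H 0 = f" "H 1 = g"
proof -
  obtain k where k: "continuous_map (prod_topology (top_of_set {0..1::real}) (top_of_set {0..1::real})) (top_of_set (cball 0 1)) k"
    "\<forall>x. k (0, x) = f x" "\<forall>x. k (1, x) = g x"
    "\<forall>t\<in>{0..1}. marked_arc P (\<lambda>x. k (t, x)) \<and> pathstart (\<lambda>x. k (t, x)) = pathstart f \<and> pathfinish (\<lambda>x. k (t, x)) = pathfinish f"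
    using assms unfolding isotopic_arcs_def homotopic_with_def by blast
  show thesis
  proof (rule that[of "\<lambda>t s. k (t, s)"])
    show "continuous_on ({0..1} \<times> {0..1}) (\<lambda>x. k (fst x, snd x))"
      using k(1) by (auto simp: subtopology_Times[symmetric] euclidean_product_topology[symmetric])
  qed (use k in \<open>auto simp: pathstart_def pathfinish_def\<close>)
qed

lemma isotopic_arcs_refl: "marked_arc P g \<Longrightarrow> isotopic_arcs P g g"
proof (rule isotopic_arcsI[of "\<lambda>t. g"])
  assume g: "marked_arc P g"
  then have "continuous_on {0..1} g" by (simp add: marked_arc_def simple_path_def path_def)
  then show "continuous_on ({0..1} \<times> {0..1}) (\<lambda>x. g (snd x))"
    by (rule continuous_on_compose2) (auto intro!: continuous_intros)
qed auto

lemma isotopic_arcs_ends: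
  assumes "isotopic_arcs P f g"
  shows "marked_arc P f" "marked_arc P g" "pathstart g = pathstart f" "pathfinish g = pathfinish f"
  using homotopic_with_imp_property[OF assms[unfolded isotopic_arcs_def]] by simp_all

lemma isotopic_arcs_sym:
  assumes "isotopic_arcs P f g"
  shows "isotopic_arcs P g f"
  using assms unfolding isotopic_arcs_def isotopic_arcs_ends(3,4)[OF assms] by (rule homotopic_with_symD)

lemma isotopic_arcs_trans:
  assumes "isotopic_arcs P f g" "isotopic_arcs P g h"
  shows "isotopic_arcs P f h"
  using assms unfolding isotopic_arcs_def isotopic_arcs_ends(3,4)[OF assms(1)] by (rule homotopic_with_trans)

text \<open>Non-contractibility is stated at the starting point. If the reversed path were
  contractible, the two ends would agree, and reversing the homotopy would contract the original
  arc.\<close>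

lemma marked_arc_reversepath:
  assumes "marked_arc P g"
  shows "marked_arc P (reversepath g)"
proof -
  have "reversepath g ` {0<..<1} = g ` {0<..<1}"
  proof (intro equalityI subsetI)
    fix y assume "y \<in> reversepath g ` {0<..<1}"
    then obtain x where "x \<in> {0<..<1}" "y = g (1 - x)" by (auto simp: reversepath_def)
    then show "y \<in> g ` {0<..<1}" by (intro image_eqI[of _ _ "1 - x"]) auto
  next
    fix y assume "y \<in> g ` {0<..<1}"
    then obtain x where "x \<in> {0<..<1}" "y = g x" by blast
    then show "y \<in> reversepath g ` {0<..<1}" by (intro image_eqI[of _ _ "1 - x"]) (auto simp: reversepath_def)
  qed
  moreover have "\<not> homotopic_paths (cball 0 1 - (marked_points P - {pathfinish g})) (reversepath g) (linepath (pathfinish g) (pathfinish g))"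
  proof
    assume h: "homotopic_paths (cball 0 1 - (marked_points P - {pathfinish g})) (reversepath g) (linepath (pathfinish g) (pathfinish g))"
    then have e: "pathstart g = pathfinish g" using homotopic_paths_imp_pathfinish by fastforce
    have "homotopic_paths (cball 0 1 - (marked_points P - {pathstart g})) g (linepath (pathstart g) (pathstart g))"
      using h homotopic_paths_reversepath[of _ "reversepath g" "linepath (pathfinish g) (pathfinish g)"] e by simp
    then show False using assms by (simp add: marked_arc_def)
  qed
  ultimately show ?thesis using assms by (simp add: marked_arc_def simple_path_reversepath)
qed

lemma isotopic_arcs_reversepath:
  assumes "isotopic_arcs P f g"
  shows "isotopic_arcs P (reversepath f) (reversepath g)"
proof -
  from assms show ?thesis
  proof (rule isotopic_arcsD)
    fix H :: "real \<Rightarrow> real \<Rightarrow> complex"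
    assume H: "continuous_on ({0..1} \<times> {0..1}) (\<lambda>x. H (fst x) (snd x))"
      "\<And>t. t \<in> {0..1} \<Longrightarrow> marked_arc P (H t)"
      "\<And>t. t \<in> {0..1} \<Longrightarrow> H t 0 = f 0" "\<And>t. t \<in> {0..1} \<Longrightarrow> H t 1 = f 1" "H 0 = f" "H 1 = g"
    show ?thesis
  proof (rule isotopic_arcsI[of "\<lambda>t. reversepath (H t)"])
    have "continuous_on ({0..1} \<times> {0..1}) (\<lambda>x. (\<lambda>y. H (fst y) (snd y)) (fst x, 1 - snd x))"
      by (rule continuous_on_compose2[OF H(1)]) (intro continuous_intros, auto)
    then show "continuous_on ({0..1} \<times> {0..1}) (\<lambda>x. reversepath (H (fst x)) (snd x))"
      by (simp add: reversepath_def)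
    show "reversepath (H t) 0 = f 1" "reversepath (H t) 1 = f 0" if "t \<in> {0..1}" for t
      using H that by (auto simp: reversepath_def)
  qed (use H marked_arc_reversepath in \<open>auto simp: reversepath_def\<close>)
  qed
qed

lemma equiv_isotopy_rel: "equiv (Collect (marked_arc P)) (isotopy_rel P)"
proof (rule equivI)
  show "isotopy_rel P \<subseteq> Collect (marked_arc P) \<times> Collect (marked_arc P)" by (auto simp: isotopy_rel_def)
  show "refl_on (Collect (marked_arc P)) (isotopy_rel P)"
    by (auto simp: refl_on_def isotopy_rel_def intro: isotopic_arcs_refl)
  have "isotopic_arcs P g f \<or> isotopic_arcs P g (reversepath f)"
    if "isotopic_arcs P f g \<or> isotopic_arcs P f (reversepath g)" for f g
    using that isotopic_arcs_sym isotopic_arcs_reversepath reversepath_reversepath by metis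
  then show "sym (isotopy_rel P)" unfolding sym_def isotopy_rel_def by blast
  have "isotopic_arcs P f h \<or> isotopic_arcs P f (reversepath h)"
    if "isotopic_arcs P f g \<or> isotopic_arcs P f (reversepath g)"
       "isotopic_arcs P g h \<or> isotopic_arcs P g (reversepath h)" for f g h
    using that isotopic_arcs_trans isotopic_arcs_reversepath reversepath_reversepath by metis
  then show "trans (isotopy_rel P)" unfolding trans_def isotopy_rel_def by blast
qed

section \<open>Paths in the closed upper half-plane\<close>

definition upper :: "complex set" where
  "upper = {z. 0 \<le> Im z}"

lemma upper_pathD: "path_image h \<subseteq> upper \<Longrightarrow> s \<in> {0..1} \<Longrightarrow> 0 \<le> Im (h s)"
  unfolding path_image_def upper_def by blast

text \<open>The Fashoda theorem for two paths in a box whose four end points alternate along its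
  bottom side, here on the real axis; complex numbers are first rewritten as vectors.\<close>

lemma upper_paths_cross:
  assumes f: "path f" "path_image f \<subseteq> upper" "f 0 = of_real a" "f 1 = of_real b"
    and g: "path g" "path_image g \<subseteq> upper" "g 0 = of_real c" "g 1 = of_real d"
    and less: "a < c" "c < b" "b < d"
  obtains s t where "s \<in> {0..1}" "t \<in> {0..1}" "f s = g t"
proof -
  define V :: "complex \<Rightarrow> real^2" where "V = (\<lambda>z. \<chi> i. if i = 1 then Re z else Im z)"
  have V: "V z $ 1 = Re z" "V z $ 2 = Im z" for z by (auto simp: V_def)
  have contV: "continuous_on S V" for S
    unfolding V_def
  proof (rule continuous_on_vec_lambda)
    fix i :: 2
    show "continuous_on S (\<lambda>z. if i = 1 then Re z else Im z)"
      by (cases "i = 1") (auto intro: continuous_intros)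
  qed
  have "bounded (path_image f \<union> path_image g)"
    using f g by (simp add: bounded_path_image)
  then obtain M where M: "\<And>z. z \<in> path_image f \<union> path_image g \<Longrightarrow> norm z \<le> M" by (meson bounded_iff)
  define l u :: "real^2" where "l = (\<chi> i. if i = 1 then - M else 0)" and "u = (\<chi> i. M)"
  have box: "V z \<in> cbox l u" if "z \<in> path_image f \<union> path_image g" for z
  proof -
    have "norm z \<le> M" "0 \<le> Im z" using M[OF that] f(2) g(2) that by (auto simp: upper_def)
    then show ?thesis
      using abs_Re_le_cmod[of z] abs_Im_le_cmod[of z] by (auto simp: mem_box_cart V_def l_def u_def)
  qed
  have "path (V \<circ> f)" "path (V \<circ> g)" using f g contV by (auto intro: path_continuous_image)
  then obtain z where z: "z \<in> path_image (V \<circ> f)" "z \<in> path_image (V \<circ> g)"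
  proof (rule fashoda_interlace[of "V \<circ> f" "V \<circ> g" l u])
    show "path_image (V \<circ> f) \<subseteq> cbox l u" "path_image (V \<circ> g) \<subseteq> cbox l u"
      using box by (auto simp: path_image_compose)
  qed (use f g less in \<open>auto simp: pathstart_def pathfinish_def V l_def\<close>)
  then obtain s t where st: "s \<in> {0..1}" "t \<in> {0..1}" "V (f s) = V (g t)" by (auto simp: path_image_def)
  then have "f s = g t" using V[of "f s"] V[of "g t"] by (simp add: complex_eq_iff)
  then show thesis using that st by blast
qed

text \<open>The second path is prolonged horizontally above \<open>f\<close> and then down to the
  real axis on the right of \<open>f\<close>. The prolonged path must meet \<open>f\<close>, and the
  added segments cannot, so the meeting point lies on \<open>g\<close>.\<close>

lemma upper_path_meets_ray:
  assumes f: "path f" "path_image f \<subseteq> upper" "f 0 = of_real a" "f 1 = of_real b"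
    and g: "path g" "path_image g \<subseteq> upper" "g 0 = of_real c"
    and less: "a < c" "c < b" and high: "\<And>s. s \<in> {0..1} \<Longrightarrow> Im (f s) < Im (g 1)"
  obtains s t where "s \<in> {0..1}" "t \<in> {0..1}" "f s = g t"
proof -
  have "bounded (path_image f)" using f by (simp add: bounded_path_image)
  then obtain M where M: "\<And>z. z \<in> path_image f \<Longrightarrow> norm z \<le> M" by (meson bounded_iff)
  define D where "D = max M b + 1"
  define Y where "Y = Im (g 1)"
  have fM: "Re (f s) < D" if "s \<in> {0..1}" for s
    using M[of "f s"] that abs_Re_le_cmod[of "f s"] by (auto simp: path_image_def D_def)
  have Y0: "Y \<ge> 0" using g(2) pathfinish_in_path_image[of g] by (auto simp: upper_def Y_def pathfinish_def)
  let ?l1 = "linepath (g 1) (Complex D Y)" and ?l2 = "linepath (Complex D Y) (of_real D)"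
  define q where "q = g +++ ?l1 +++ ?l2"
  have i1: "Im z = Y" if z: "z \<in> path_image ?l1" for z
  proof -
    obtain u where "z = (1 - u) *\<^sub>R g 1 + u *\<^sub>R Complex D Y" using z by (auto simp: in_segment)
    then have "Im z = (1 - u) * Im (g 1) + u * Y" by simp
    then show ?thesis by (simp add: Y_def algebra_simps)
  qed
  have i2: "Re z = D \<and> 0 \<le> Im z" if z: "z \<in> path_image ?l2" for z
  proof -
    obtain u where "z = (1 - u) *\<^sub>R Complex D Y + u *\<^sub>R of_real D" "0 \<le> u" and "u \<le> 1"
      using z by (auto simp: in_segment)
    then have "Re z = (1 - u) * D + u * D" "Im z = (1 - u) * Y" by simp_all
    moreover have "0 \<le> (1 - u) * Y" using Y0 \<open>u \<le> 1\<close> by simp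
    ultimately show ?thesis by (simp add: left_diff_distrib)
  qed
  have gf: "pathfinish g = g 1" by (simp add: pathfinish_def)
  have pq: "path q" unfolding q_def by (intro path_join_imp path_linepath g(1)) (simp_all add: gf)
  have imq: "path_image q = path_image g \<union> (path_image ?l1 \<union> path_image ?l2)"
    unfolding q_def by (simp add: path_image_join gf)
  have "path_image q \<subseteq> upper" using imq g(2) i1 i2 Y0 by (auto simp: upper_def)
  moreover have "q 0 = of_real c" using g(3) by (simp add: q_def joinpaths_def)
  moreover have "q 1 = of_real D" unfolding q_def by (simp add: joinpaths_def linepath_def)
  moreover have "b < D" by (simp add: D_def)
  ultimately obtain s t where st: "s \<in> {0..1}" "t \<in> {0..1}" "f s = q t"
    using upper_paths_cross[OF f pq] less by metis
  have "q t \<in> path_image q" using st by (auto simp: path_image_def)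
  moreover have "q t \<notin> path_image ?l1" using i1[of "q t"] high[OF st(1)] st(3) by (auto simp: Y_def)
  moreover have "q t \<notin> path_image ?l2" using i2[of "q t"] fM[OF st(1)] st(3) by auto
  ultimately have "f s \<in> path_image g" using imq st(3) by auto
  then show thesis using that st(1) by (auto simp: path_image_def)
qed

section \<open>Lifts of arcs between boundary points\<close>

text \<open>Simplicity and avoidance of the marked points are required of the projection rather than
  of \<open>h\<close> itself; that \<open>A\<close> and \<open>B\<close> differ encodes
  non-contractibility.\<close>

definition cover_path :: "complex set \<Rightarrow> real \<Rightarrow> real \<Rightarrow> (real \<Rightarrow> complex) \<Rightarrow> bool" where
  "cover_path P A B h \<longleftrightarrow> path h \<and> path_image h \<subseteq> upper \<and> h 0 = of_real A \<and> h 1 = of_real B \<and>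
     A \<noteq> B \<and> cov A \<in> P \<and> cov B \<in> P \<and> (\<forall>s\<in>{0<..<1}. cov (h s) \<notin> P) \<and> loop_free (\<lambda>s. cov (h s))"

text \<open>A contraction would take place in the plane without the puncture, where the winding
  number \<open>(B - A) / (2 * pi)\<close> is invariant and not 0.\<close>

lemma cover_path_marked:
  assumes h: "cover_path P A B h"
  shows "marked_arc P (\<lambda>s. cov (h s))"
proof -
  let ?g = "\<lambda>s. cov (h s)"
  have ph: "path h" using h by (simp add: cover_path_def)
  have im: "0 \<le> Im (h s)" if "s \<in> {0..1}" for s
    using h upper_pathD that by (simp add: cover_path_def)
  have "path ?g" using ph unfolding path_def by (intro continuous_intros)
  then have "simple_path ?g" using h by (simp add: simple_path_def cover_path_def)
  moreover have "path_image ?g \<subseteq> cball 0 1" using im by (auto simp: path_image_def norm_cov)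
  moreover have "pathstart ?g \<in> P" "pathfinish ?g \<in> P"
    using h by (auto simp: cover_path_def pathstart_def pathfinish_def)
  moreover have "?g ` {0<..<1} \<inter> marked_points P = {}"
    using h by (auto simp: cover_path_def marked_points_def)
  moreover have "\<not> homotopic_paths (cball 0 1 - (marked_points P - {pathstart ?g})) ?g (linepath (pathstart ?g) (pathstart ?g))"
  proof
    assume "homotopic_paths (cball 0 1 - (marked_points P - {pathstart ?g})) ?g (linepath (pathstart ?g) (pathstart ?g))"
    then have "homotopic_paths (- {0}) ?g (linepath (pathstart ?g) (pathstart ?g))"
      by (rule homotopic_paths_subset) (auto simp: marked_points_def pathstart_def)
    then have "winding_number ?g 0 = winding_number (linepath (pathstart ?g) (pathstart ?g)) 0"
      by (rule winding_number_homotopic_paths)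
    also have "\<dots> = 0" by (rule winding_number_trivial) (simp add: pathstart_def)
    finally have "(h 1 - h 0) / (2 * pi) = 0" using winding_number_cov[OF ph] by simp
    then show False using h by (auto simp: cover_path_def)
  qed
  ultimately show ?thesis by (simp add: marked_arc_def marked_points_def)
qed

lemma cover_path_isotopic:
  fixes H :: "real \<Rightarrow> real \<Rightarrow> complex"
  assumes cont: "continuous_on ({0..1} \<times> {0..1}) (\<lambda>x. H (fst x) (snd x))"
    and H: "\<And>t. t \<in> {0..1} \<Longrightarrow> cover_path P A B (H t)"
    and fg: "\<And>s. s \<in> {0..1} \<Longrightarrow> f s = cov (H 0 s)" "\<And>s. s \<in> {0..1} \<Longrightarrow> g s = cov (H 1 s)"
  shows "isotopic_arcs P f g"
proof (rule isotopic_arcsI[of "\<lambda>t s. cov (H t s)"])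
  show "continuous_on ({0..1} \<times> {0..1}) (\<lambda>x. cov (H (fst x) (snd x)))" using cont by (rule continuous_on_cov)
  show "marked_arc P (\<lambda>s. cov (H t s))" if "t \<in> {0..1}" for t using cover_path_marked H that by blast
  show "cov (H t 0) = cov A" "cov (H t 1) = cov B" if "t \<in> {0..1}" for t
    using H[OF that] by (auto simp: cover_path_def)
qed (use fg in auto)

lemma cov_real_in_P: "P \<subseteq> sphere 0 1 \<Longrightarrow> cov w \<in> P \<Longrightarrow> Im w = 0"
  using norm_cov[of w] by (auto simp: subset_iff)

text \<open>A simple arc cannot cross its own translate by a full turn.\<close>

lemma cover_path_length:
  assumes P: "P \<subseteq> sphere 0 1" and h: "cover_path P A B h" and "A < B"
  shows "B \<le> A + 2 * pi"
proof (rule ccontr)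
  assume less: "\<not> B \<le> A + 2 * pi"
  have hh: "path h" "path_image h \<subseteq> upper" "h 0 = of_real A" "h 1 = of_real B" "loop_free (\<lambda>s. cov (h s))"
    using h by (auto simp: cover_path_def)
  let ?k = "\<lambda>s. h s + of_real (2 * pi)"
  have "path ?k" using hh(1) unfolding path_def by (intro continuous_intros)
  moreover have "path_image ?k \<subseteq> upper" using hh(2) by (auto simp: path_image_def upper_def)
  ultimately obtain s t where st: "s \<in> {0..1}" "t \<in> {0..1}" "h s = ?k t"
    using upper_paths_cross[OF hh(1-4), of ?k "A + 2 * pi" "B + 2 * pi"] hh less by auto
  have "cov (h s) = cov (h t)" using cov_shift[of "h t" 1] st(3) by simp
  then have "s = t \<or> s = 0 \<and> t = 1 \<or> s = 1 \<and> t = 0" using hh(5) st by (auto simp: loop_free_def)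
  then show False
  proof (elim disjE conjE)
    assume "s = t" then show False using st(3) by simp
  next
    assume "s = 0" "t = 1"
    then have "of_real A = (of_real (B + 2 * pi) :: complex)" using st(3) hh by simp
    then have "A = B + 2 * pi" by (simp only: of_real_eq_iff)
    then show False using \<open>A < B\<close> pi_gt_zero by linarith
  next
    assume "s = 1" "t = 0"
    then have "of_real B = (of_real (A + 2 * pi) :: complex)" using st(3) hh by simp
    then have "B = A + 2 * pi" by (simp only: of_real_eq_iff)
    then show False using less by simp
  qed
qed

text \<open>The lift can be pushed off the real line and contracted.\<close>

lemma closed_lift_contractible:
  assumes P: "P \<subseteq> sphere 0 1" and h: "path h" "path_image h \<subseteq> upper" "h 0 = of_real A" "h 1 = of_real A"
    and un: "\<And>s. s \<in> {0<..<1} \<Longrightarrow> cov (h s) \<notin> P"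
  shows "homotopic_paths (cball 0 1 - (marked_points P - {cov A})) (\<lambda>s. cov (h s)) (linepath (cov A) (cov A))"
proof -
  let ?S = "cball 0 1 - (marked_points P - {cov A})"
  \<comment> \<open>Linear contraction to \<open>A\<close> with a vertical bump. For
    \<open>0 < t < 1\<close> the bump is positive except where \<open>h s = A\<close>, so the
    intermediate curves meet the real line, which carries the marked points, only at
    \<open>A\<close>.\<close>
  define H :: "real \<Rightarrow> real \<Rightarrow> complex"
    where "H = (\<lambda>t s. of_real (1 - t) * h s + of_real (t * A) + \<i> * of_real (t * (1 - t) * norm (h s - A)))"
  have ch: "continuous_on {0..1} h" using h(1) by (simp add: path_def)
  have Him: "Im (H t s) = (1 - t) * Im (h s) + t * (1 - t) * norm (h s - A)" for t s
    by (simp add: H_def)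
  have hs: "0 \<le> Im (h s)" if "s \<in> {0..1}" for s using upper_pathD[OF h(2) that] .
  have HS: "cov (H t s) \<in> ?S" if ts: "t \<in> {0..1}" "s \<in> {0..1}" for t s
  proof -
    have "0 \<le> Im (H t s)" unfolding Him using ts hs[OF ts(2)] by (intro add_nonneg_nonneg mult_nonneg_nonneg) auto
    moreover have "cov (H t s) \<in> P \<Longrightarrow> cov (H t s) = cov A"
    proof -
      assume "cov (H t s) \<in> P"
      then have z: "(1 - t) * Im (h s) + t * (1 - t) * norm (h s - A) = 0" using cov_real_in_P[OF P] Him by metis
      consider "t = 0" | "t = 1" | "0 < t" "t < 1" using ts by force
      then show ?thesis
      proof cases
        case 1
        then have "H t s = h s" by (simp add: H_def)
        then have "s \<notin> {0<..<1}" using un \<open>cov (H t s) \<in> P\<close> by metis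
        then have "s = 0 \<or> s = 1" using ts by auto
        then show ?thesis using h \<open>H t s = h s\<close> by auto
      next
        case 2 then show ?thesis by (simp add: H_def)
      next
        case 3
        have "(1 - t) * Im (h s) \<ge> 0" "t * (1 - t) * norm (h s - A) \<ge> 0" using 3 hs[OF ts(2)] by auto
        then have "t * (1 - t) * norm (h s - A) = 0" using z by linarith
        then have "h s = A" using 3 by simp
        then show ?thesis by (simp add: H_def algebra_simps)
      qed
    qed
    ultimately show ?thesis by (auto simp: marked_points_def norm_cov)
  qed
  show ?thesis
    unfolding homotopic_paths
  proof (intro exI[of _ "\<lambda>x. cov (H (fst x) (snd x))"] conjI ballI)
    have "continuous_on ({0..1} \<times> {0..1}) (\<lambda>x. h (snd x))"
      by (rule continuous_on_compose2[OF ch]) (intro continuous_intros, auto)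
    then show "continuous_on ({0..1} \<times> {0..1}) (\<lambda>x. cov (H (fst x) (snd x)))"
      unfolding H_def by (intro continuous_intros)
    show "(\<lambda>x. cov (H (fst x) (snd x))) \<in> {0..1} \<times> {0..1} \<rightarrow> ?S" using HS by auto
  qed (use h in \<open>auto simp: H_def pathstart_def pathfinish_def linepath_def algebra_simps scaleR_conv_of_real\<close>)
qed

lemma marked_arc_lift:
  assumes P: "P \<subseteq> sphere 0 1" and g: "marked_arc P g" and ends: "pathstart g \<in> P" "pathfinish g \<in> P"
    and A: "cov (of_real A) = pathstart g"
  obtains B h where "cover_path P A B h" "\<And>s. s \<in> {0..1} \<Longrightarrow> g s = cov (h s)"
proof -
  have sg: "simple_path g" "path_image g \<subseteq> cball 0 1" "g ` {0<..<1} \<inter> marked_points P = {}"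
    using g by (auto simp: marked_arc_def)
  have gP: "g s \<notin> P" "g s \<noteq> 0" if "s \<in> {0<..<1}" for s
    using sg(3) imageI[OF that, of g] unfolding marked_points_def by blast+
  have "0 \<notin> P" using P by auto
  have "g s \<noteq> 0" if "s \<in> {0..1}" for s
  proof -
    have "s = 0 \<or> s = 1 \<or> s \<in> {0<..<1}" using that by force
    then show ?thesis using gP ends \<open>0 \<notin> P\<close> by (auto simp: pathstart_def pathfinish_def)
  qed
  then have "0 \<notin> path_image g" by (auto simp: path_image_def)
  moreover have "path g" using sg by (simp add: simple_path_def)
  ultimately obtain h where h: "path h" "h 0 = of_real A" "\<And>t. t \<in> {0..1} \<Longrightarrow> g t = cov (h t)"
    using path_lift[of g "of_real A"] A by (auto simp: pathstart_def)
  have up: "path_image h \<subseteq> upper"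
  proof -
    have "0 \<le> Im (h s)" if "s \<in> {0..1}" for s
    proof -
      have "norm (g s) \<le> 1" using sg(2) that by (auto simp: path_image_def image_subset_iff)
      then show ?thesis using h(3)[OF that] by (simp add: norm_cov)
    qed
    then show ?thesis by (auto simp: path_image_def upper_def)
  qed
  have "cov (h 1) \<in> P" using ends h(3)[of 1] by (simp add: pathfinish_def)
  then have "Im (h 1) = 0" using cov_real_in_P[OF P] by blast
  then have h1: "h 1 = of_real (Re (h 1))" by (simp add: complex_eq_iff)
  have un: "cov (h s) \<notin> P" if "s \<in> {0<..<1}" for s using gP[OF that] h(3)[of s] that by auto
  have lf: "loop_free (\<lambda>s. cov (h s))" using sg(1) h(3) unfolding simple_path_def loop_free_def by metis
  \<comment> \<open>A closed lift could be contracted, contrary to the definition of an arc.\<close>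
  have "A \<noteq> Re (h 1)"
  proof
    assume "A = Re (h 1)"
    then have c: "homotopic_paths (cball 0 1 - (marked_points P - {cov A})) (\<lambda>s. cov (h s)) (linepath (cov A) (cov A))"
      by (intro closed_lift_contractible[OF P h(1) up h(2) _ un]) (use h1 in auto)
    have "marked_arc P (\<lambda>s. cov (h s))" using marked_arc_cong[of g "\<lambda>s. cov (h s)" P] h(3) g by blast
    then show False using c h(2) by (simp add: marked_arc_def pathstart_def)
  qed
  then have "cover_path P A (Re (h 1)) h"
    unfolding cover_path_def using h up un lf h1 ends A \<open>cov (h 1) \<in> P\<close> by auto
  then show thesis using that h(3) by blast
qed

text \<open>Meant for \<open>shrink\<close>, whose inner quotient need have no limit as
  \<open>t\<close> tends to 1, while the factor in front vanishes there and the arc is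
  bounded.\<close>

lemma continuous_on_vanishing_factor:
  fixes v :: "'a::metric_space \<Rightarrow> complex"
  assumes u: "continuous_on S u" and v: "continuous_on {x \<in> S. u x \<noteq> 0} v"
    and B: "\<And>x. x \<in> S \<Longrightarrow> norm (v x) \<le> B"
  shows "continuous_on S (\<lambda>x. of_real (u x) * v x)"
  unfolding continuous_on_iff
proof (intro ballI allI impI)
  fix x and e :: real assume x: "x \<in> S" and e: "e > 0"
  let ?f = "\<lambda>x. of_real (u x) * v x"
  show "\<exists>d>0. \<forall>y\<in>S. dist y x < d \<longrightarrow> dist (?f y) (?f x) < e"
  proof (cases "u x = 0")
    case True
    have B0: "B \<ge> 0" using B[OF x] norm_ge_zero order_trans by blast
    then have "e / (B + 1) > 0" using e by simp
    then obtain d where d: "d > 0" "\<And>y. y \<in> S \<Longrightarrow> dist y x < d \<Longrightarrow> dist (u y) (u x) < e / (B + 1)"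
      using u x unfolding continuous_on_iff by meson
    have "dist (?f y) (?f x) < e" if y: "y \<in> S" "dist y x < d" for y
    proof -
      have "\<bar>u y\<bar> < e / (B + 1)" using d(2)[OF y] True by (simp add: dist_real_def)
      then have "\<bar>u y\<bar> * (B + 1) < e" using B0 by (simp add: field_simps)
      moreover have "norm (?f y) \<le> \<bar>u y\<bar> * (B + 1)"
        unfolding norm_mult norm_of_real using B[OF y(1)] by (intro mult_left_mono) auto
      ultimately show ?thesis using True by (simp add: dist_norm)
    qed
    then show ?thesis using d by blast
  next
    case False
    have "continuous_on {x \<in> S. u x \<noteq> 0} ?f"
      by (intro continuous_intros v continuous_on_subset[OF u]) auto
    then obtain d1 where d1: "d1 > 0" "\<And>y. y \<in> S \<Longrightarrow> u y \<noteq> 0 \<Longrightarrow> dist y x < d1 \<Longrightarrow> dist (?f y) (?f x) < e"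
      using x False e unfolding continuous_on_iff by (metis (mono_tags, lifting) mem_Collect_eq)
    have "\<bar>u x\<bar> > 0" using False by simp
    then obtain d2 where d2: "d2 > 0" "\<And>y. y \<in> S \<Longrightarrow> dist y x < d2 \<Longrightarrow> dist (u y) (u x) < \<bar>u x\<bar>"
      using u x unfolding continuous_on_iff by meson
    have "dist (?f y) (?f x) < e" if "y \<in> S" "dist y x < min d1 d2" for y
    proof -
      have "u y \<noteq> 0" using d2(2)[of y] that by (auto simp: dist_real_def)
      then show ?thesis using d1(2)[of y] that by simp
    qed
    then show ?thesis using d1(1) d2(1) by (intro exI[of _ "min d1 d2"]) auto
  qed
qed

section \<open>Isotopy to standard arcs\<close>

text \<open>Alexander's trick for an arc whose final point is exposed: the arc is shrunk towards its
  initial point and prolonged by a straight segment.\<close>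

definition shrink :: "(real \<Rightarrow> complex) \<Rightarrow> real \<Rightarrow> real \<Rightarrow> complex" where
  "shrink c t s = c 0 + of_real (1 - t) * (c (min 1 (s / (1 - t))) - c 0) +
     of_real (max 0 (s - (1 - t))) * (c 1 - c 0)"

lemma shrink_left: "t < 1 \<Longrightarrow> s \<le> 1 - t \<Longrightarrow> shrink c t s = c 0 + of_real (1 - t) * (c (s / (1 - t)) - c 0)"
  by (simp add: shrink_def min_def)

lemma shrink_right: "t \<le> 1 \<Longrightarrow> 1 - t \<le> s \<Longrightarrow> shrink c t s = c 0 + of_real s * (c 1 - c 0)"
proof (cases "t = 1")
  case False
  assume ts: "t \<le> 1" "1 - t \<le> s"
  then have "min 1 (s / (1 - t)) = 1" using False by (auto simp: min_def field_simps)
  then have "shrink c t s = c 0 + (of_real (1 - t) * (c 1 - c 0) + of_real (s - (1 - t)) * (c 1 - c 0))"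
    using ts by (simp add: shrink_def)
  also have "of_real (1 - t) * (c 1 - c 0) + of_real (s - (1 - t)) * (c 1 - c 0) = of_real s * (c 1 - c 0)"
    unfolding distrib_right[symmetric] of_real_add[symmetric] by simp
  finally show ?thesis .
qed (simp add: shrink_def)

lemma shrink_0: "s \<in> {0..1} \<Longrightarrow> shrink c 0 s = c s"
  by (simp add: shrink_def)

lemma shrink_ends: "t \<in> {0..1} \<Longrightarrow> shrink c t 0 = c 0" "t \<in> {0..1} \<Longrightarrow> shrink c t 1 = c 1"
  using shrink_right[of t 1 c] by (auto simp: shrink_def)

lemma continuous_on_shrink:
  assumes c: "continuous_on {0..1} c"
  shows "continuous_on ({0..1} \<times> {0..1}) (\<lambda>x. shrink c (fst x) (snd x))"
proof -
  let ?S = "{0..1} \<times> {0..1::real}"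
  let ?v = "\<lambda>x::real \<times> real. c (min 1 (snd x / (1 - fst x))) - c 0"
  have arg: "min 1 (snd x / (1 - fst x)) \<in> {0..1}" if "x \<in> ?S" for x :: "real \<times> real"
    using that by (auto simp: min_def)
  have "compact (c ` {0..1})" using c by (intro compact_continuous_image) auto
  then obtain B where B: "\<And>y. y \<in> c ` {0..1} \<Longrightarrow> norm y \<le> B" using compact_imp_bounded bounded_iff by metis
  have "continuous_on ?S (\<lambda>x. of_real (1 - fst x) * ?v x)" (is "continuous_on _ ?a")
  proof (rule continuous_on_vanishing_factor[where B = "B + B"])
    show "continuous_on {x \<in> ?S. 1 - fst x \<noteq> 0} ?v"
    proof (intro continuous_intros)
      show "continuous_on {x \<in> ?S. 1 - fst x \<noteq> 0} (\<lambda>x. c (min 1 (snd x / (1 - fst x))))"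
        by (rule continuous_on_compose2[OF c]) (use arg in \<open>auto intro!: continuous_intros\<close>)
    qed
    show "norm (?v x) \<le> B + B" if "x \<in> ?S" for x
      using norm_triangle_ineq4[of "c (min 1 (snd x / (1 - fst x)))" "c 0"]
        B[OF imageI[OF arg[OF that]]] B[of "c 0"] by force
  qed (intro continuous_intros)
  moreover have "continuous_on ?S (\<lambda>x. of_real (max 0 (snd x - (1 - fst x))) * (c 1 - c 0))" (is "continuous_on _ ?b")
    by (intro continuous_intros)
  ultimately have "continuous_on ?S (\<lambda>x. c 0 + ?a x + ?b x)"
    by (intro continuous_on_add continuous_on_const)
  then show ?thesis unfolding shrink_def .
qed

lemma shrink_in_convex:
  assumes C: "convex C" "\<And>s. s \<in> {0..1} \<Longrightarrow> c s \<in> C" and ts: "t \<in> {0..1}" "s \<in> {0..1}"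
  shows "shrink c t s \<in> C"
proof (cases "1 - t \<le> s")
  case True
  have "shrink c t s = (1 - s) *\<^sub>R c 0 + s *\<^sub>R c 1"
    using shrink_right[of t s c] True ts by (simp add: scaleR_conv_of_real algebra_simps)
  then show ?thesis using C ts convexD[OF C(1), of "c 0" "c 1" "1 - s" s] by simp
next
  case False
  then have t: "t < 1" using ts by auto
  have a: "s / (1 - t) \<in> {0..1}" using False ts t by auto
  have "shrink c t s = t *\<^sub>R c 0 + (1 - t) *\<^sub>R c (s / (1 - t))"
    using shrink_left[of t s c] False t by (simp add: scaleR_conv_of_real algebra_simps)
  then show ?thesis using C(2)[OF a] C(2)[of 0] ts convexD[OF C(1), of "c 0" "c (s / (1 - t))" t "1 - t"] by simp
qed

text \<open>The danger is a collision of the shrunken copy with the added segment. Scaling back by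
  \<open>1 / (1 - t)\<close> would give a point of \<open>C\<close> on the ray from
  \<open>c 0\<close> beyond \<open>c 1\<close>, which the exit condition forbids.\<close>

lemma shrink_inj:
  assumes c: "inj_on c {0..1}" and C: "\<And>s. s \<in> {0..1} \<Longrightarrow> c s \<in> C"
    and ray: "\<And>r. r > 1 \<Longrightarrow> c 0 + of_real r * (c 1 - c 0) \<notin> C"
    and t: "t \<in> {0..1}" and ss: "s \<in> {0..1}" "s' \<in> {0..1}" and eq: "shrink c t s = shrink c t s'"
  shows "s = s'"
proof -
  have ne: "c 0 \<noteq> c 1" using inj_onD[OF c, of 0 1] by auto
  have mixed: False if ss: "s \<in> {0..1}" "s < 1 - t" "1 - t < s'" and eq: "shrink c t s = shrink c t s'" for s s'
  proof -
    have t1: "t < 1" using that by auto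
    have "of_real (1 - t) * (c (s / (1 - t)) - c 0) = of_real s' * (c 1 - c 0)"
      using eq shrink_left[of t s c] shrink_right[of t s' c] ss t by simp
    then have "c (s / (1 - t)) - c 0 = of_real s' * (c 1 - c 0) / of_real (1 - t)"
      using t1 by (simp add: field_simps del: of_real_diff)
    then have "c (s / (1 - t)) = c 0 + of_real (s' / (1 - t)) * (c 1 - c 0)"
      by (simp add: algebra_simps of_real_divide)
    moreover have "s' / (1 - t) > 1" using t1 ss by (simp add: field_simps)
    moreover have "s / (1 - t) \<in> {0..1}" using t1 ss by (simp add: field_simps)
    ultimately show False using C[of "s / (1 - t)"] ray[of "s' / (1 - t)"] by metis
  qed
  consider "s \<ge> 1 - t" "s' \<ge> 1 - t" | "s \<le> 1 - t" "s' \<le> 1 - t" | "s < 1 - t" "1 - t < s'" | "s' < 1 - t" "1 - t < s"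
    by linarith
  then show ?thesis
  proof cases
    case 1
    then have "shrink c t s = c 0 + of_real s * (c 1 - c 0)" "shrink c t s' = c 0 + of_real s' * (c 1 - c 0)"
      using t by (auto intro!: shrink_right)
    then have "of_real s * (c 1 - c 0) = of_real s' * (c 1 - c 0)" using eq by (metis add_left_cancel)
    then show ?thesis using ne by simp
  next
    case 2
    show ?thesis
    proof (cases "t = 1")
      case True then show ?thesis using 2 ss by simp
    next
      case False
      then have t1: "t < 1" using t by simp
      then have "c (s / (1 - t)) = c (s' / (1 - t))"
        using eq shrink_left[of t s c] shrink_left[of t s' c] 2 by simp
      moreover have "s / (1 - t) \<in> {0..1}" "s' / (1 - t) \<in> {0..1}" using t1 2 ss by (auto simp: field_simps)
      ultimately have "s / (1 - t) = s' / (1 - t)" using inj_onD[OF c] by blast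
      then show ?thesis using t1 by simp
    qed
  next
    case 3 then show ?thesis using mixed[of s s'] ss eq by simp
  next
    case 4 then show ?thesis using mixed[of s' s] ss eq by simp
  qed
qed

text \<open>The scaling is centred at the puncture, so for \<open>t > 0\<close> the shrunken copy
  lies in the open disk and meets no marked point of the circle, and the added segment is part of a
  radius.\<close>

lemma spoke_isotopic_radius:
  assumes P: "P \<subseteq> sphere 0 1" and g: "marked_arc P g" and ends: "pathstart g = 0" "pathfinish g \<in> P"
  shows "isotopic_arcs P g (linepath 0 (pathfinish g))"
proof -
  define p where "p = g 1"
  have p: "p \<in> P" "norm p = 1" using ends P by (auto simp: p_def pathfinish_def)
  have g0: "g 0 = 0" "g 1 = p" using ends by (auto simp: p_def pathstart_def)
  have sg: "simple_path g" "path_image g \<subseteq> cball 0 1" "g ` {0<..<1} \<inter> marked_points P = {}"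
    using g by (auto simp: marked_arc_def)
  have cg: "continuous_on {0..1} g" using sg by (simp add: simple_path_def path_def)
  have "g 0 \<noteq> g 1" using g0 p by auto
  then have "arc g" using sg(1) by (simp add: arc_simple_path pathstart_def pathfinish_def)
  then have inj: "inj_on g {0..1}" by (simp add: arc_def)
  have gc: "g s \<in> cball 0 1" if "s \<in> {0..1}" for s using sg(2) that by (auto simp: path_image_def image_subset_iff)
  have ray: "g 0 + of_real r * (g 1 - g 0) \<notin> cball 0 1" if "r > 1" for r
    using g0 p that by (simp add: norm_mult)
  show ?thesis
  proof (rule isotopic_arcsI[of "shrink g" P 0 p])
    show "continuous_on ({0..1} \<times> {0..1}) (\<lambda>x. shrink g (fst x) (snd x))" by (rule continuous_on_shrink[OF cg])
    show c0: "shrink g t 0 = 0" and c1: "shrink g t 1 = p" if "t \<in> {0..1}" for t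
      using shrink_ends[OF that, of g] g0 by auto
    show "g s = shrink g 0 s" if "s \<in> {0..1}" for s using shrink_0[OF that] by simp
    show "linepath 0 (pathfinish g) s = shrink g 1 s" if "s \<in> {0..1}" for s
      using shrink_right[of 1 s g] that g0 by (simp add: linepath_def pathfinish_def scaleR_conv_of_real)
    show "marked_arc P (shrink g t)" if t: "t \<in> {0..1}" for t
    proof -
      have "continuous_on {0..1} (\<lambda>s. (t, s))"
        by (intro continuous_on_Pair continuous_on_const continuous_on_id)
      from continuous_on_compose2[OF continuous_on_shrink[OF cg] this]
      have cc: "continuous_on {0..1} (shrink g t)" using t by (simp add: image_subset_iff)
      have lf: "s = s'" if "s \<in> {0..1}" "s' \<in> {0..1}" "shrink g t s = shrink g t s'" for s s'
        by (rule shrink_inj[OF inj gc ray t that])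
      have "simple_path (shrink g t)"
        unfolding simple_path_def path_def loop_free_def using cc lf by blast
      moreover have "path_image (shrink g t) \<subseteq> cball 0 1"
        using shrink_in_convex[OF convex_cball gc t] by (auto simp: path_image_def)
      moreover have "shrink g t s \<notin> marked_points P" if s: "s \<in> {0<..<1}" for s
      proof -
        have "shrink g t s \<noteq> 0" using lf[of s 0] c0[OF t] s by auto
        moreover have "shrink g t s \<notin> P"
        proof (cases "1 - t \<le> s")
          case True
          then have "norm (shrink g t s) = s" using shrink_right[of t s g] t g0 p s by (simp add: norm_mult)
          then show ?thesis using P s by force
        next
          case False
          then have t1: "t < 1" using s by auto
          have a: "s / (1 - t) \<in> {0<..<1}" using False s t1 by auto
          have e: "shrink g t s = of_real (1 - t) * g (s / (1 - t))" using shrink_left[of t s g] False t1 g0 by simp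
          show ?thesis
          proof (cases "t = 0")
            case True
            then have "shrink g t s = g s" using e by simp
            moreover have "g s \<notin> marked_points P" using sg(3) imageI[OF s, of g] by blast
            ultimately show ?thesis by (simp add: marked_points_def)
          next
            case False
            have "norm (g (s / (1 - t))) \<le> 1" using gc[of "s / (1 - t)"] a by auto
            then have "(1 - t) * norm (g (s / (1 - t))) \<le> 1 - t" using t1 by (simp add: mult_left_le)
            moreover have "norm (shrink g t s) = (1 - t) * norm (g (s / (1 - t)))"
              unfolding e norm_mult norm_of_real using t1 by simp
            moreover have "0 < t" using False t by simp
            ultimately have "norm (shrink g t s) < 1" by linarith
            then show ?thesis using P by force
          qed
        qed
        ultimately show ?thesis by (simp add: marked_points_def)
      qed
      moreover have "\<not> homotopic_paths S (shrink g t) (linepath (pathstart (shrink g t)) (pathstart (shrink g t)))" for S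
        using homotopic_paths_imp_pathfinish[of S "shrink g t" "linepath (pathstart (shrink g t)) (pathstart (shrink g t))"]
          c0[OF t] c1[OF t] p by (auto simp: pathstart_def pathfinish_def)
      ultimately show ?thesis
        using c0[OF t] c1[OF t] p unfolding marked_arc_def by (auto simp: pathstart_def pathfinish_def marked_points_def)
    qed
  qed
qed

section \<open>Pushing arcs off the circle; graphs over an interval\<close>

lemma real_mod_interval:
  fixes x x' A B :: real and k :: int
  assumes "x \<in> {A..B}" "x' \<in> {A..B}" "B \<le> A + 2 * pi" "x' = x + 2 * pi * k"
  shows "x' = x \<or> x = A \<and> x' = B \<or> x = B \<and> x' = A"
proof -
  consider "k = 0" | "k \<ge> 1" | "k \<le> -1" by linarith
  then show ?thesis
  proof cases
    case 2
    then have "2 * pi * real_of_int k \<ge> 2 * pi * 1" by (intro mult_left_mono) auto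
    then have "x = A" "x' = B" using assms unfolding atLeastAtMost_iff by linarith+
    then show ?thesis by blast
  next
    case 3
    then have "2 * pi * real_of_int k \<le> 2 * pi * (-1)" by (intro mult_left_mono) auto
    then have "x = B" "x' = A" using assms unfolding atLeastAtMost_iff by linarith+
    then show ?thesis by blast
  qed (use assms in simp)
qed

lemma continuous_on_slice:
  assumes "continuous_on ({0..1} \<times> {0..1}) (\<lambda>x. F (fst x) (snd x))" "t \<in> {0..1}"
  shows "continuous_on {0..1} (F t)"
proof -
  have "continuous_on {0..1} (\<lambda>s. (t, s))"
    by (intro continuous_on_Pair continuous_on_const continuous_on_id)
  from continuous_on_compose2[OF assms(1) this] show ?thesis using assms(2) by (simp add: image_subset_iff)
qed

text \<open>Moving an arc off the boundary circle by a shear.\<close>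

lemma cover_path_push:
  assumes P: "P \<subseteq> sphere 0 1" "closed P" and h: "cover_path P A B h"
  obtains h' where "cover_path P A B h'" "isotopic_arcs P (\<lambda>s. cov (h s)) (\<lambda>s. cov (h' s))"
    "\<And>s. s \<in> {0<..<1} \<Longrightarrow> 0 < Im (h' s)"
proof -
  have hh: "path h" "path_image h \<subseteq> upper" "h 0 = of_real A" "h 1 = of_real B" "A \<noteq> B" "cov A \<in> P" "cov B \<in> P"
      "\<And>s. s \<in> {0<..<1} \<Longrightarrow> cov (h s) \<notin> P" "loop_free (\<lambda>s. cov (h s))"
    using h by (auto simp: cover_path_def)
  have ch: "continuous_on {0..1} h" using hh(1) by (simp add: path_def)
  \<comment> \<open>The height of the shear is the distance from \<open>P\<close>. It is periodic,
    so the shear commutes with the deck translations and the arc stays simple downstairs; it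
    vanishes exactly over \<open>P\<close>, so the end points stay fixed and all other boundary
    points are raised.\<close>
  define e where "e = (\<lambda>x::real. infdist (cov (of_real x)) P)"
  have e0: "e x \<ge> 0" for x by (simp add: e_def infdist_nonneg)
  have Pne: "P \<noteq> {}" using hh(6) by auto
  have eP: "e x = 0 \<longleftrightarrow> cov (of_real x) \<in> P" for x
    using in_closed_iff_infdist_zero[OF P(2) Pne] by (simp add: e_def)
  have eper: "e (x + 2 * pi * of_int k) = e x" for x k
    using cov_shift[of "of_real x" k] by (simp add: e_def)
  define H :: "real \<Rightarrow> real \<Rightarrow> complex" where "H = (\<lambda>t s. h s + \<i> * of_real (t * e (Re (h s))))"
  have ImH: "Im (H t s) = Im (h s) + t * e (Re (h s))" and ReH: "Re (H t s) = Re (h s)" for t s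
    by (simp_all add: H_def)
  have cont: "continuous_on ({0..1} \<times> {0..1}) (\<lambda>x. H (fst x) (snd x))"
  proof -
    have "continuous_on ({0..1} \<times> {0..1}) (\<lambda>x::real \<times> real. h (snd x))"
      by (rule continuous_on_compose2[OF ch]) (intro continuous_intros, auto)
    then show ?thesis unfolding H_def e_def by (intro continuous_intros)
  qed
  have real: "Im (h s) = 0 \<and> t * e (Re (h s)) = 0" if "t \<in> {0..1}" "s \<in> {0..1}" "Im (H t s) = 0" for t s
  proof -
    have "0 \<le> Im (h s)" "0 \<le> t * e (Re (h s))" using upper_pathD[OF hh(2) that(2)] that(1) e0 by auto
    then show ?thesis using that(3) ImH[of t s] by linarith
  qed
  have notP: "cov (H t s) \<notin> P" if ts: "t \<in> {0..1}" "s \<in> {0<..<1}" for t s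
  proof
    assume c: "cov (H t s) \<in> P"
    then have "Im (H t s) = 0" using cov_real_in_P[OF P(1)] by blast
    then have r: "Im (h s) = 0" "t * e (Re (h s)) = 0" using real[of t s] ts by auto
    then have "H t s = h s" by (simp add: H_def)
    then show False using c hh(8)[OF ts(2)] by simp
  qed
  have H: "cover_path P A B (H t)" if t: "t \<in> {0..1}" for t
    unfolding cover_path_def
  proof (intro conjI ballI)
    show "path (H t)" unfolding path_def using continuous_on_slice[OF cont t] .
    have "0 \<le> Im (H t s)" if "s \<in> {0..1}" for s
      using upper_pathD[OF hh(2) that] t e0 by (simp add: ImH)
    then show "path_image (H t) \<subseteq> upper" by (auto simp: path_image_def upper_def)
    have "e A = 0" "e B = 0" using eP hh by auto
    then show "H t 0 = of_real A" "H t 1 = of_real B" using hh by (auto simp: H_def)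
    show "cov (H t s) \<notin> P" if "s \<in> {0<..<1}" for s using notP[OF t that] .
    have "cov (h s) = cov (h s')" if eq: "cov (H t s) = cov (H t s')" for s s'
    proof -
      obtain k :: int where k: "H t s' = H t s + of_real (2 * pi * k)" using eq cov_eq by blast
      then have "Re (h s') = Re (h s) + 2 * pi * of_int k" using ReH by (metis Re_complex_of_real plus_complex.simps(1))
      then have "e (Re (h s')) = e (Re (h s))" using eper by simp
      then have "h s' = h s + of_real (2 * pi * k)" using k by (simp add: H_def)
      then show ?thesis using cov_eq by blast
    qed
    then show "loop_free (\<lambda>s. cov (H t s))" using hh(9) unfolding loop_free_def by blast
  qed (use hh in auto)
  have "isotopic_arcs P (\<lambda>s. cov (h s)) (\<lambda>s. cov (H 1 s))"
    by (rule cover_path_isotopic[OF cont H]) (auto simp: H_def)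
  moreover have "0 < Im (H 1 s)" if s: "s \<in> {0<..<1}" for s
  proof -
    have "0 \<le> Im (H 1 s)" using upper_pathD[OF hh(2), of s] s e0 by (simp add: ImH)
    moreover have "Im (H 1 s) \<noteq> 0"
    proof
      assume "Im (H 1 s) = 0"
      then have r: "Im (h s) = 0" "e (Re (h s)) = 0" using real[of 1 s] s by auto
      then have "cov (of_real (Re (h s))) \<in> P" using eP by simp
      moreover have "h s = of_real (Re (h s))" using r by (simp add: complex_eq_iff)
      ultimately show False using hh(8)[OF s] by simp
    qed
    ultimately show ?thesis by simp
  qed
  ultimately show thesis using that H[of 1] by simp
qed

definition graph_path :: "real \<Rightarrow> real \<Rightarrow> (real \<Rightarrow> real) \<Rightarrow> real \<Rightarrow> complex" where
  "graph_path A B r s = Complex (A + (B - A) * s) (r (A + (B - A) * s))"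

lemma graph_path_range:
  fixes A B s :: real
  assumes "A < B"
  shows "s \<in> {0..1} \<Longrightarrow> A + (B - A) * s \<in> {A..B}" "s \<in> {0<..<1} \<Longrightarrow> A + (B - A) * s \<in> {A<..<B}"
proof -
  have *: "A + (B - A) * s = B - (B - A) * (1 - s)" by (simp add: algebra_simps)
  show "A + (B - A) * s \<in> {A..B}" if "s \<in> {0..1}"
  proof -
    have "0 \<le> (B - A) * s" "0 \<le> (B - A) * (1 - s)" using that assms by auto
    then show ?thesis unfolding atLeastAtMost_iff using * by linarith
  qed
  show "A + (B - A) * s \<in> {A<..<B}" if "s \<in> {0<..<1}"
  proof -
    have "0 < (B - A) * s" "0 < (B - A) * (1 - s)" using that assms by auto
    then show ?thesis unfolding greaterThanLessThan_iff using * by linarith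
  qed
qed

lemma graph_path_continuous:
  assumes "A < B" "continuous_on {A..B} r"
  shows "continuous_on {0..1} (graph_path A B r)"
proof -
  have "continuous_on {0..1} (\<lambda>s. r (A + (B - A) * s))"
    by (rule continuous_on_compose2[OF assms(2)])
       (use graph_path_range[OF assms(1)] in \<open>auto intro!: continuous_intros\<close>)
  then show ?thesis unfolding graph_path_def Complex_eq by (intro continuous_intros)
qed

lemma graph_path_cover:
  assumes P: "P \<subseteq> sphere 0 1" and AB: "A < B" "B \<le> A + 2 * pi" "cov A \<in> P" "cov B \<in> P"
    and r: "continuous_on {A..B} r" "r A = 0" "r B = 0" "\<And>x. x \<in> {A<..<B} \<Longrightarrow> 0 < r x"
  shows "cover_path P A B (graph_path A B r)"
  unfolding cover_path_def
proof (intro conjI ballI)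
  have r0: "0 \<le> r x" if "x \<in> {A..B}" for x using r that by (cases "x = A \<or> x = B") (auto intro: less_imp_le)
  show "path (graph_path A B r)" unfolding path_def by (rule graph_path_continuous[OF AB(1) r(1)])
  show "path_image (graph_path A B r) \<subseteq> upper"
    using r0 graph_path_range(1)[OF AB(1)] by (auto simp: path_image_def upper_def graph_path_def)
  show "graph_path A B r 0 = of_real A" "graph_path A B r 1 = of_real B"
    using r by (auto simp: graph_path_def complex_eq_iff)
  show "cov (graph_path A B r s) \<notin> P" if "s \<in> {0<..<1}" for s
    using cov_real_in_P[OF P, of "graph_path A B r s"] r(4)[OF graph_path_range(2)[OF AB(1) that]]
    by (auto simp: graph_path_def)
  show "loop_free (\<lambda>s. cov (graph_path A B r s))"
    unfolding loop_free_def
  proof (intro ballI impI)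
    fix s s' :: real assume s: "s \<in> {0..1}" "s' \<in> {0..1}" "cov (graph_path A B r s) = cov (graph_path A B r s')"
    then obtain k :: int where "graph_path A B r s' = graph_path A B r s + of_real (2 * pi * k)" using cov_eq by blast
    then have "A + (B - A) * s' = (A + (B - A) * s) + 2 * pi * k"
      by (simp add: graph_path_def complex_eq_iff)
    from real_mod_interval[OF graph_path_range(1)[OF AB(1) s(1)] graph_path_range(1)[OF AB(1) s(2)] AB(2) this]
    have "(B - A) * s' = (B - A) * s \<or> (B - A) * s = (B - A) * 0 \<and> (B - A) * s' = (B - A) * 1 \<or>
       (B - A) * s = (B - A) * 1 \<and> (B - A) * s' = (B - A) * 0" by (auto simp: algebra_simps)
    then show "s = s' \<or> s = 0 \<and> s' = 1 \<or> s = 1 \<and> s' = 0" using AB(1) unfolding mult_cancel_left by auto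
  qed
qed (use AB in auto)

text \<open>A graph over at most one period is simple because of its abscissae alone, so
  interpolating the heights linearly never creates an intersection.\<close>

lemma graph_paths_isotopic:
  assumes P: "P \<subseteq> sphere 0 1" and AB: "A < B" "B \<le> A + 2 * pi" "cov A \<in> P" "cov B \<in> P"
    and r: "continuous_on {A..B} r" "r A = 0" "r B = 0" "\<And>x. x \<in> {A<..<B} \<Longrightarrow> 0 < r x"
    and q: "continuous_on {A..B} q" "q A = 0" "q B = 0" "\<And>x. x \<in> {A<..<B} \<Longrightarrow> 0 < q x"
  shows "isotopic_arcs P (\<lambda>s. cov (graph_path A B r s)) (\<lambda>s. cov (graph_path A B q s))"
proof (rule cover_path_isotopic[of "\<lambda>t. graph_path A B (\<lambda>x. (1 - t) * r x + t * q x)" _ A B])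
  have c: "continuous_on ({0..1} \<times> {0..1}) (\<lambda>x::real \<times> real. f (A + (B - A) * snd x))"
    if "continuous_on {A..B} f" for f :: "real \<Rightarrow> real"
    by (rule continuous_on_compose2[OF that])
       (use graph_path_range[OF AB(1)] in \<open>auto intro!: continuous_intros\<close>)
  show "continuous_on ({0..1} \<times> {0..1}) (\<lambda>x. graph_path A B (\<lambda>y. (1 - fst x) * r y + fst x * q y) (snd x))"
    unfolding graph_path_def Complex_eq by (intro continuous_intros c r q)
  show "cover_path P A B (graph_path A B (\<lambda>x. (1 - t) * r x + t * q x))" if t: "t \<in> {0..1}" for t
  proof (rule graph_path_cover[OF P AB])
    show "continuous_on {A..B} (\<lambda>x. (1 - t) * r x + t * q x)" by (intro continuous_intros r q)
    show "0 < (1 - t) * r x + t * q x" if x: "x \<in> {A<..<B}" for x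
    proof (cases "t = 0")
      case False
      then have "0 < t * q x" "0 \<le> (1 - t) * r x" using t r(4)[OF x] q(4)[OF x] by auto
      then show ?thesis by linarith
    qed (use r(4)[OF x] in simp)
  qed (use r q in auto)
qed (auto simp: graph_path_def)

text \<open>The exit condition of \<^const>\<open>shrink\<close> for a chord of the unit circle.\<close>

lemma chord_ray_leaves_disc:
  fixes a b :: complex
  assumes "norm a = 1" "norm b = 1" "a \<noteq> b" "r > 1"
  shows "a + of_real r * (b - a) \<notin> cball 0 1"
proof -
  define D where "D = b - a"
  have a1: "(Re a)\<^sup>2 + (Im a)\<^sup>2 = 1" using assms(1) cmod_power2[of a] by simp
  have b1: "(Re a + Re D)\<^sup>2 + (Im a + Im D)\<^sup>2 = 1" using assms(2) cmod_power2[of b] by (simp add: D_def)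
  have D0: "(Re D)\<^sup>2 + (Im D)\<^sup>2 > 0" using assms(3) unfolding cmod_power2[symmetric] by (simp add: D_def)
  have dot: "2 * (Re a * Re D + Im a * Im D) = - ((Re D)\<^sup>2 + (Im D)\<^sup>2)"
    using a1 b1 by (simp add: power2_eq_square algebra_simps)
  have "(norm (a + of_real r * D))\<^sup>2 = ((Re a)\<^sup>2 + (Im a)\<^sup>2) + r * (2 * (Re a * Re D + Im a * Im D)) + r\<^sup>2 * ((Re D)\<^sup>2 + (Im D)\<^sup>2)"
    unfolding cmod_power2 by (simp add: power2_eq_square algebra_simps)
  also have "\<dots> = 1 + (r * (r - 1)) * ((Re D)\<^sup>2 + (Im D)\<^sup>2)"
    unfolding dot a1 by (simp add: power2_eq_square algebra_simps)
  finally have "(norm (a + of_real r * D))\<^sup>2 > 1" using assms(4) D0 by simp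
  then have "\<not> norm (a + of_real r * D) \<le> 1" by (metis norm_ge_zero not_le power_le_one)
  then show ?thesis by (simp add: D_def)
qed

section \<open>The Jordan domain between an arc and a low graph\<close>

lemma outside_of_upper_curve:
  assumes J: "J \<subseteq> upper"
  shows "inside J \<subseteq> upper"
proof
  fix w assume w: "w \<in> inside J"
  show "w \<in> upper"
  proof (rule ccontr)
    assume "w \<notin> upper"
    then have wn: "Im w < 0" by (simp add: upper_def)
    let ?L = "{z::complex. Im z < 0}"
    \<comment> \<open>The lower half-plane is connected, unbounded and disjoint from
      \<open>J\<close>, so none of its points lies inside.\<close>
    have "connected ?L" by (rule convex_connected[OF convex_halfspace_Im_lt])
    moreover have "?L \<subseteq> - J" using J by (auto simp: upper_def)
    ultimately have sub: "?L \<subseteq> connected_component_set (- J) w"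
      using wn by (intro connected_component_maximal) auto
    have "\<not> bounded ?L"
    proof
      assume "bounded ?L"
      then obtain M where M: "\<And>z. z \<in> ?L \<Longrightarrow> norm z \<le> M" by (meson bounded_iff)
      have "Complex 0 (- (\<bar>M\<bar> + 1)) \<in> ?L" by simp
      from M[OF this] have "\<bar>\<bar>M\<bar> + 1\<bar> \<le> M" by (simp add: cmod_def)
      then show False by linarith
    qed
    then have "\<not> bounded (connected_component_set (- J) w)" using sub bounded_subset by blast
    then show False using w by (simp add: inside_def)
  qed
qed

text \<open>The part of a lift that is cut off by the arc meets its own translates only at the end points.
  This treats loops and arcs uniformly: below a loop there is a Jordan domain upstairs, while
  downstairs the region between the loop and the circle is pinched.\<close>

lemma jordan_region_translates:
  fixes J :: "complex set" and A B :: real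
  assumes p: "simple_path p" "pathstart p = of_real A" "pathfinish p = of_real A" "path_image p = J"
    and q: "simple_path q" "pathstart q = of_real B" "pathfinish q = of_real B" "path_image q = J"
    and AB: "A < B" "B \<le> A + 2 * pi"
    and J: "J \<subseteq> upper" "\<And>w. w \<in> J \<Longrightarrow> Im w = 0 \<Longrightarrow> w = of_real A \<or> w = of_real B"
    and tr: "\<And>w (k::int). w \<in> J \<Longrightarrow> w + of_real (2 * pi * of_int k) \<in> J \<Longrightarrow> k \<noteq> (0::int) \<Longrightarrow>
        w \<in> {of_real A, of_real B} \<and> w + of_real (2 * pi * of_int k) \<in> {of_real A, of_real B}"
    and C: "C = inside J \<union> J"
  shows "\<And>w. w \<in> C \<Longrightarrow> w = of_real A \<or> w = of_real B \<or> 0 < Im w"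
    and "\<And>w (k::int). w \<in> C \<Longrightarrow> w + of_real (2 * pi * of_int k) \<in> C \<Longrightarrow> k \<noteq> (0::int) \<Longrightarrow>
        w \<in> {of_real A, of_real B} \<and> w + of_real (2 * pi * of_int k) \<in> {of_real A, of_real B}"
proof -
  let ?U = "inside J" and ?a = "of_real A :: complex" and ?b = "of_real B :: complex"
  have closedp: "pathfinish p = pathstart p" using p by simp
  note Jd = Jordan_inside_outside[OF p(1) closedp, unfolded p(4)]
  have oU: "open ?U" and conU: "connected ?U" and frU: "frontier ?U = J" using Jd by auto
  have clU: "closure ?U = C" using frU C by (simp add: closure_Un_frontier)
  have aJ: "?a \<in> J" using p pathstart_in_path_image[of p] by simp
  have bJ: "?b \<in> J" using q pathstart_in_path_image[of q] by simp
  have ab: "?a \<noteq> ?b" using AB by simp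
  have posU: "0 < Im w" if w: "w \<in> ?U" for w
  proof -
    obtain e where e: "e > 0" "ball w e \<subseteq> ?U" using oU w open_contains_ball by blast
    have "w - \<i> * of_real (e/2) \<in> ball w e" using e(1) by (simp add: dist_norm norm_mult)
    then have "w - \<i> * of_real (e/2) \<in> upper" using e(2) outside_of_upper_curve[OF J(1)] by blast
    then show ?thesis using e(1) by (simp add: upper_def)
  qed
  show posC: "w = ?a \<or> w = ?b \<or> 0 < Im w" if w: "w \<in> C" for w
  proof (cases "w \<in> ?U")
    case True then show ?thesis using posU by simp
  next
    case False
    then have wJ: "w \<in> J" using w C by blast
    then have "0 \<le> Im w" using J(1) by (auto simp: upper_def)
    then show ?thesis using J(2)[OF wJ] by fastforce
  qed
  have realout: "of_real x \<in> outside J" if "x \<noteq> A" "x \<noteq> B" for x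
  proof -
    have "(of_real x :: complex) \<notin> C" using posC[of "of_real x"] that by auto
    then show ?thesis using C inside_Un_outside[of J] by blast
  qed
  have conA: "connected (J - {?a})" using connected_simple_path_endless[OF p(1)] p by simp
  have conB: "connected (J - {?b})" using connected_simple_path_endless[OF q(1)] q by simp
  \<comment> \<open>A translated connected piece of \<open>J\<close> that avoids \<open>J\<close>
    lies on one side of it. If it contains a real point other than \<open>A\<close> and
    \<open>B\<close>, that side is the outside.\<close>
  have sep: "w + of_real t \<notin> ?U"
    if S: "connected S" "S \<subseteq> J" "w \<in> S" "of_real x \<in> S" "x + t \<noteq> A" "x + t \<noteq> B"
      and dis: "\<And>z. z \<in> S \<Longrightarrow> z + of_real t \<notin> J" for S w x t
  proof
    assume wU: "w + of_real t \<in> ?U"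
    have "connected ((\<lambda>z. z + of_real t) ` S)"
      by (rule connected_continuous_image[OF _ S(1)]) (intro continuous_intros)
    then have "connected_component (- J) (w + of_real t) (of_real x + of_real t)"
      by (rule connected_component_joinI) (use S(3,4) dis in auto)
    then have "of_real x + of_real t \<in> inside J" using wU by (rule inside_same_component)
    moreover have "of_real x + of_real t \<in> outside J" using realout[OF S(5,6)] by simp
    ultimately show False using inside_Int_outside[of J] by blast
  qed
  \<comment> \<open>Translating to the right may move \<open>A\<close> onto \<open>B\<close>, so
    \<open>A\<close> is removed first, and the translate of \<open>B\<close> serves as the real
    point; for a translation to the left the roles are exchanged.\<close>
  have JU: "w + of_real (2 * pi * of_int k) \<notin> ?U" if w: "w \<in> J" and k: "k \<noteq> 0" for w and k :: int
  proof -
    let ?t = "2 * pi * of_int k"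
    have realU: "of_real x \<notin> ?U" for x using posU[of "of_real x"] by auto
    consider "k \<ge> 1" | "k \<le> -1" using k by linarith
    then show ?thesis
    proof cases
      case 1
      then have "2 * pi * real_of_int k \<ge> 2 * pi * 1" by (intro mult_left_mono) auto
      then have t: "?t > 0" using pi_gt_zero by linarith
      show ?thesis
      proof (cases "w = ?a")
        case True then show ?thesis using realU[of "A + ?t"] by simp
      next
        case False
        show ?thesis
        proof (rule sep[OF conA])
          fix z assume z: "z \<in> J - {?a}"
          show "z + of_real ?t \<notin> J"
          proof
            assume "z + of_real ?t \<in> J"
            then have "z = ?b" "z + of_real ?t \<in> {?a, ?b}" using tr[of z k] z k by auto
            then have "of_real (B + ?t) = ?a \<or> of_real (B + ?t) = ?b" by simp
            then have "B + ?t = A \<or> B + ?t = B" by (simp only: of_real_eq_iff)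
            then show False using t AB by linarith
          qed
        qed (use w False bJ ab t AB in auto)
      qed
    next
      case 2
      then have "2 * pi * real_of_int k \<le> 2 * pi * (-1)" by (intro mult_left_mono) auto
      then have t: "?t < 0" using pi_gt_zero by linarith
      show ?thesis
      proof (cases "w = ?b")
        case True then show ?thesis using realU[of "B + ?t"] by simp
      next
        case False
        show ?thesis
        proof (rule sep[OF conB])
          fix z assume z: "z \<in> J - {?b}"
          show "z + of_real ?t \<notin> J"
          proof
            assume "z + of_real ?t \<in> J"
            then have "z = ?a" "z + of_real ?t \<in> {?a, ?b}" using tr[of z k] z k by auto
            then have "of_real (A + ?t) = ?a \<or> of_real (A + ?t) = ?b" by simp
            then have "A + ?t = A \<or> A + ?t = B" by (simp only: of_real_eq_iff)
            then show False using t AB by linarith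
          qed
        qed (use w False aJ ab t AB in auto)
      qed
    qed
  qed
  have main: "w \<in> {?a, ?b} \<and> w + of_real (2 * pi * k) \<in> {?a, ?b}"
    if w: "w \<in> C" "w + of_real (2 * pi * k) \<in> C" and k: "k \<ge> 1" for w and k :: int
  proof -
    let ?t = "of_real (2 * pi * of_int k) :: complex"
    have "2 * pi * real_of_int k \<ge> 2 * pi * 1" using k by (intro mult_left_mono) auto
    then have t: "2 * pi * real_of_int k > 0" using pi_gt_zero by linarith
    have "w \<in> J"
    proof (rule ccontr)
      assume "w \<notin> J"
      then have wU: "w \<in> ?U" using w C by blast
      have "w + ?t \<notin> J"
      proof
        assume "w + ?t \<in> J"
        then have "(w + ?t) + of_real (2 * pi * of_int (- k)) \<notin> ?U" using JU[of "w + ?t" "- k"] k by simp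
        then show False using wU by simp
      qed
      then have wtU: "w + ?t \<in> ?U" using w C by blast
      \<comment> \<open>If a point and its translate both lay inside, the inside would be contained
        in its own translate, and \<open>A\<close> would be the translate of a real point of
        \<open>C\<close> to the left of \<open>A\<close>; but such points lie outside.\<close>
      let ?T = "(+) ?t ` ?U"
      have "?U \<inter> frontier ?T = {}"
      proof -
        have "frontier ?T = (+) ?t ` J" by (simp only: frontier_translation frU)
        moreover have "z + ?t \<notin> ?U" if "z \<in> J" for z using JU[OF that, of k] k by simp
        ultimately show ?thesis by (auto simp: add.commute)
      qed
      moreover have "w + ?t \<in> ?U \<inter> ?T" using wtU wU by (auto simp: add.commute)
      ultimately have "?U \<subseteq> ?T" using connected_Int_frontier[OF conU, of ?T] by blast
      then have "closure ?U \<subseteq> (+) ?t ` closure ?U" using closure_mono[of ?U ?T] by (simp only: closure_translation)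
      then have "?a \<in> (+) ?t ` C" using clU C aJ by blast
      then obtain z where z: "z \<in> C" "?a = ?t + z" by blast
      then have "z = of_real (A - 2 * pi * of_int k)" by (simp add: algebra_simps)
      then have "of_real (A - 2 * pi * of_int k) \<in> C" using z by simp
      moreover have "of_real (A - 2 * pi * of_int k) \<in> outside J" by (rule realout) (use t AB in linarith)+
      ultimately show False using C inside_Int_outside[of J] outside_no_overlap[of J] by blast
    qed
    moreover have "w + ?t \<in> J" using JU[OF \<open>w \<in> J\<close>, of k] k w C by auto
    ultimately show ?thesis using tr[of w k] k by simp
  qed
  show "w \<in> {?a, ?b} \<and> w + of_real (2 * pi * k) \<in> {?a, ?b}"
    if w: "w \<in> C" "w + of_real (2 * pi * k) \<in> C" and k: "k \<noteq> 0" for w and k :: int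
  proof (cases "k \<ge> 1")
    case True then show ?thesis using main w by blast
  next
    case False
    then have "- k \<ge> 1" using k by simp
    moreover have "(w + of_real (2 * pi * k)) + of_real (2 * pi * of_int (- k)) = w" by simp
    ultimately show ?thesis using main[of "w + of_real (2 * pi * k)" "- k"] w by simp
  qed
qed

text \<open>For real \<open>A < B\<close> the graph of this parabola lifts the standard arc.  Nested intervals have
  nested parabolas, so standard arcs are disjoint whenever their intervals are not interlaced.\<close>

definition parabola :: "real \<Rightarrow> real \<Rightarrow> real \<Rightarrow> real" where
  "parabola A B x = (x - A) * (B - x)"

lemma parabola_graph:
  "continuous_on S (parabola A B)" "parabola A B A = 0" "parabola A B B = 0"
  "x \<in> {A<..<B} \<Longrightarrow> 0 < parabola A B x"
  unfolding parabola_def by (auto intro!: continuous_intros)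

text \<open>The graph keeps away from all translates of the arc, so arc and graph bound a Jordan
  domain that meets its translates only at the two ends. In a disk model of this domain both
  boundary arcs are straightened to the same chord, and on the way every curve still projects to a
  simple arc.\<close>

lemma isotopic_graph_below:
  assumes P: "P \<subseteq> sphere 0 1" and h: "cover_path P A B h" and AB: "A < B"
    and pos: "\<And>s. s \<in> {0<..<1} \<Longrightarrow> 0 < Im (h s)"
  obtains r where "continuous_on {A..B} r" "r A = 0" "r B = 0" "\<And>x. x \<in> {A<..<B} \<Longrightarrow> 0 < r x"
    "isotopic_arcs P (\<lambda>s. cov (h s)) (\<lambda>s. cov (graph_path A B r s))"
proof -
  have B2: "B \<le> A + 2 * pi" by (rule cover_path_length[OF P h AB])
  have hh: "path h" "path_image h \<subseteq> upper" "h 0 = of_real A" "h 1 = of_real B" "cov A \<in> P" "cov B \<in> P"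
      "loop_free (\<lambda>s. cov (h s))"
    using h by (auto simp: cover_path_def)
  have ch: "continuous_on {0..1} h" using hh(1) by (simp add: path_def)
  let ?a = "of_real A :: complex" and ?b = "of_real B :: complex"
  have ab: "?a \<noteq> ?b" using AB by simp
  have hreal: "s = 0 \<or> s = 1" if "s \<in> {0..1}" "Im (h s) = 0" for s
    using pos[of s] that by force
  have hinj: "s = s' \<or> s = 0 \<and> s' = 1 \<or> s = 1 \<and> s' = 0"
    if "s \<in> {0..1}" "s' \<in> {0..1}" "cov (h s) = cov (h s')" for s s'
    using hh(7) that unfolding loop_free_def by blast
  \<comment> \<open>All lifts of the arc at once: the union of the translates of
    \<open>h\<close>.\<close>
  define G where "G = cov -` (cov ` path_image h)"
  have "closed G"
    unfolding G_def
  proof (rule closed_vimage)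
    have "compact (cov ` path_image h)"
      by (intro compact_continuous_image compact_path_image hh(1)) (intro continuous_intros)
    then show "closed (cov ` path_image h)" by (rule compact_imp_closed)
    show "continuous_on UNIV cov" by (intro continuous_on_cov continuous_on_id)
  qed
  have hG: "w \<in> G" if "w \<in> path_image h" for w using that by (auto simp: G_def)
  have Gtr: "w + of_real (2 * pi * k) \<in> G \<longleftrightarrow> w \<in> G" for w and k :: int
    by (simp only: G_def vimage_def mem_Collect_eq cov_shift)
  have aG: "?a \<in> G" "?b \<in> G"
    using hG[OF pathstart_in_path_image[of h]] hG[OF pathfinish_in_path_image[of h]] hh by (auto simp: pathstart_def pathfinish_def)
  \<comment> \<open>The factor 1/2 keeps a point of the graph strictly closer to the real point
    below it than \<open>G\<close> is.\<close>
  define r where "r = (\<lambda>x::real. infdist (of_real x) G / 2)"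
  have r0: "r A = 0" "r B = 0" using aG by (auto simp: r_def)
  have rcont: "continuous_on S r" for S unfolding r_def by (intro continuous_intros) auto
  have rpos: "0 < r x" if x: "x \<in> {A<..<B}" for x
  proof -
    have "of_real x \<notin> G"
    proof
      assume "of_real x \<in> G"
      then obtain s where s: "s \<in> {0..1}" "cov (of_real x) = cov (h s)" by (auto simp: G_def path_image_def)
      then obtain k :: int where k: "h s = of_real x + of_real (2 * pi * k)" using cov_eq by blast
      then have "s = 0 \<or> s = 1" using hreal[OF s(1)] by simp
      then have "of_real A = (of_real (x + 2 * pi * k)::complex) \<or> of_real B = (of_real (x + 2 * pi * k)::complex)"
        using k hh by auto
      then have "A = x + 2 * pi * k \<or> B = x + 2 * pi * k" by (simp only: of_real_eq_iff)
      then show False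
        using real_mod_interval[of x A B A k] real_mod_interval[of x A B B k] x B2 AB by auto
    qed
    then show ?thesis using infdist_pos_not_in_closed[OF \<open>closed G\<close>] aG by (auto simp: r_def)
  qed
  define K where "K = graph_path A B r"
  have Kc: "cover_path P A B K"
    unfolding K_def by (rule graph_path_cover[OF P AB B2 hh(5,6) rcont r0 rpos])
  have K01: "K 0 = ?a" "K 1 = ?b" and pK: "path K" and Kup: "path_image K \<subseteq> upper"
    using Kc by (auto simp: cover_path_def)
  have KG: "s = 0 \<or> s = 1" if s: "s \<in> {0..1}" "K s \<in> G" for s
  proof (rule ccontr)
    assume "\<not> ?thesis"
    then have "s \<in> {0<..<1}" using s by auto
    then have x: "A + (B - A) * s \<in> {A<..<B}" (is "?x \<in> _") by (rule graph_path_range(2)[OF AB])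
    have "infdist (of_real ?x) G \<le> dist (of_real ?x) (K s)" using s(2) by (rule infdist_le)
    also have "dist (of_real ?x) (K s) = r ?x"
      using rpos[OF x] by (simp add: K_def graph_path_def dist_norm cmod_def)
    finally show False using rpos[OF x] by (simp add: r_def)
  qed
  have KE: "w = ?a \<or> w = ?b" if w: "w \<in> path_image K" "w \<in> G" for w
  proof -
    obtain s where s: "s \<in> {0..1}" "w = K s" using w by (auto simp: path_image_def)
    then show ?thesis using KG[OF s(1)] w K01 by metis
  qed
  have hE: "w = ?a \<or> w = ?b" if w: "w \<in> path_image h" "Im w = 0" for w
  proof -
    obtain s where s: "s \<in> {0..1}" "w = h s" using w by (auto simp: path_image_def)
    then show ?thesis using hreal[OF s(1)] w hh(3,4) by metis
  qed
  have Kreal: "w = ?a \<or> w = ?b" if w: "w \<in> path_image K" "Im w = 0" for w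
  proof -
    obtain s where s: "s \<in> {0..1}" "w = K s" using w by (auto simp: path_image_def)
    have "\<not> s \<in> {0<..<1}" using rpos[OF graph_path_range(2)[OF AB]] w s by (force simp: K_def graph_path_def)
    then have "s = 0 \<or> s = 1" using s by auto
    then show ?thesis using K01 s by auto
  qed
  define J where "J = path_image h \<union> path_image K"
  have Jup: "J \<subseteq> upper" using hh Kup by (auto simp: J_def)
  have Jreal: "w = ?a \<or> w = ?b" if "w \<in> J" "Im w = 0" for w using that hE Kreal by (auto simp: J_def)
  have arch: "arc h"
    unfolding arc_def
  proof (intro conjI hh inj_onI)
    fix s s' assume s: "s \<in> {0..1}" "s' \<in> {0..1}" "h s = h s'"
    then have "s = s' \<or> s = 0 \<and> s' = 1 \<or> s = 1 \<and> s' = 0" using hinj[of s s'] by simp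
    then show "s = s'" using s(3) hh ab by auto
  qed
  have injK: "inj_on K {0..1}"
  proof (rule inj_onI)
    fix s s' assume "K s = K s'"
    then have "A + (B - A) * s = A + (B - A) * s'" by (simp add: K_def graph_path_def)
    then show "s = s'" using AB by simp
  qed
  have arcK: "arc K" unfolding arc_def using pK injK by blast
  have int: "path_image h \<inter> path_image K \<subseteq> {?a, ?b}" using KE hG by blast
  have trJ: "w \<in> {?a, ?b} \<and> w + of_real (2 * pi * k) \<in> {?a, ?b}"
    if w: "w \<in> J" "w + of_real (2 * pi * k) \<in> J" and k: "k \<noteq> 0" for w and k :: int
  proof -
    have hK: "w \<in> {?a, ?b} \<and> w + of_real (2 * pi * k) \<in> {?a, ?b}"
      if "w \<in> path_image h \<and> w + of_real (2 * pi * k) \<in> path_image K \<or>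
          w \<in> path_image K \<and> w + of_real (2 * pi * k) \<in> path_image h"
    proof -
      have "w \<in> G \<and> w + of_real (2 * pi * k) \<in> G" using that hG Gtr by blast
      then have "w = ?a \<or> w = ?b \<or> w + of_real (2 * pi * k) = ?a \<or> w + of_real (2 * pi * k) = ?b" using that KE by blast
      moreover have "Im (w + of_real (2 * pi * k)) = Im w" by simp
      ultimately have "Im w = 0" by (metis Im_complex_of_real)
      then show ?thesis using Jreal[of w] Jreal[of "w + of_real (2 * pi * k)"] w by simp
    qed
    consider "w \<in> path_image h" "w + of_real (2 * pi * k) \<in> path_image h"
      | "w \<in> path_image K" "w + of_real (2 * pi * k) \<in> path_image K"
      | "w \<in> path_image h \<and> w + of_real (2 * pi * k) \<in> path_image K \<or>
          w \<in> path_image K \<and> w + of_real (2 * pi * k) \<in> path_image h"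
      using w unfolding J_def by blast
    then show ?thesis
    proof cases
      case 1
      then obtain s s' where s: "s \<in> {0..1}" "s' \<in> {0..1}" "w = h s" "w + of_real (2 * pi * k) = h s'"
        by (auto simp: path_image_def)
      then have "cov (h s) = cov (h s')" using cov_eq by metis
      moreover have "s \<noteq> s'" using s k by auto
      ultimately have "s = 0 \<and> s' = 1 \<or> s = 1 \<and> s' = 0" using hinj[of s s'] s by blast
      then show ?thesis using s hh by auto
    next
      case 2
      then obtain s s' where s: "s \<in> {0..1}" "s' \<in> {0..1}" "w = K s" "w + of_real (2 * pi * k) = K s'"
        by (auto simp: path_image_def)
      have "cov (K s) = cov (K s')" using s cov_eq by metis
      moreover have "s \<noteq> s'" using s k by auto
      moreover have "loop_free (\<lambda>s. cov (K s))" using Kc by (simp add: cover_path_def)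
      ultimately have "s = 0 \<and> s' = 1 \<or> s = 1 \<and> s' = 0" using s(1,2) unfolding loop_free_def by blast
      then show ?thesis using s K01 by auto
    next
      case 3 then show ?thesis by (rule hK)
    qed
  qed
  have rK: "arc (reversepath K)" using arcK by (rule arc_reversepath)
  have ends: "pathstart h = ?a" "pathfinish h = ?b" "pathstart (reversepath K) = ?b" "pathfinish (reversepath K) = ?a"
    using hh K01 by (auto simp: pathstart_def pathfinish_def reversepath_def)
  define p where "p = h +++ reversepath K"
  define q where "q = reversepath K +++ h"
  have p: "simple_path p" "pathstart p = ?a" "pathfinish p = ?a" "path_image p = J"
    using simple_path_join_loop[OF arch rK] ends int by (auto simp: p_def J_def path_image_join)
  have q: "simple_path q" "pathstart q = ?b" "pathfinish q = ?b" "path_image q = J"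
    using simple_path_join_loop[OF rK arch] ends int by (auto simp: q_def J_def path_image_join)
  define C where "C = inside J \<union> J"
  have region1: "w = ?a \<or> w = ?b \<or> 0 < Im w" if "w \<in> C" for w
    by (rule jordan_region_translates(1)[OF p q AB B2 Jup _ _ C_def that]) (use Jreal trJ in blast)+
  have region2: "w \<in> {?a, ?b} \<and> w + of_real (2 * pi * of_int k) \<in> {?a, ?b}"
    if "w \<in> C" "w + of_real (2 * pi * of_int k) \<in> C" "k \<noteq> 0" for w and k :: int
    by (rule jordan_region_translates(2)[OF p q AB B2 Jup _ _ C_def that]) (use Jreal trJ in blast)+
  obtain f g where fg: "homeomorphism C (cball (0::complex) 1) f g" and fJ: "f ` J \<subseteq> sphere 0 1"
    using inside_homeomorphic_disc[OF p(1)] p unfolding C_def by metis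
  have hC: "h s \<in> C" and KC: "K s \<in> C" if "s \<in> {0..1}" for s
    using that by (auto simp: C_def J_def path_image_def)
  \<comment> \<open>Since \<open>C\<close> meets its translates only at the ends, any injective path
    in \<open>C\<close> between the two ends lifts a simple arc. Injectivity in the disk model is
    therefore what has to be checked along the isotopy.\<close>
  have inC: "cover_path P A B w"
    if w: "continuous_on {0..1} w" "inj_on w {0..1}" "\<And>s. s \<in> {0..1} \<Longrightarrow> w s \<in> C" "w 0 = ?a" "w 1 = ?b" for w
  proof -
    have wE: "s = 0 \<or> s = 1" if s: "s \<in> {0..1}" "w s = ?a \<or> w s = ?b" for s
      using s(2) w(4,5) inj_onD[OF w(2), of s 0] inj_onD[OF w(2), of s 1] s(1) by auto
    have wpos: "0 < Im (w s)" if "s \<in> {0<..<1}" for s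
      using region1[OF w(3), of s] wE[of s] that by auto
    have "loop_free (\<lambda>s. cov (w s))"
      unfolding loop_free_def
    proof (intro ballI impI)
      fix s s' :: real assume s: "s \<in> {0..1}" "s' \<in> {0..1}" "cov (w s) = cov (w s')"
      then obtain k :: int where k: "w s' = w s + of_real (2 * pi * k)" using cov_eq by blast
      show "s = s' \<or> s = 0 \<and> s' = 1 \<or> s = 1 \<and> s' = 0"
      proof (cases "k = 0")
        case True
        then have "w s = w s'" using k by simp
        then show ?thesis using inj_onD[OF w(2)] s by blast
      next
        case False
        have "w s + of_real (2 * pi * k) \<in> C" using w(3)[OF s(2)] k by simp
        then have "w s \<in> {?a, ?b} \<and> w s' \<in> {?a, ?b}"
          using region2[OF w(3)[OF s(1)] _ False] k by simp
        then show ?thesis using wE[OF s(1)] wE[OF s(2)] by auto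
      qed
    qed
    moreover have "0 \<le> Im (w s)" if "s \<in> {0..1}" for s using region1[OF w(3)[OF that]] by auto
    moreover have "cov (w s) \<notin> P" if "s \<in> {0<..<1}" for s using cov_real_in_P[OF P, of "w s"] wpos[OF that] by auto
    ultimately show ?thesis
      unfolding cover_path_def using w hh AB by (auto simp: path_def path_image_def upper_def)
  qed
  have fC: "continuous_on C f" "continuous_on (cball 0 1) g" and gf: "\<And>z. z \<in> C \<Longrightarrow> g (f z) = z"
    and fg': "\<And>z. z \<in> cball 0 1 \<Longrightarrow> f (g z) = z" and fim: "\<And>z. z \<in> C \<Longrightarrow> f z \<in> cball 0 1"
    and gim: "\<And>z. z \<in> cball 0 1 \<Longrightarrow> g z \<in> C"
    using fg by (auto simp: homeomorphism_def)
  have aJ: "?a \<in> J" "?b \<in> J" using p q pathstart_in_path_image[of p] pathstart_in_path_image[of q] by auto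
  have fn: "norm (f ?a) = 1" "norm (f ?b) = 1" using fJ aJ by auto
  have abC: "?a \<in> C" "?b \<in> C" using aJ by (auto simp: C_def)
  have fne: "f ?a \<noteq> f ?b" using gf[OF abC(1)] gf[OF abC(2)] ab by metis
  \<comment> \<open>The chord of the disk between the images of the two ends, transported back; both
    boundary arcs are shrunk onto it.\<close>
  define chord where "chord = (\<lambda>s::real. cov (g (f ?a + of_real s * (f ?b - f ?a))))"
  have to_chord: "isotopic_arcs P (\<lambda>s. cov (c s)) chord"
    if c: "continuous_on {0..1} c" "inj_on c {0..1}" "\<And>s. s \<in> {0..1} \<Longrightarrow> c s \<in> C" "c 0 = ?a" "c 1 = ?b" for c
  proof -
    let ?d = "\<lambda>s. f (c s)"
    have dc: "continuous_on {0..1} ?d" by (rule continuous_on_compose2[OF fC(1) c(1)]) (use c(3) in auto)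
    have dinj: "inj_on ?d {0..1}"
    proof (rule inj_onI)
      fix s s' assume s: "s \<in> {0..1}" "s' \<in> {0..1}" "f (c s) = f (c s')"
      then have "c s = c s'" using gf[OF c(3)[OF s(1)]] gf[OF c(3)[OF s(2)]] by metis
      then show "s = s'" using inj_onD[OF c(2)] s by blast
    qed
    have dim: "?d s \<in> cball 0 1" if "s \<in> {0..1}" for s using fim c(3)[OF that] by blast
    have ray: "?d 0 + of_real r * (?d 1 - ?d 0) \<notin> cball 0 1" if "r > 1" for r
      using chord_ray_leaves_disc[OF fn fne that] c(4,5) by simp
    have sh: "shrink ?d t s \<in> cball 0 1" if "t \<in> {0..1}" "s \<in> {0..1}" for t s
      by (rule shrink_in_convex[OF convex_cball dim that])
    have cont: "continuous_on ({0..1} \<times> {0..1}) (\<lambda>x. g (shrink ?d (fst x) (snd x)))"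
      by (rule continuous_on_compose2[OF fC(2) continuous_on_shrink[OF dc]]) (use sh in auto)
    show ?thesis
    proof (rule cover_path_isotopic[OF cont])
      fix t :: real assume t: "t \<in> {0..1}"
      show "cover_path P A B (\<lambda>s. g (shrink ?d t s))"
      proof (rule inC)
        show "continuous_on {0..1} (\<lambda>s. g (shrink ?d t s))"
          using continuous_on_slice[of "\<lambda>t s. g (shrink ?d t s)", OF cont t] .
        show "inj_on (\<lambda>s. g (shrink ?d t s)) {0..1}"
        proof (rule inj_onI)
          fix s s' :: real assume s: "s \<in> {0..1}" "s' \<in> {0..1}" "g (shrink ?d t s) = g (shrink ?d t s')"
          then have eq: "shrink ?d t s = shrink ?d t s'" using fg'[OF sh[OF t s(1)]] fg'[OF sh[OF t s(2)]] by metis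
          show "s = s'" by (rule shrink_inj[OF dinj dim ray t s(1,2) eq])
        qed
        show "g (shrink ?d t s) \<in> C" if "s \<in> {0..1}" for s using gim[OF sh[OF t that]] .
        show "g (shrink ?d t 0) = ?a" "g (shrink ?d t 1) = ?b"
          using shrink_ends[OF t, of ?d] c(4,5) gf abC by auto
      qed
    next
      fix s :: real assume s: "s \<in> {0..1}"
      show "cov (c s) = cov (g (shrink ?d 0 s))" using shrink_0[OF s, of ?d] gf[OF c(3)[OF s]] by simp
      have "shrink ?d 1 s = ?d 0 + of_real s * (?d 1 - ?d 0)" using shrink_right[of 1 s ?d] s by simp
      then show "chord s = cov (g (shrink ?d 1 s))" using c(4,5) by (simp add: chord_def)
    qed
  qed
  have "isotopic_arcs P (\<lambda>s. cov (h s)) chord"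
    by (rule to_chord[OF ch _ hC hh(3,4)]) (use arch in \<open>simp add: arc_def\<close>)
  moreover have "isotopic_arcs P (\<lambda>s. cov (K s)) chord"
    by (rule to_chord[OF _ injK KC K01]) (use pK in \<open>simp add: path_def\<close>)
  ultimately have "isotopic_arcs P (\<lambda>s. cov (h s)) (\<lambda>s. cov (K s))"
    using isotopic_arcs_sym isotopic_arcs_trans by blast
  then show thesis using that[OF rcont r0 rpos] by (simp add: K_def)
qed

theorem cover_path_isotopic_parabola:
  assumes P: "P \<subseteq> sphere 0 1" "closed P" and h: "cover_path P A B h" and AB: "A < B"
  shows "isotopic_arcs P (\<lambda>s. cov (h s)) (\<lambda>s. cov (graph_path A B (parabola A B) s))"
proof -
  have B2: "B \<le> A + 2 * pi" by (rule cover_path_length[OF P(1) h AB])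
  have cP: "cov A \<in> P" "cov B \<in> P" using h by (auto simp: cover_path_def)
  obtain h' where h': "cover_path P A B h'" "isotopic_arcs P (\<lambda>s. cov (h s)) (\<lambda>s. cov (h' s))"
    "\<And>s. s \<in> {0<..<1} \<Longrightarrow> 0 < Im (h' s)"
    using cover_path_push[OF P h] by blast
  obtain r where r: "continuous_on {A..B} r" "r A = 0" "r B = 0" "\<And>x. x \<in> {A<..<B} \<Longrightarrow> 0 < r x"
    "isotopic_arcs P (\<lambda>s. cov (h' s)) (\<lambda>s. cov (graph_path A B r s))"
    using isotopic_graph_below[OF P(1) h'(1) AB h'(3)] by blast
  have "isotopic_arcs P (\<lambda>s. cov (graph_path A B r s)) (\<lambda>s. cov (graph_path A B (parabola A B) s))"
    by (rule graph_paths_isotopic[OF P(1) AB B2 cP r(1-4) parabola_graph])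
  then show ?thesis using h'(2) r(5) isotopic_arcs_trans by blast
qed

section \<open>Invariants of isotopy and forced crossings\<close>

lemma isotopic_arcs_eq:
  assumes "marked_arc P g" "\<And>s. s \<in> {0..1} \<Longrightarrow> g s = g' s"
  shows "isotopic_arcs P g g'"
proof (rule isotopic_arcsI[of "\<lambda>t. g"])
  have "continuous_on {0..1} g" using assms(1) by (simp add: marked_arc_def simple_path_def path_def)
  then show "continuous_on ({0..1} \<times> {0..1}) (\<lambda>x. g (snd x))"
    by (rule continuous_on_compose2) (auto intro!: continuous_intros)
qed (use assms in auto)

lemma cover_path_reverse:
  assumes "cover_path P A B h"
  shows "cover_path P B A (\<lambda>s. h (1 - s))"
proof -
  have h: "path h" "path_image h \<subseteq> upper" "h 0 = of_real A" "h 1 = of_real B" "A \<noteq> B" "cov A \<in> P" "cov B \<in> P"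
      "\<And>s. s \<in> {0<..<1} \<Longrightarrow> cov (h s) \<notin> P" "loop_free (\<lambda>s. cov (h s))"
    using assms by (auto simp: cover_path_def)
  have "path (\<lambda>s. h (1 - s))" "path_image (\<lambda>s. h (1 - s)) \<subseteq> upper"
    using h(1,2) path_reversepath[of h] path_image_reversepath[of h] by (auto simp: reversepath_def)
  moreover have "loop_free (\<lambda>s. cov (h (1 - s)))"
    unfolding loop_free_def
  proof (intro ballI impI)
    fix x y :: real assume xy: "x \<in> {0..1}" "y \<in> {0..1}" "cov (h (1 - x)) = cov (h (1 - y))"
    then have "1 - x \<in> {0..1}" "1 - y \<in> {0..1}" by auto
    then have "1 - x = 1 - y \<or> 1 - x = 0 \<and> 1 - y = 1 \<or> 1 - x = 1 \<and> 1 - y = 0"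
      using h(9) xy(3) unfolding loop_free_def by blast
    then show "x = y \<or> x = 0 \<and> y = 1 \<or> x = 1 \<and> y = 0" by auto
  qed
  moreover have "cov (h (1 - s)) \<notin> P" if "s \<in> {0<..<1}" for s using h(8)[of "1 - s"] that by auto
  ultimately show ?thesis unfolding cover_path_def using h(3-7) by auto
qed

text \<open>The intermediate arcs never pass through the puncture: their interiors avoid it, and
  their ends are the fixed boundary points. So the winding number about it is constant.\<close>

lemma isotopic_lift_length:
  assumes P: "P \<subseteq> sphere 0 1" and iso: "isotopic_arcs P f g" and h: "cover_path P A B h" "cover_path P A' B' h'"
    and f: "\<And>s. s \<in> {0..1} \<Longrightarrow> f s = cov (h s)" and g: "\<And>s. s \<in> {0..1} \<Longrightarrow> g s = cov (h' s)"
  shows "B - A = B' - A'"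
proof -
  have hp: "path h" "h 0 = of_real A" "h 1 = of_real B" "cov A \<in> P" "cov B \<in> P" and hp': "path h'" "h' 0 = of_real A'" "h' 1 = of_real B'"
    using h by (auto simp: cover_path_def)
  from iso have "homotopic_paths (- {0}) (\<lambda>s. cov (h s)) (\<lambda>s. cov (h' s))"
  proof (rule isotopic_arcsD)
    fix H :: "real \<Rightarrow> real \<Rightarrow> complex"
    assume H: "continuous_on ({0..1} \<times> {0..1}) (\<lambda>x. H (fst x) (snd x))"
      "\<And>t. t \<in> {0..1} \<Longrightarrow> marked_arc P (H t)"
      "\<And>t. t \<in> {0..1} \<Longrightarrow> H t 0 = f 0" "\<And>t. t \<in> {0..1} \<Longrightarrow> H t 1 = f 1" "H 0 = f" "H 1 = g"
    have nz: "H t s \<noteq> 0" if ts: "t \<in> {0..1}" "s \<in> {0..1}" for t s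
    proof -
      consider "s = 0" | "s = 1" | "s \<in> {0<..<1}" using ts(2) by force
      then show ?thesis
      proof cases
        case 3
        then have "H t s \<in> H t ` {0<..<1}" by blast
        then have "H t s \<notin> marked_points P" using H(2)[OF ts(1)] unfolding marked_arc_def by blast
        then show ?thesis by (auto simp: marked_points_def)
      qed (use H(3,4)[OF ts(1)] f in auto)
    qed
    show "homotopic_paths (- {0}) (\<lambda>s. cov (h s)) (\<lambda>s. cov (h' s))"
      unfolding homotopic_paths
    proof (intro exI[of _ "\<lambda>x. H (fst x) (snd x)"] conjI ballI)
      show "(\<lambda>x. H (fst x) (snd x)) \<in> {0..1} \<times> {0..1} \<rightarrow> - {0}" using nz by auto
    qed (use H f g in \<open>auto simp: pathstart_def pathfinish_def\<close>)
  qed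
  then have "winding_number (\<lambda>s. cov (h s)) 0 = winding_number (\<lambda>s. cov (h' s)) 0"
    by (rule winding_number_homotopic_paths)
  then have "(of_real (B - A) :: complex) = of_real (B' - A')"
    unfolding winding_number_cov[OF hp(1)] winding_number_cov[OF hp'(1)] hp hp' by simp
  then show ?thesis by (simp only: of_real_eq_iff)
qed

text \<open>Radial shrinking leaves the circle at once, so it meets no marked point there. This is
  why \<open>cover_arc\<close> has no constructor for loops at the puncture.\<close>

lemma loop_at_puncture_contractible:
  assumes P: "P \<subseteq> sphere 0 1" and g: "path g" "path_image g \<subseteq> cball 0 1" "g 0 = 0" "g 1 = 0"
    and un: "\<And>s. s \<in> {0<..<1} \<Longrightarrow> g s \<notin> P"
  shows "homotopic_paths (cball 0 1 - (marked_points P - {0})) g (linepath 0 0)"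
  unfolding homotopic_paths
proof (intro exI[of _ "\<lambda>x. of_real (1 - fst x) * g (snd x)"] conjI ballI)
  have cg: "continuous_on {0..1} g" using g(1) by (simp add: path_def)
  have "continuous_on ({0..1} \<times> {0..1}) (\<lambda>x::real \<times> real. g (snd x))"
    by (rule continuous_on_compose2[OF cg]) (intro continuous_intros, auto)
  then show "continuous_on ({0..1} \<times> {0..1}) (\<lambda>x. of_real (1 - fst x) * g (snd x))"
    by (intro continuous_intros)
  have "of_real (1 - t) * g s \<in> cball 0 1 - (marked_points P - {0})" if ts: "t \<in> {0..1}" "s \<in> {0..1}" for t s
  proof -
    have gs: "norm (g s) \<le> 1" using g(2) ts by (auto simp: path_image_def image_subset_iff)
    have nm: "norm (of_real (1 - t) * g s) = (1 - t) * norm (g s)" using ts unfolding norm_mult norm_of_real by simp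
    have le: "(1 - t) * norm (g s) \<le> 1 - t" using gs ts by (simp add: mult_left_le)
    have "of_real (1 - t) * g s \<notin> P"
    proof
      assume c: "of_real (1 - t) * g s \<in> P"
      then have "norm (of_real (1 - t) * g s) = 1" using P by (auto simp: subset_iff)
      then have "t = 0" using nm le ts by auto
      then have "g s \<in> P" using c by simp
      then have "s \<noteq> 0" "s \<noteq> 1" using g P by auto
      then show False using un[of s] \<open>g s \<in> P\<close> ts by auto
    qed
    then show ?thesis using nm le ts by (auto simp: marked_points_def)
  qed
  then show "(\<lambda>x. of_real (1 - fst x) * g (snd x)) \<in> {0..1} \<times> {0..1} \<rightarrow> cball 0 1 - (marked_points P - {0})"
    by auto
qed (use g in \<open>auto simp: pathstart_def pathfinish_def linepath_def\<close>)

lemma marked_arc_radius: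
  assumes P: "P \<subseteq> sphere 0 1" and p: "p \<in> P"
  shows "marked_arc P (linepath 0 p)"
proof -
  have n: "norm p = 1" "p \<noteq> 0" using P p by auto
  have nl: "norm (linepath 0 p s) = \<bar>s\<bar>" for s using n by (simp add: linepath_def)
  have "linepath 0 p s \<notin> marked_points P" if s: "s \<in> {0<..<1}" for s
  proof -
    have "0 < norm (linepath 0 p s)" "norm (linepath 0 p s) < 1" using nl[of s] s by auto
    then show ?thesis using P by (auto simp: marked_points_def)
  qed
  moreover have "path_image (linepath 0 p) \<subseteq> cball 0 1"
  proof
    fix z assume "z \<in> path_image (linepath 0 p)"
    then obtain s where s: "s \<in> {0..1}" "z = linepath 0 p s" unfolding path_image_def by blast
    then have "norm z = \<bar>s\<bar>" using nl[of s] by (simp only:)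
    then show "z \<in> cball 0 1" using s(1) by simp
  qed
  moreover have "simple_path (linepath 0 p)" using n by (simp add: arc_imp_simple_path arc_linepath)
  moreover have "\<not> homotopic_paths S (linepath 0 p) (linepath 0 0)" for S
    using homotopic_paths_imp_pathfinish[of S "linepath 0 p" "linepath 0 0"] n by auto
  ultimately show ?thesis unfolding marked_arc_def using p by (auto simp: marked_points_def)
qed

lemma interior_image_reverse: "(\<lambda>s. g (1 - s)) ` {0<..<1::real} = g ` {0<..<1}"
proof (intro equalityI subsetI)
  fix y assume "y \<in> (\<lambda>s. g (1 - s)) ` {0<..<1}"
  then obtain x where "x \<in> {0<..<1}" "y = g (1 - x)" by blast
  then show "y \<in> g ` {0<..<1}" by (intro image_eqI[of _ _ "1 - x"]) auto
next
  fix y assume "y \<in> g ` {0<..<1}"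
  then obtain x where "x \<in> {0<..<1}" "y = g x" by blast
  then show "y \<in> (\<lambda>s. g (1 - s)) ` {0<..<1}" by (intro image_eqI[of _ _ "1 - x"]) auto
qed

text \<open>The lifts meet. If either parameter were an end of its interval, the meeting point would
  project into \<open>P\<close>, so the other would be an end too; but the four ends are such that
  no end of one lift is an end of the other.\<close>

lemma interlaced_arcs_cross:
  assumes h: "cover_path P A B h" and k: "cover_path P C D k" and less: "A < C" "C < B" "B < D"
  shows "(\<lambda>s. cov (h s)) ` {0<..<1} \<inter> (\<lambda>s. cov (k s)) ` {0<..<1} \<noteq> {}"
proof -
  have hh: "path h" "path_image h \<subseteq> upper" "h 0 = of_real A" "h 1 = of_real B" "cov A \<in> P" "cov B \<in> P"
      "\<And>s. s \<in> {0<..<1} \<Longrightarrow> cov (h s) \<notin> P" using h by (auto simp: cover_path_def)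
  have kk: "path k" "path_image k \<subseteq> upper" "k 0 = of_real C" "k 1 = of_real D" "cov C \<in> P" "cov D \<in> P"
      "\<And>s. s \<in> {0<..<1} \<Longrightarrow> cov (k s) \<notin> P" using k by (auto simp: cover_path_def)
  obtain s t where st: "s \<in> {0..1}" "t \<in> {0..1}" "h s = k t"
    using upper_paths_cross[OF hh(1-4) kk(1-4) less] by blast
  have sE: "s = 0 \<or> s = 1 \<or> s \<in> {0<..<1}" and tE: "t = 0 \<or> t = 1 \<or> t \<in> {0<..<1}" using st by auto
  have ne: "(of_real A :: complex) \<noteq> of_real C" "(of_real A :: complex) \<noteq> of_real D"
    "(of_real B :: complex) \<noteq> of_real C" "(of_real B :: complex) \<noteq> of_real D" using less by auto
  have "s \<in> {0<..<1}"
  proof (rule ccontr)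
    assume s: "s \<notin> {0<..<1}"
    then have "cov (k t) \<in> P" using sE st(3) hh(3-6) by metis
    then have "t = 0 \<or> t = 1" using tE kk(7) by blast
    then show False using s sE st(3) hh(3,4) kk(3,4) ne by metis
  qed
  moreover have "t \<in> {0<..<1}"
  proof (rule ccontr)
    assume t: "t \<notin> {0<..<1}"
    then have "cov (h s) \<in> P" using tE st(3) kk(3-6) by metis
    then show False using hh(7) calculation by blast
  qed
  ultimately show ?thesis using st(3) by fastforce
qed

text \<open>Upstairs the spoke climbs to infinite height. Cut off once it is higher than every point
  of \<open>h\<close>, it becomes a path to which \<open>upper_path_meets_ray\<close>
  applies.\<close>

lemma spoke_crosses_arc:
  assumes P: "P \<subseteq> sphere 0 1" and h: "cover_path P A B h"
    and g: "marked_arc P g" "g 0 = cov (of_real C)" "g 1 = 0" "cov (of_real C) \<in> P" and less: "A < C" "C < B"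
  shows "(\<lambda>s. cov (h s)) ` {0<..<1} \<inter> g ` {0<..<1} \<noteq> {}"
proof -
  have hh: "path h" "path_image h \<subseteq> upper" "h 0 = of_real A" "h 1 = of_real B" "cov A \<in> P" "cov B \<in> P"
      "\<And>s. s \<in> {0<..<1} \<Longrightarrow> cov (h s) \<notin> P" using h by (auto simp: cover_path_def)
  have sg: "simple_path g" "path_image g \<subseteq> cball 0 1" "g ` {0<..<1} \<inter> marked_points P = {}"
    using g by (auto simp: marked_arc_def)
  have cg: "continuous_on {0..1} g" using sg by (simp add: simple_path_def path_def)
  have gint: "g s \<notin> P" "g s \<noteq> 0" if "s \<in> {0<..<1}" for s
    using sg(3) imageI[OF that, of g] unfolding marked_points_def by blast+
  have "bounded (path_image h)" using hh by (simp add: bounded_path_image)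
  then obtain Y where Y: "\<And>z. z \<in> path_image h \<Longrightarrow> norm z \<le> Y" by (meson bounded_iff)
  have hY: "Im (h s) \<le> Y" if "s \<in> {0..1}" for s
    using Y[of "h s"] that abs_Im_le_cmod[of "h s"] by (auto simp: path_image_def)
  \<comment> \<open>A norm below \<open>exp (- (Y + 1))\<close> means a height above
    \<open>Y + 1\<close> in the lift.\<close>
  obtain d where d: "d > 0" "\<And>x. x \<in> {0..1} \<Longrightarrow> dist x 1 < d \<Longrightarrow> dist (g x) (g 1) < exp (- (Y + 1))"
    using cg unfolding continuous_on_iff by (metis atLeastAtMost_iff exp_gt_zero order_refl zero_le_one)
  define t0 where "t0 = 1 - min (1/2) (d/2)"
  have t0: "0 < t0" "t0 < 1" "dist t0 1 < d" using d(1) by (auto simp: t0_def dist_real_def min_def)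
  have small: "norm (g t0) < exp (- (Y + 1))" using d(2)[of t0] t0 g(3) by (simp add: dist_norm)
  define k where "k = (\<lambda>t. g (t0 * t))"
  have range: "t0 * t \<in> {0..t0}" if "t \<in> {0..1}" for t using t0 that by (auto simp: mult_left_le)
  have pk: "path k"
    unfolding path_def k_def
  proof (rule continuous_on_compose2[OF cg])
    show "continuous_on {0..1} (\<lambda>t. t0 * t)" by (intro continuous_intros)
    have "t0 * t \<in> {0..1}" if "t \<in> {0..1}" for t
      using range[OF that] t0(2) unfolding atLeastAtMost_iff by linarith
    then show "(\<lambda>t. t0 * t) ` {0..1} \<subseteq> {0..1}" by blast
  qed
  have kz: "k t \<noteq> 0" if "t \<in> {0..1}" for t
  proof (cases "t0 * t = 0")
    case True
  then have "k t = cov (of_real C)" using g(2) by (simp only: k_def)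
  then show ?thesis by simp
  next
    case False
    then have "t0 * t \<in> {0<..<1}"
      using range[OF that] t0(2) unfolding atLeastAtMost_iff greaterThanLessThan_iff by linarith
    then show ?thesis unfolding k_def by (rule gint(2))
  qed
  then have "0 \<notin> path_image k" by (auto simp: path_image_def)
  then obtain q where q: "path q" "q 0 = of_real C" "\<And>t. t \<in> {0..1} \<Longrightarrow> k t = cov (q t)"
    using path_lift[OF pk, of "of_real C"] g(2) by (auto simp: k_def)
  have "0 \<le> Im (q t)" if t: "t \<in> {0..1}" for t
  proof -
    have "t0 * t \<in> {0..1}" using range[OF t] t0(2) unfolding atLeastAtMost_iff by linarith
    then have "g (t0 * t) \<in> cball 0 1" using sg(2) unfolding path_image_def by blast
    then have "norm (k t) \<le> 1" by (simp add: k_def)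
    then show ?thesis using q(3)[OF t] by (simp add: norm_cov)
  qed
  then have qup: "path_image q \<subseteq> upper" by (auto simp: path_image_def upper_def)
  have "Y + 1 < Im (q 1)" using small q(3)[of 1] by (simp add: k_def norm_cov)
  then have high: "Im (h s) < Im (q 1)" if "s \<in> {0..1}" for s using hY[OF that] by linarith
  obtain s t where st: "s \<in> {0..1}" "t \<in> {0..1}" "h s = q t"
    using upper_path_meets_ray[OF hh(1-4) q(1) qup q(2) less high] by blast
  have eq: "cov (h s) = g (t0 * t)" using q(3)[OF st(2)] st(3) by (simp add: k_def)
  have ne: "(of_real A :: complex) \<noteq> of_real C" "(of_real B :: complex) \<noteq> of_real C" using less by auto
  have tE: "t = 0 \<or> t0 * t \<in> {0<..<1}"
  proof (cases "t = 0")
    case False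
    then have "0 < t0 * t" using t0(1) st(2) by simp
    moreover have "t0 * t \<le> t0" using range[OF st(2)] unfolding atLeastAtMost_iff by blast
    ultimately show ?thesis using t0(2) unfolding greaterThanLessThan_iff by linarith
  qed simp
  have sE: "s = 0 \<or> s = 1 \<or> s \<in> {0<..<1}" using st by auto
  have s: "s \<in> {0<..<1}"
  proof (rule ccontr)
    assume s: "s \<notin> {0<..<1}"
    then have "g (t0 * t) \<in> P" using sE eq hh(3-6) by metis
    then have "t = 0" using tE gint(1) by blast
    then show False using s sE st(3) hh(3,4) q(2) ne by metis
  qed
  then have "g (t0 * t) \<notin> P" using hh(7) eq by metis
  then have "t \<noteq> 0" using g(2,4) by (metis mult_zero_right)
  then have "t0 * t \<in> {0<..<1}" using tE by blast
  then show ?thesis using s eq by fastforce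
qed

section \<open>Arc classes as orbits of chords and spokes\<close>

lemma relpow_map:
  assumes "\<And>a b. (a, b) \<in> R \<Longrightarrow> (f a, f b) \<in> S" "(x, y) \<in> R ^^ k"
  shows "(f x, f y) \<in> S ^^ k"
  using assms(2)
proof (induction k arbitrary: y)
  case (Suc k)
  then show ?case using assms(1) by auto
qed auto

lemma enumerate_marked_points:
  fixes N :: nat
  assumes N: "N \<ge> 1" and P: "P \<subseteq> sphere 0 1" "card P = N"
  obtains \<theta> :: "int \<Rightarrow> real" where "strict_mono \<theta>" "\<And>i. \<theta> (i + int N) = \<theta> i + 2 * pi"
    "P = range (\<lambda>i. cov (of_real (\<theta> i)))"
proof -
  have fP: "finite P" using N P(2) card.infinite by fastforce
  have arg: "cov (of_real (Arg2pi p)) = p" if "p \<in> P" for p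
  proof -
    have "norm p = 1" using P(1) that by auto
    then show ?thesis using Arg2pi[of p] by (simp add: cov_def is_Arg_def)
  qed
  define S where "S = Arg2pi ` P"
  have "inj_on Arg2pi P" by (rule inj_onI) (metis arg)
  then have S: "finite S" "card S = N" using fP P(2) by (auto simp: S_def card_image)
  have Srange: "0 \<le> x \<and> x < 2 * pi" if "x \<in> S" for x using that Arg2pi by (auto simp: S_def)
  define xs where "xs = sorted_list_of_set S"
  have xs: "length xs = N" "set xs = S" "sorted_wrt (<) xs" using S by (auto simp: xs_def)
  define n where "n = int N"
  have n: "n \<ge> 1" using N by (simp add: n_def)
  \<comment> \<open>The sorted arguments are continued periodically, with one full turn for every
    \<open>n\<close> indices. The step from residue \<open>n - 1\<close> to residue 0 is an increase
    because all arguments lie within one turn.\<close>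
  define \<theta> where "\<theta> = (\<lambda>i. xs ! nat (i mod n) + 2 * pi * of_int (i div n))"
  have idx: "nat (i mod n) < length xs" for i
    using n pos_mod_bound[of n i] pos_mod_sign[of n i] xs(1) by (simp add: n_def nat_less_iff)
  have inS: "xs ! nat (i mod n) \<in> S" for i using nth_mem[OF idx[of i]] xs(2) by simp
  have step: "\<theta> i < \<theta> (i + 1)" for i
  proof (cases "i mod n = n - 1")
    case True
    have e: "i + 1 = n * (i div n + 1)" using True div_mult_mod_eq[of i n] unfolding distrib_left mult.commute[of n] by linarith
    have "(i + 1) mod n = 0" unfolding e by simp
    moreover have "(i + 1) div n = i div n + 1" unfolding e using n by simp
    ultimately have "\<theta> (i + 1) = xs ! nat 0 + 2 * pi * of_int (i div n) + 2 * pi"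
      by (simp add: \<theta>_def algebra_simps)
    moreover have "0 \<le> xs ! nat 0" using inS[of 0] Srange by simp
    moreover have "xs ! nat (i mod n) < 2 * pi" using inS[of i] Srange by blast
    ultimately show ?thesis by (simp add: \<theta>_def)
  next
    case False
    then have r: "i mod n + 1 < n" using n pos_mod_bound[of n i] by linarith
    have r0: "0 \<le> i mod n" using n by simp
    have e: "i + 1 = (i mod n + 1) + (i div n) * n" using div_mult_mod_eq[of i n] by linarith
    have m: "(i mod n + 1) mod n = i mod n + 1" and d: "(i mod n + 1) div n = 0"
      using r r0 by (simp_all add: mod_pos_pos_trivial div_pos_pos_trivial)
    have "(i + 1) mod n = i mod n + 1" unfolding e mod_mult_self1 by (rule m)
    moreover have "n \<noteq> 0" using n by simp
    then have "(i + 1) div n = i div n" unfolding e div_mult_self1[OF \<open>n \<noteq> 0\<close>] d by simp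
    moreover have "xs ! nat (i mod n) < xs ! nat (i mod n + 1)"
      by (rule sorted_wrt_nth_less[OF xs(3)]) (use r r0 xs(1) in \<open>auto simp: n_def\<close>)
    ultimately show ?thesis by (simp add: \<theta>_def)
  qed
  have mono: "strict_mono \<theta>"
  proof (rule strict_monoI)
    fix i j :: int assume "i < j"
    then have "i + 1 \<le> j" by simp
    then show "\<theta> i < \<theta> j"
    proof (induction j rule: int_ge_induct[where k = "i + 1"])
      case (step j)
      then show ?case using \<open>\<And>i. \<theta> i < \<theta> (i + 1)\<close>[of j] by simp
    qed (rule step)
  qed
  have per: "\<theta> (i + int N) = \<theta> i + 2 * pi" for i
    using n by (simp add: \<theta>_def algebra_simps flip: n_def)
  have cov\<theta>: "cov (of_real (\<theta> i)) = cov (of_real (xs ! nat (i mod n)))" for i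
    using cov_shift[of "of_real (xs ! nat (i mod n))" "i div n"] by (simp add: \<theta>_def)
  have "P = range (\<lambda>i. cov (of_real (\<theta> i)))"
  proof (intro equalityI subsetI)
    fix p assume p: "p \<in> P"
    then have "Arg2pi p \<in> set xs" using xs(2) by (simp add: S_def)
    then obtain j where j: "j < N" "xs ! j = Arg2pi p" using xs(1) by (metis in_set_conv_nth)
    then have "nat (int j mod n) = j" by (simp add: n_def)
    then have "cov (of_real (\<theta> (int j))) = p" using cov\<theta>[of "int j"] j(2) arg[OF p] by simp
    then show "p \<in> range (\<lambda>i. cov (of_real (\<theta> i)))" by (metis rangeI)
  next
    fix p assume "p \<in> range (\<lambda>i. cov (of_real (\<theta> i)))"
    then obtain i where "p = cov (of_real (xs ! nat (i mod n)))" using cov\<theta> by auto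
    then show "p \<in> P" using inS[of i] arg by (auto simp: S_def)
  qed
  then show thesis using that[OF mono per] by blast
qed

locale marked_disc =
  fixes P :: "complex set" and n :: int and \<theta> :: "int \<Rightarrow> real"
  assumes n: "n \<ge> 1" and P: "P \<subseteq> sphere 0 1" "closed P"
    and mono: "strict_mono \<theta>" and per: "\<And>i. \<theta> (i + n) = \<theta> i + 2 * pi"
    and Pimage: "P = range (\<lambda>i. cov (of_real (\<theta> i)))"
begin

fun std :: "cover_arc \<Rightarrow> real \<Rightarrow> complex" where
  "std (Chord i j) = (\<lambda>s. cov (graph_path (\<theta> i) (\<theta> j) (parabola (\<theta> i) (\<theta> j)) s))"
| "std (Spoke i) = linepath 0 (cov (of_real (\<theta> i)))"

definition cls :: "cover_arc \<Rightarrow> (real \<Rightarrow> complex) set" where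
  "cls x = isotopy_rel P `` {std x}"

lemma theta_less [simp]: "\<theta> i < \<theta> j \<longleftrightarrow> i < j" and theta_le [simp]: "\<theta> i \<le> \<theta> j \<longleftrightarrow> i \<le> j" and theta_eq [simp]: "\<theta> i = \<theta> j \<longleftrightarrow> i = j"
  using mono by (auto simp: strict_mono_less strict_mono_less_eq strict_mono_eq)

lemma period: "\<theta> (i + k * n) = \<theta> i + 2 * pi * of_int k"
proof (induction k rule: int_induct[where k = 0])
  case (step1 k)
  have "\<theta> (i + (k + 1) * n) = \<theta> (i + k * n) + 2 * pi" using per[of "i + k * n"] by (simp add: algebra_simps)
  then show ?case using step1 by (simp add: algebra_simps)
next
  case (step2 k)
  have "\<theta> (i + k * n) = \<theta> (i + (k - 1) * n) + 2 * pi" using per[of "i + (k - 1) * n"] by (simp add: algebra_simps)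
  then show ?case using step2 by (simp add: algebra_simps)
qed simp

lemma covP [simp]: "cov (of_real (\<theta> i)) \<in> P"
  using Pimage by blast

lemma cov_theta_eq: "cov (of_real a) = cov (of_real (\<theta> i)) \<Longrightarrow> \<exists>k. a = \<theta> (i + k * n)"
proof -
  assume "cov (of_real a) = cov (of_real (\<theta> i))"
  then obtain k :: int where "(of_real a :: complex) = of_real (\<theta> i) + of_real (2 * pi * k)"
    using cov_eq[of "of_real (\<theta> i)" "of_real a"] by metis
  then have "(of_real a :: complex) = of_real (\<theta> i + 2 * pi * k)" by simp
  then have "a = \<theta> i + 2 * pi * k" by (simp only: of_real_eq_iff)
  then show ?thesis using period[of i k] by (intro exI[of _ k]) simp
qed

lemma real_in_P: "cov (of_real a) \<in> P \<Longrightarrow> \<exists>i. a = \<theta> i"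
  using cov_theta_eq Pimage by blast

lemma valid_le: "valid n (Chord i j) \<longleftrightarrow> i < j \<and> \<theta> j \<le> \<theta> i + 2 * pi"
  using theta_le[of j "i + n"] per[of i] by (simp del: theta_le)

lemma std_cover:
  assumes "valid n (Chord i j)"
  shows "cover_path P (\<theta> i) (\<theta> j) (graph_path (\<theta> i) (\<theta> j) (parabola (\<theta> i) (\<theta> j)))"
  by (rule graph_path_cover[OF P(1) _ _ _ _ parabola_graph]) (use assms valid_le in auto)

lemma std_marked:
  assumes "valid n x"
  shows "marked_arc P (std x)"
proof (cases x)
  case (Chord i j)
  then show ?thesis using cover_path_marked[OF std_cover[of i j]] assms by simp
next
  case (Spoke i)
  then show ?thesis using marked_arc_radius[OF P(1) covP[of i]] by simp
qed

lemma std_shift: "std (shift (k * n) x) = std x"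
proof (cases x)
  case (Chord i j)
  have "graph_path (\<theta> i + 2 * pi * of_int k) (\<theta> j + 2 * pi * of_int k)
      (parabola (\<theta> i + 2 * pi * of_int k) (\<theta> j + 2 * pi * of_int k)) s =
      graph_path (\<theta> i) (\<theta> j) (parabola (\<theta> i) (\<theta> j)) s + of_real (2 * pi * of_int k)" for s
    by (simp add: graph_path_def parabola_def complex_eq_iff algebra_simps)
  then show ?thesis using Chord by (auto simp: period cov_shift simp del: of_real_mult)
next
  case (Spoke i)
  have "cov (of_real (\<theta> i) + of_real (2 * pi * of_int k)) = cov (of_real (\<theta> i))" by (rule cov_shift)
  then show ?thesis using Spoke by (simp add: period)
qed

lemma cls_shift [simp]: "cls (shift (k * n) x) = cls x"
  by (simp add: cls_def std_shift)

text \<open>Loops at the puncture are excluded because they are contractible. An arc that ends at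
  the puncture but starts on the circle, or whose lift runs to the left, is reversed first.\<close>

lemma marked_arc_standard:
  assumes g: "marked_arc P g"
  obtains x where "valid n x" "(g, std x) \<in> isotopy_rel P"
proof -
  have sg: "simple_path g" "path_image g \<subseteq> cball 0 1" "g ` {0<..<1} \<inter> marked_points P = {}"
    "pathstart g \<in> marked_points P" "pathfinish g \<in> marked_points P"
    using g by (auto simp: marked_arc_def)
  have rg: "marked_arc P (reversepath g)" by (rule marked_arc_reversepath[OF g])
  have relI: "(g, std x) \<in> isotopy_rel P" if "valid n x" "isotopic_arcs P g (std x)" for x
    using that g std_marked by (auto simp: isotopy_rel_def)
  have relI': "(g, std x) \<in> isotopy_rel P" if "valid n x" "isotopic_arcs P (reversepath g) (std x)" for x
  proof -
    have "isotopic_arcs P g (reversepath (std x))"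
      using isotopic_arcs_reversepath[OF that(2)] by simp
    then show ?thesis using that(1) g std_marked by (auto simp: isotopy_rel_def)
  qed
  consider "pathstart g = 0" "pathfinish g = 0" | "pathstart g = 0" "pathfinish g \<in> P"
    | "pathstart g \<in> P" "pathfinish g = 0" | "pathstart g \<in> P" "pathfinish g \<in> P"
    using sg(4,5) by (auto simp: marked_points_def)
  then show thesis
  proof cases
    case 1
    have "g s \<notin> P" if "s \<in> {0<..<1}" for s
      using sg(3) imageI[OF that, of g] unfolding marked_points_def by blast
    then have "homotopic_paths (cball 0 1 - (marked_points P - {0})) g (linepath 0 0)"
      using sg 1 by (intro loop_at_puncture_contractible[OF P(1)]) (auto simp: simple_path_def pathstart_def pathfinish_def)
    then show ?thesis using g 1 by (simp add: marked_arc_def)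
  next
    case 2
    obtain i where i: "pathfinish g = cov (of_real (\<theta> i))" using 2 Pimage by auto
    have "isotopic_arcs P g (std (Spoke i))" using spoke_isotopic_radius[OF P(1) g 2] i by simp
    then show ?thesis using that[of "Spoke i"] relI[of "Spoke i"] by simp
  next
    case 3
    obtain i where i: "pathstart g = cov (of_real (\<theta> i))" using 3 Pimage by auto
    have "isotopic_arcs P (reversepath g) (std (Spoke i))"
      using spoke_isotopic_radius[OF P(1) rg] i 3 by simp
    then show ?thesis using that[of "Spoke i"] relI'[of "Spoke i"] by simp
  next
    case 4
    obtain i where i: "cov (of_real (\<theta> i)) = pathstart g" using 4 Pimage by auto
    obtain B h where h: "cover_path P (\<theta> i) B h" "\<And>s. s \<in> {0..1} \<Longrightarrow> g s = cov (h s)"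
      using marked_arc_lift[OF P(1) g 4 i] by blast
    obtain j where j: "B = \<theta> j" using real_in_P[of B] h(1) by (auto simp: cover_path_def)
    have ne: "\<theta> i \<noteq> B" using h(1) by (simp add: cover_path_def)
    show ?thesis
    proof (cases "\<theta> i < B")
      case True
      have v: "valid n (Chord i j)"
        unfolding valid_le using cover_path_length[OF P(1) h(1) True] True j by simp
      have "isotopic_arcs P g (\<lambda>s. cov (h s))" by (rule isotopic_arcs_eq[OF g h(2)])
      then have "isotopic_arcs P g (std (Chord i j))"
        using cover_path_isotopic_parabola[OF P h(1) True] isotopic_arcs_trans j unfolding std.simps by blast
      then show ?thesis using that v relI by blast
    next
      case False
      then have less: "B < \<theta> i" using ne by simp
      have h': "cover_path P B (\<theta> i) (\<lambda>s. h (1 - s))" by (rule cover_path_reverse[OF h(1)])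
      have v: "valid n (Chord j i)"
        unfolding valid_le using cover_path_length[OF P(1) h' less] less j by simp
      have "isotopic_arcs P (reversepath g) (\<lambda>s. cov (h (1 - s)))"
        by (rule isotopic_arcs_eq[OF rg]) (use h(2) in \<open>auto simp: reversepath_def\<close>)
      then have "isotopic_arcs P (reversepath g) (std (Chord j i))"
        using cover_path_isotopic_parabola[OF P h' less] isotopic_arcs_trans j unfolding std.simps by blast
      then show ?thesis using that v relI' by blast
    qed
  qed
qed

lemma std_ends:
  "pathstart (std (Chord i j)) = cov (of_real (\<theta> i))" "pathfinish (std (Chord i j)) = cov (of_real (\<theta> j))"
  "pathstart (std (Spoke i)) = 0" "pathfinish (std (Spoke i)) = cov (of_real (\<theta> i))"
  by (auto simp: graph_path_def parabola_def pathstart_def pathfinish_def Complex_eq)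

text \<open>A representative, reversed if necessary, starts at the same marked point, so it has a
  lift starting at \<open>\<theta> i\<close>; invariance of the displacement forces the other end to
  be \<open>\<theta> j\<close>.\<close>

lemma chord_class_member:
  assumes v: "valid n (Chord i j)" and g: "(std (Chord i j), g) \<in> isotopy_rel P"
  obtains h where "cover_path P (\<theta> i) (\<theta> j) h" "g ` {0<..<1} = (\<lambda>s. cov (h s)) ` {0<..<1}"
proof -
  have main: "\<exists>h. cover_path P (\<theta> i) (\<theta> j) h \<and> (\<forall>s\<in>{0..1}. f s = cov (h s))"
    if iso: "isotopic_arcs P (std (Chord i j)) f" for f
  proof -
    note e = isotopic_arcs_ends[OF iso]
    have "cov (of_real (\<theta> i)) = pathstart f" "pathstart f \<in> P" "pathfinish f \<in> P"
      using e(3,4) unfolding std_ends by auto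
    then obtain B h where h: "cover_path P (\<theta> i) B h" "\<And>s. s \<in> {0..1} \<Longrightarrow> f s = cov (h s)"
      using marked_arc_lift[OF P(1) e(2)] by metis
    have "\<theta> j - \<theta> i = B - \<theta> i"
      by (rule isotopic_lift_length[OF P(1) iso std_cover[OF v] h(1) _ h(2)]) simp
    then show ?thesis using h by auto
  qed
  from g have "isotopic_arcs P (std (Chord i j)) g \<or> isotopic_arcs P (std (Chord i j)) (reversepath g)"
    by (simp add: isotopy_rel_def)
  then show thesis
  proof
    assume "isotopic_arcs P (std (Chord i j)) g"
    then obtain h where h: "cover_path P (\<theta> i) (\<theta> j) h" "\<And>s. s \<in> {0..1} \<Longrightarrow> g s = cov (h s)" using main by blast
    have "g ` {0<..<1} = (\<lambda>s. cov (h s)) ` {0<..<1}" by (rule image_cong) (use h(2) in auto)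
    then show thesis using that h(1) by blast
  next
    assume "isotopic_arcs P (std (Chord i j)) (reversepath g)"
    then obtain h where h: "cover_path P (\<theta> i) (\<theta> j) h" "\<And>s. s \<in> {0..1} \<Longrightarrow> reversepath g s = cov (h s)"
      using main by blast
    have "(\<lambda>s. g (1 - s)) ` {0<..<1} = (\<lambda>s. cov (h s)) ` {0<..<1}"
      by (rule image_cong) (use h(2) in \<open>auto simp: reversepath_def\<close>)
    then show thesis using that h(1) interior_image_reverse[of g] by simp
  qed
qed

text \<open>Representatives are oriented from the circle to the puncture, so that their lifts start
  on the real line.\<close>

lemma spoke_class_member:
  assumes g: "(std (Spoke i), g) \<in> isotopy_rel P"
  obtains f where "marked_arc P f" "f 0 = cov (of_real (\<theta> i))" "f 1 = 0" "g ` {0<..<1} = f ` {0<..<1}"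
proof -
  from g have "isotopic_arcs P (std (Spoke i)) g \<or> isotopic_arcs P (std (Spoke i)) (reversepath g)"
    by (simp add: isotopy_rel_def)
  then show thesis
  proof
    assume iso: "isotopic_arcs P (std (Spoke i)) g"
    note e = isotopic_arcs_ends[OF iso]
    have "reversepath g 0 = cov (of_real (\<theta> i))" "reversepath g 1 = 0"
      using e(3,4) unfolding std_ends by (auto simp: reversepath_def pathstart_def pathfinish_def)
    then show thesis
      using that[OF marked_arc_reversepath[OF e(2)]] interior_image_reverse[of g] by (simp add: reversepath_def)
  next
    assume iso: "isotopic_arcs P (std (Spoke i)) (reversepath g)"
    note e = isotopic_arcs_ends[OF iso]
    have "g 0 = cov (of_real (\<theta> i))" "g 1 = 0"
      using e(3,4) unfolding std_ends by (auto simp: reversepath_def pathstart_def pathfinish_def)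
    then show thesis using that[of g] g by (auto simp: isotopy_rel_def)
  qed
qed

end

text \<open>Widening the interval enlarges the factors of the product, strictly unless the ends
  agree.\<close>

lemma nested_parabolas:
  assumes "a \<le> c" "d \<le> b" "c < x" "x < d" "parabola a b x = parabola c d x"
  shows "a = c \<and> b = d"
proof -
  have eq: "(x - a) * (b - x) = (x - c) * (d - x)" using assms(5) by (simp add: parabola_def)
  have "(x - c) * (d - x) \<le> (x - c) * (b - x)" "(x - c) * (b - x) \<le> (x - a) * (b - x)"
    using assms by (auto intro!: mult_left_mono mult_right_mono)
  then have "(x - c) * (d - x) = (x - c) * (b - x)" "(x - c) * (b - x) = (x - a) * (b - x)" using eq by linarith+
  then show ?thesis using assms by auto
qed

text \<open>In the upper half-plane a radius becomes a vertical ray.\<close>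

lemma radius_point:
  assumes "0 < t"
  shows "linepath 0 (cov (of_real u)) t = cov (Complex u (- ln t))"
proof -
  have "\<i> * Complex u (- ln t) = \<i> * of_real u + of_real (ln t)" by (simp add: complex_eq_iff)
  then have "cov (Complex u (- ln t)) = cov (of_real u) * exp (of_real (ln t))"
    by (simp only: cov_def exp_add)
  also have "exp (of_real (ln t)) = (of_real t :: complex)" using assms by (simp add: exp_of_real)
  finally show ?thesis by (simp add: linepath_def scaleR_conv_of_real)
qed

lemma rel_ends:
  assumes "(f, g) \<in> isotopy_rel P"
  shows "pathstart g = pathstart f \<and> pathfinish g = pathfinish f \<or>
    pathstart g = pathfinish f \<and> pathfinish g = pathstart f"
proof -
  from assms have "isotopic_arcs P f g \<or> isotopic_arcs P f (reversepath g)" by (simp add: isotopy_rel_def)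
  then show ?thesis
  proof
    assume "isotopic_arcs P f g"
    from isotopic_arcs_ends(3,4)[OF this] show ?thesis by simp
  next
    assume "isotopic_arcs P f (reversepath g)"
    from isotopic_arcs_ends(3,4)[OF this] show ?thesis by simp
  qed
qed

section \<open>Equality and crossing of classes\<close>

context marked_disc
begin

text \<open>The initial marked point and the displacement determine a chord up to translation. The
  reversed case is impossible because the displacement would change its sign.\<close>

lemma rel_imp_orbit:
  assumes v: "valid n x" "valid n y" and rel: "(std x, std y) \<in> isotopy_rel P"
  shows "y \<in> orbit n x"
proof (cases x)
  case x: (Chord i j)
  show ?thesis
  proof (cases y)
    case y: (Chord a b)
    have vx: "valid n (Chord i j)" and vy: "valid n (Chord a b)" using v x y by simp_all
    have ij: "i < j" and ab: "a < b" using vx vy by simp_all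
    note cx = std_cover[OF vx] and cy = std_cover[OF vy]
    have sx: "std x s = cov (graph_path (\<theta> i) (\<theta> j) (parabola (\<theta> i) (\<theta> j)) s)"
      and sy: "std y s = cov (graph_path (\<theta> a) (\<theta> b) (parabola (\<theta> a) (\<theta> b)) s)" for s
      by (simp_all only: x y std.simps)
    from rel have "isotopic_arcs P (std x) (std y) \<or> isotopic_arcs P (std x) (reversepath (std y))"
      by (simp add: isotopy_rel_def)
    then show ?thesis
    proof
      assume iso: "isotopic_arcs P (std x) (std y)"
      have len: "\<theta> j - \<theta> i = \<theta> b - \<theta> a"
        by (rule isotopic_lift_length[OF P(1) iso cx cy sx sy])
      have "cov (of_real (\<theta> a)) = cov (of_real (\<theta> i))"
        using isotopic_arcs_ends(3)[OF iso] unfolding x y std_ends .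
      then obtain k where k: "\<theta> a = \<theta> (i + k * n)" using cov_theta_eq by blast
      have "\<theta> b = \<theta> (j + k * n)" using len k period[of i k] period[of j k] by linarith
      then have "y = shift (k * n) x" using k x y by simp
      then show ?thesis unfolding orbit_def by blast
    next
      assume iso: "isotopic_arcs P (std x) (reversepath (std y))"
      have "\<theta> j - \<theta> i = \<theta> a - \<theta> b"
        by (rule isotopic_lift_length[OF P(1) iso cx cover_path_reverse[OF cy] sx])
          (simp only: reversepath_def sy)
      moreover have "\<theta> i < \<theta> j" "\<theta> a < \<theta> b" using ij ab by simp_all
      ultimately show ?thesis by linarith
    qed
  next
    case y: (Spoke a)
    show ?thesis using rel_ends[OF rel] unfolding x y std_ends by simp
  qed
next
  case x: (Spoke i)
  show ?thesis
  proof (cases y)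
    case y: (Chord a b)
    show ?thesis using rel_ends[OF rel] unfolding x y std_ends by simp
  next
    case y: (Spoke a)
    have "cov (of_real (\<theta> a)) = cov (of_real (\<theta> i))" using rel_ends[OF rel] unfolding x y std_ends by simp
    then obtain k where k: "\<theta> a = \<theta> (i + k * n)" using cov_theta_eq by blast
    then have "y = shift (k * n) x" using x y by simp
    then show ?thesis unfolding orbit_def by blast
  qed
qed

lemma cls_eq_iff:
  assumes "valid n x" "valid n y"
  shows "cls x = cls y \<longleftrightarrow> y \<in> orbit n x"
proof
  assume "cls x = cls y"
  then have "(std x, std y) \<in> isotopy_rel P"
    unfolding cls_def using eq_equiv_class[OF _ equiv_isotopy_rel] std_marked[OF assms(2)] by blast
  then show "y \<in> orbit n x" by (rule rel_imp_orbit[OF assms])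
qed (auto simp: orbit_def)

lemma std_in_cls: assumes "valid n x" shows "std x \<in> cls x"
  unfolding cls_def using std_marked[OF assms] by (intro equiv_class_self[OF equiv_isotopy_rel] CollectI)

lemma arc_classes_eq: "arc_classes P = cls ` {x. valid n x}"
proof (intro equalityI subsetI)
  fix c assume "c \<in> arc_classes P"
  then obtain g where g: "marked_arc P g" "c = isotopy_rel P `` {g}" unfolding arc_classes_def quotient_def by blast
  obtain x where x: "valid n x" "(g, std x) \<in> isotopy_rel P" using marked_arc_standard[OF g(1)] by blast
  have "c = cls x" unfolding g(2) cls_def by (rule equiv_class_eq[OF equiv_isotopy_rel x(2)])
  then show "c \<in> cls ` {x. valid n x}" using x(1) by blast
next
  fix c assume "c \<in> cls ` {x. valid n x}"
  then obtain x where "valid n x" "c = isotopy_rel P `` {std x}" unfolding cls_def by blast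
  then show "c \<in> arc_classes P" unfolding arc_classes_def using std_marked by (auto intro: quotientI)
qed

fun lies_on :: "cover_arc \<Rightarrow> real \<Rightarrow> real \<Rightarrow> bool" where
  "lies_on (Chord i j) u v \<longleftrightarrow> \<theta> i < u \<and> u < \<theta> j \<and> v = parabola (\<theta> i) (\<theta> j) u"
| "lies_on (Spoke i) u v \<longleftrightarrow> u = \<theta> i"

lemma lies_on_shift: "lies_on (shift (k * n) x) (u + 2 * pi * of_int k) v \<longleftrightarrow> lies_on x u v"
proof (cases x)
  case (Chord i j)
  have "parabola (a + c) (b + c) (u + c) = parabola a b u" for a b c by (simp add: parabola_def)
  then show ?thesis unfolding Chord shift.simps lies_on.simps period by simp
next
  case (Spoke i)
  then show ?thesis unfolding Spoke shift.simps lies_on.simps period by simp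
qed

lemma std_interior:
  assumes "valid n x" "p \<in> std x ` {0<..<1}"
  obtains u v where "p = cov (Complex u v)" "lies_on x u v"
proof (cases x)
  case (Chord i j)
  obtain s where s: "s \<in> {0<..<1}" "p = std x s" using assms(2) by blast
  have "\<theta> i < \<theta> j" using assms(1) Chord by simp
  note r = graph_path_range(2)[OF this s(1)]
  show ?thesis
    by (rule that[of "\<theta> i + (\<theta> j - \<theta> i) * s" "parabola (\<theta> i) (\<theta> j) (\<theta> i + (\<theta> j - \<theta> i) * s)"])
      (use r s(2) Chord in \<open>simp_all add: graph_path_def\<close>)
next
  case (Spoke i)
  obtain s where s: "s \<in> {0<..<1}" "p = std x s" using assms(2) by blast
  then have "p = cov (Complex (\<theta> i) (- ln s))" using radius_point[of s "\<theta> i"] Spoke by simp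
  then show ?thesis using that Spoke by simp
qed

text \<open>Two intervals with a common interior point that are not interlaced are nested, and the
  parabolas of distinct nested intervals do not meet over the interior of the smaller one.\<close>

lemma lies_on_unique:
  assumes "lies_on x u v" "lies_on y u v" "\<not> crosses x y"
  shows "x = y"
proof (cases x)
  case x: (Chord i j)
  show ?thesis
  proof (cases y)
    case y: (Chord a b)
    have u: "\<theta> i < u" "u < \<theta> j" "\<theta> a < u" "u < \<theta> b"
      and e: "parabola (\<theta> i) (\<theta> j) u = parabola (\<theta> a) (\<theta> b) u" using assms x y by simp_all
    have "\<theta> i < \<theta> b" "\<theta> a < \<theta> j" using u by linarith+
    then have "i < b" "a < j" by simp_all
    then consider "i \<le> a" "b \<le> j" | "a \<le> i" "j \<le> b" using assms(3) x y by fastforce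
    then show ?thesis
    proof cases
      case 1
      then show ?thesis using nested_parabolas[OF _ _ u(3,4) e] x y by simp
    next
      case 2
      then show ?thesis using nested_parabolas[OF _ _ u(1,2) e[symmetric]] x y by simp
    qed
  qed (use assms x in auto)
next
  case x: (Spoke i)
  then show ?thesis using assms by (cases y) auto
qed

lemma std_disjoint:
  assumes v: "valid n x" "valid n y" and ne: "y \<notin> orbit n x" and nc: "\<And>k. \<not> crosses x (shift (k * n) y)"
  shows "std x ` {0<..<1} \<inter> std y ` {0<..<1} = {}"
proof (rule ccontr)
  assume "std x ` {0<..<1} \<inter> std y ` {0<..<1} \<noteq> {}"
  then obtain p where p: "p \<in> std x ` {0<..<1}" "p \<in> std y ` {0<..<1}" by blast
  obtain a b where ab: "p = cov (Complex a b)" "lies_on x a b" using std_interior[OF v(1) p(1)] .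
  obtain c d where cd: "p = cov (Complex c d)" "lies_on y c d" using std_interior[OF v(2) p(2)] .
  have "cov (Complex c d) = cov (Complex a b)" using ab(1) cd(1) by simp
  then obtain k :: int where "Complex a b = Complex c d + of_real (2 * pi * of_int k)" using cov_eq by blast
  then have "a = c + 2 * pi * of_int k" "b = d" by (simp_all add: complex_eq_iff)
  then have "lies_on (shift (k * n) y) a b" using lies_on_shift[of k y c d] cd(2) by (simp only:)
  then have eq: "x = shift (k * n) y" using lies_on_unique[OF ab(2)] nc by blast
  have "y = shift ((- k) * n) x" unfolding eq by simp
  then show False using ne unfolding orbit_def by blast
qed

text \<open>Non-crossing asks for one disjoint pair of representatives, so every pair has to be
  shown to meet. The description of the members of a class brings any pair into the form that the
  crossing lemmas require.\<close>

lemma crossing_classes: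
  assumes v: "valid n x" "valid n y" and c: "crosses x y"
  shows "\<not> noncrossing (cls x) (cls y)"
proof -
  have cc: "f ` {0<..<1} \<inter> g ` {0<..<1} \<noteq> {}"
    if fg: "valid n (Chord i j)" "valid n (Chord a b)" "f \<in> cls (Chord i j)" "g \<in> cls (Chord a b)"
      and less: "i < a" "a < j" "j < b" for i j a b f g
  proof -
    obtain h where h: "cover_path P (\<theta> i) (\<theta> j) h" "f ` {0<..<1} = (\<lambda>s. cov (h s)) ` {0<..<1}"
      using chord_class_member[OF fg(1)] fg(3) unfolding cls_def by blast
    obtain k where k: "cover_path P (\<theta> a) (\<theta> b) k" "g ` {0<..<1} = (\<lambda>s. cov (k s)) ` {0<..<1}"
      using chord_class_member[OF fg(2)] fg(4) unfolding cls_def by blast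
    show ?thesis unfolding h(2) k(2) by (rule interlaced_arcs_cross[OF h(1) k(1)]) (use less in simp_all)
  qed
  have cs: "f ` {0<..<1} \<inter> g ` {0<..<1} \<noteq> {}"
    if fg: "valid n (Chord i j)" "f \<in> cls (Chord i j)" "g \<in> cls (Spoke a)"
      and less: "i < a" "a < j" for i j a f g
  proof -
    obtain h where h: "cover_path P (\<theta> i) (\<theta> j) h" "f ` {0<..<1} = (\<lambda>s. cov (h s)) ` {0<..<1}"
      using chord_class_member[OF fg(1)] fg(2) unfolding cls_def by blast
    obtain k where k: "marked_arc P k" "k 0 = cov (of_real (\<theta> a))" "k 1 = 0" "g ` {0<..<1} = k ` {0<..<1}"
      using spoke_class_member[of a g] fg(3) unfolding cls_def by blast
    show ?thesis unfolding h(2) k(4)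
      by (rule spoke_crosses_arc[OF P(1) h(1) k(1-3) covP]) (use less in simp_all)
  qed
  have "f ` {0<..<1} \<inter> g ` {0<..<1} \<noteq> {}" if fg: "f \<in> cls x" "g \<in> cls y" for f g
  proof (cases x)
    case x: (Chord i j)
    show ?thesis
    proof (cases y)
      case y: (Chord a b)
      then consider "i < a" "a < j" "j < b" | "a < i" "i < b" "b < j" using c x by auto
      then show ?thesis
      proof cases
        case 1
        show ?thesis using cc[OF _ _ _ _ 1] v fg unfolding x y by blast
      next
        case 2
        show ?thesis using cc[OF _ _ _ _ 2] v fg unfolding x y by blast
      qed
    next
      case y: (Spoke a)
      then have "i < a" "a < j" using c x by simp_all
      from cs[OF _ _ _ this] show ?thesis using v fg unfolding x y by blast
    qed
  next
    case x: (Spoke a)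
    then obtain i j where y: "y = Chord i j" using c by (cases y) auto
    then have "i < a" "a < j" using c x by simp_all
    from cs[OF _ _ _ this] show ?thesis using v fg unfolding x y by blast
  qed
  then show ?thesis unfolding noncrossing_def by blast
qed

section \<open>Triangulations as maximal periodic families\<close>

definition lift :: "(real \<Rightarrow> complex) set set \<Rightarrow> cover_arc set" where
  "lift T = {x. valid n x \<and> cls x \<in> T}"

lemma family_lift:
  assumes "arc_system P T"
  shows "family n (lift T)"
  unfolding family_def
proof (intro conjI ballI allI)
  fix x show "shift n x \<in> lift T \<longleftrightarrow> x \<in> lift T" using cls_shift[of 1 x] by (simp add: lift_def)
next
  fix x y assume "x \<in> lift T" "y \<in> lift T"
  then have xy: "valid n x" "valid n y" "cls x \<in> T" "cls y \<in> T" by (simp_all add: lift_def)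
  show "\<not> crosses x y"
  proof (cases "y \<in> orbit n x")
    case True
    then show ?thesis using valid_not_crosses_orbit[OF xy(1) n] unfolding orbit_def by blast
  next
    case False
    then have "cls x \<noteq> cls y" using cls_eq_iff[OF xy(1,2)] by simp
    then have "noncrossing (cls x) (cls y)" using assms xy(3,4) unfolding arc_system_def pairwise_def by blast
    then show ?thesis using crossing_classes[OF xy(1,2)] by blast
  qed
qed (simp add: lift_def)

text \<open>One disjoint pair of representatives is enough, and the standard arcs provide
  it.\<close>

lemma arc_system_image:
  assumes F: "family n F"
  shows "arc_system P (cls ` F)"
proof -
  have v: "valid n x" if "x \<in> F" for x using F that by (simp add: family_def)
  have "noncrossing (cls x) (cls y)" if xy: "x \<in> F" "y \<in> F" "cls x \<noteq> cls y" for x y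
  proof -
    have no: "y \<notin> orbit n x" using xy(3) cls_eq_iff[OF v[OF xy(1)] v[OF xy(2)]] by simp
    have nc: "\<not> crosses x (shift (k * n) y)" for k
      using F xy(1) family_shift[OF F, of k y] xy(2) unfolding family_def by blast
    show ?thesis unfolding noncrossing_def
      using std_disjoint[OF v[OF xy(1)] v[OF xy(2)] no nc] std_in_cls[OF v[OF xy(1)]] std_in_cls[OF v[OF xy(2)]] by blast
  qed
  then show ?thesis unfolding arc_system_def pairwise_def arc_classes_eq using v by blast
qed

lemma image_lift:
  assumes "T \<subseteq> arc_classes P"
  shows "cls ` lift T = T"
proof (intro equalityI subsetI)
  fix c assume c: "c \<in> T"
  then obtain x where "valid n x" "c = cls x" using assms unfolding arc_classes_eq by blast
  then show "c \<in> cls ` lift T" using c by (auto simp: lift_def)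
qed (auto simp: lift_def)

lemma lift_image:
  assumes F: "family n F"
  shows "lift (cls ` F) = F"
proof (intro equalityI subsetI)
  fix x assume "x \<in> lift (cls ` F)"
  then obtain y where y: "valid n x" "y \<in> F" "cls x = cls y" by (auto simp: lift_def)
  have "x \<in> orbit n y" using cls_eq_iff[of y x] y F by (simp add: family_def)
  then show "x \<in> F" using orbit_subset_family[OF F y(2)] by blast
next
  fix x assume "x \<in> F"
  then show "x \<in> lift (cls ` F)" using F by (simp add: lift_def family_def)
qed

lemma triang_lift:
  assumes T: "T \<in> triangulations P"
  shows "triang n (lift T)"
proof -
  have sys: "arc_system P T" and max: "\<And>T'. arc_system P T' \<Longrightarrow> T \<subseteq> T' \<Longrightarrow> T' = T"
    using T by (auto simp: triangulations_def)
  have im: "cls ` lift T = T" using sys by (intro image_lift) (simp add: arc_system_def)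
  have "F = lift T" if F: "family n F" "lift T \<subseteq> F" for F
  proof -
    have "T \<subseteq> cls ` F" using image_mono[OF F(2), of cls] im by simp
    then have "cls ` F = T" by (rule max[OF arc_system_image[OF F(1)]])
    then show ?thesis using lift_image[OF F(1)] by simp
  qed
  then show ?thesis using family_lift[OF sys] unfolding triang_def by blast
qed

lemma triangulation_image:
  assumes F: "triang n F"
  shows "cls ` F \<in> triangulations P"
proof -
  have fam: "family n F" and max: "\<And>F'. family n F' \<Longrightarrow> F \<subseteq> F' \<Longrightarrow> F' = F" using F by (auto simp: triang_def)
  have "T = cls ` F" if T: "arc_system P T" "cls ` F \<subseteq> T" for T
  proof -
    have "F \<subseteq> lift T" using T(2) fam by (auto simp: lift_def family_def)
    then have "lift T = F" by (rule max[OF family_lift[OF T(1)]])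
    then show ?thesis using image_lift[of T] T(1) by (simp add: arc_system_def)
  qed
  then show ?thesis using arc_system_image[OF fam] unfolding triangulations_def by blast
qed

lemma image_orbit: "cls ` orbit n x = {cls x}"
  using orbit_refl[of x n] by (auto simp: orbit_def)

lemma flips_image:
  assumes "(T, T') \<in> tri_adj n"
  shows "(cls ` T, cls ` T') \<in> flips P"
proof -
  obtain x y where t: "triang n T" "triang n T'" and xy: "T - T' = orbit n x" "T' - T = orbit n y"
    using assms by (auto simp: tri_adj_def)
  \<comment> \<open>Taking classes commutes with differences because a periodic family contains
    every valid arc whose class it represents.\<close>
  have diff: "cls ` A - cls ` B = cls ` (A - B)" if A: "triang n A" and B: "triang n B" for A B
  proof -
    have "cls z \<notin> cls ` B" if "z \<in> A" "z \<notin> B" for z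
    proof
      assume "cls z \<in> cls ` B"
      moreover have "valid n z" using A that(1) by (simp add: triang_def family_def)
      ultimately have "z \<in> lift (cls ` B)" by (simp add: lift_def)
      then show False using lift_image[of B] B that(2) by (simp add: triang_def)
    qed
    then show ?thesis by blast
  qed
  have "cls ` T - cls ` T' = {cls x}" "cls ` T' - cls ` T = {cls y}"
    using diff[OF t] diff[OF t(2,1)] xy image_orbit by simp_all
  then show ?thesis using triangulation_image t by (simp add: flips_def)
qed

text \<open>The target is \<open>near\<close> because that relation, unlike a genuine flip, survives
  contraction.\<close>

lemma near_lift:
  assumes "(T, T') \<in> flips P"
  shows "(lift T, lift T') \<in> near n"
proof -
  have t: "T \<in> triangulations P" "T' \<in> triangulations P" and s: "is_singleton (T - T')" "is_singleton (T' - T)"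
    using assms by (auto simp: flips_def)
  have sub: "\<exists>x. lift A - lift B \<subseteq> orbit n x" if A: "A \<in> triangulations P" and AB: "is_singleton (A - B)" for A B
  proof -
    obtain c where c: "A - B = {c}" using AB by (auto simp: is_singleton_def)
    then have "c \<in> arc_classes P" using A by (auto simp: triangulations_def arc_system_def)
    then obtain x where x: "valid n x" "c = cls x" unfolding arc_classes_eq by blast
    have "z \<in> orbit n x" if z: "z \<in> lift A - lift B" for z
    proof -
      have "valid n z" "cls z \<in> A - B" using z by (auto simp: lift_def)
      then show ?thesis using cls_eq_iff[OF x(1)] c x(2) by auto
    qed
    then show ?thesis by blast
  qed
  show ?thesis using triang_lift[OF t(1)] triang_lift[OF t(2)] sub[OF t(1) s(1)] sub[OF t(2) s(2)] by (simp add: near_def)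
qed

end

theorem theorem1p1:
  fixes n :: nat and P :: "complex set"
  assumes "n \<ge> 1" and "P \<subseteq> sphere 0 1" and "card P = n"
  shows "graph_diameter (triangulations P) (flips P) = enat (2 * n - 2)"
proof -
  obtain \<theta> where th: "strict_mono \<theta>" "\<And>i. \<theta> (i + int n) = \<theta> i + 2 * pi" "P = range (\<lambda>i. cov (of_real (\<theta> i)))"
    using enumerate_marked_points[OF assms] by blast
  have "finite P" using assms(1,3) card.infinite by fastforce
  then have "closed P" by (rule finite_imp_closed)
  interpret marked_disc P "int n" \<theta>
    by unfold_locales (use assms(1,2) th \<open>closed P\<close> in auto)
  have n1: "int n \<ge> 1" using assms(1) by simp
  show ?thesis
  proof (rule antisym)
    have "graph_distance (flips P) T T' \<le> enat (2 * n - 2)"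
      if T: "T \<in> triangulations P" "T' \<in> triangulations P" for T T'
    proof -
      obtain k where k: "k \<le> 2 * nat (int n) - 2" "(lift T, lift T') \<in> tri_adj (int n) ^^ k"
        using tri_adj_distance_le[OF triang_lift[OF T(1)] triang_lift[OF T(2)] n1] by blast
      have "(cls ` lift T, cls ` lift T') \<in> flips P ^^ k"
        by (rule relpow_map[where R = "tri_adj (int n)"]) (use flips_image k(2) in auto)
      moreover have "cls ` lift T = T" "cls ` lift T' = T'"
        using T by (auto intro!: image_lift simp: triangulations_def arc_system_def)
      ultimately have "k \<in> {k. (T, T') \<in> flips P ^^ k}" by simp
      then have "graph_distance (flips P) T T' \<le> enat k" unfolding graph_distance_def by (rule INF_lower)
      also have "\<dots> \<le> enat (2 * n - 2)" using k(1) by simp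
      finally show ?thesis .
    qed
    then show "graph_diameter (triangulations P) (flips P) \<le> enat (2 * n - 2)"
      unfolding graph_diameter_def by (intro SUP_least) auto
  next
    have tr: "triang (int n) (fan (int n))" "triang (int n) (fan' (int n))"
      using triang_fan[OF n1] triang_fan'[OF n1] by simp_all
    \<comment> \<open>Any path of flips between the images of the two fans lifts to a
      \<open>near\<close> path of the same length, so the infimum defining the distance obeys the
      bound.\<close>
    have "enat (2 * n - 2) \<le> enat k"
      if k: "(cls ` fan (int n), cls ` fan' (int n)) \<in> flips P ^^ k" for k
    proof -
      have "(lift (cls ` fan (int n)), lift (cls ` fan' (int n))) \<in> near (int n) ^^ k"
        by (rule relpow_map[OF near_lift k])
      moreover have "lift (cls ` fan (int n)) = fan (int n)" "lift (cls ` fan' (int n)) = fan' (int n)"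
        using tr lift_image unfolding triang_def by blast+
      ultimately have "(fan (int n), fan' (int n)) \<in> near (int n) ^^ k" by simp
      then show ?thesis using fan_distance_ge[OF assms(1)] by simp
    qed
    then have "enat (2 * n - 2) \<le> graph_distance (flips P) (cls ` fan (int n)) (cls ` fan' (int n))"
      unfolding graph_distance_def by (intro INF_greatest) auto
    also have "\<dots> \<le> graph_diameter (triangulations P) (flips P)"
      unfolding graph_diameter_def
      by (rule SUP_upper2[of "(cls ` fan (int n), cls ` fan' (int n))"]) (use tr triangulation_image in auto)
    finally show "enat (2 * n - 2) \<le> graph_diameter (triangulations P) (flips P)" .
  qed
qed

end
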